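(* Let $(\mathfrak g,\mathfrak h,\rho,D)$ be a relative difference Lie algebra with Lie brackets $\pi$ on $\mathfrak g$ and $\mu$ on $\mathfrak h$, and set $\Pi=\pi+\rho+\mu$. Then $(s^{-1}\mathcal M\oplus F,\{l_k^{(s^{-1}\Pi,D)}\}_{k\ge1})$ is an $L_\infty$-algebra. Moreover, for linear maps $\pi'\in\mathrm{Hom}(\wedge^2\mathfrak g,\mathfrak g)$, $\mu'\in\mathrm{Hom}(\wedge^2\mathfrak h,\mathfrak h)$, $\rho'\in\mathrm{Hom}(\mathfrak g\otimes\mathfrak h,\mathfrak h)$, $D'\in\mathrm{Hom}(\mathfrak g,\mathfrak h)$, the following are equivalent: (a) $\pi+\pi'$ and $\mu+\mu'$ are Lie algebra structures on $\mathfrak g$ and $\mathfrak h$, $\rho+\rho'$ is an action of $(\mathfrak g,\pi+\pi')$ on $(\mathfrak h,\mu+\mu')$, and $D+D'$ is a relative difference operator with respect to it; (b) $(s^{-1}(\pi'+\mu'+\rho'),D')$ is a Maurer–Cartan element of $(s^{-1}\mathcal M\oplus F,\{l_k^{(s^{-1}\Pi,D)}\})$.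
   Context: For a vector space $V$, $L(V)=\bigoplus_{n\ge0}\mathrm{Hom}(\wedge^{n+1}V,V)$, elements of $\mathrm{Hom}(\wedge^{n+1}V,V)$ having degree $n$ ($|f|$). For $f\in\mathrm{Hom}(\wedge^mV,V)$, $g\in\mathrm{Hom}(\wedge^nV,V)$, $(f\circ g)(v_1,\dots,v_{m+n-1})=\sum_{\sigma\in S(n,m-1)}\mathrm{sgn}(\sigma)f(g(v_{\sigma(1)},\dots,v_{\sigma(n)}),v_{\sigma(n+1)},\dots,v_{\sigma(m+n-1)})$ and $[f,g]_{NR}=f\circ g-(-1)^{(m-1)(n-1)}g\circ f$. Maps $\kappa:\wedge^k\mathfrak g\otimes\wedge^l\mathfrak h\to\mathfrak g$ or $\mathfrak h$ are identified with their lifts $\hat\kappa(x_1+u_1,\dots,x_{k+l}+u_{k+l})=\sum_{\tau\in S(k,l)}\mathrm{sgn}(\tau)\kappa(x_{\tau(1)},\dots,x_{\tau(k)},u_{\tau(k+1)},\dots,u_{\tau(k+l)})$ in $L=L(\mathfrak g\oplus\mathfrak h)$. $F=\bigoplus_{n\ge0}\mathrm{Hom}(\wedge^{n+1}\mathfrak g,\mathfrak h)$, $P$ the projection of $L$ onto $F$, $\mathcal M=\bigoplus_{k\ge0}\big(\mathrm{Hom}(\wedge^{k+1}\mathfrak g,\mathfrak g)\oplus\bigoplus_{i+j=k+1,j\ge1}\mathrm{Hom}(\wedge^i\mathfrak g\otimes\wedge^j\mathfrak h,\mathfrak h)\big)$. Desuspension $(s^{-1}W)^i=W^{i+1}$.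 The $L_\infty$-algebra $s^{-1}\mathcal M\oplus F$ has brackets $l_1(s^{-1}f,\theta)=P(f)$, $l_2(s^{-1}f,s^{-1}g)=(-1)^{|f|}s^{-1}[f,g]_{NR}$, $l_k(s^{-1}f,\theta_1,\dots,\theta_{k-1})=P[\cdots[f,\theta_1]_{NR}\cdots,\theta_{k-1}]_{NR}$ ($k\ge2$), plus graded-symmetric permutations, all others zero. A Maurer–Cartan element of an $L_\infty$-algebra $(\mathfrak L,\{l_k\})$ is a degree 0 element $\alpha$ with $\sum_{k\ge1}\frac1{k!}l_k(\alpha,\dots,\alpha)=0$; the twisted brackets are $l_k^\alpha(x_1,\dots,x_k)=\sum_{n\ge0}\frac1{n!}l_{k+n}(\alpha,\dots,\alpha,x_1,\dots,x_k)$ ($n$ copies of $\alpha$). A relative difference Lie algebra $(\mathfrak g,\mathfrak h,\rho,D)$: Lie algebras $\mathfrak g,\mathfrak h$, a Lie algebra homomorphism $\rho:\mathfrak g\to\mathrm{Der}(\mathfrak h)$ (an action, identified with an element of $\mathrm{Hom}(\mathfrak g\otimes\mathfrak h,\mathfrak h)$), and a linear $D:\mathfrak g\to\mathfrak h$ with $D[x,y]_{\mathfrak g}=\rho(x)D(y)-\rho(y)D(x)+[D(x),D(y)]_{\mathfrak h}$ (a relative difference operator). By the known result, $(s^{-1}\Pi,D)$ is a Maurer–Cartan element of $s^{-1}\mathcal M\oplus F$. *)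

theory Defs
  imports Main "HOL.Vector_Spaces" "HOL-Combinatorics.Permutations" "HOL-Library.Function_Algebras"
          "HOL-Library.Product_Plus"
begin

definition sgnv :: "int \<Rightarrow> 'a::ab_group_add \<Rightarrow> 'a" where
  "sgnv e v = (if even e then v else - v)"

definition psgn :: "(nat \<Rightarrow> nat) \<Rightarrow> 'a::ab_group_add \<Rightarrow> 'a" where
  "psgn \<sigma> v = (if evenperm \<sigma> then v else - v)"

definition unshuffles :: "nat \<Rightarrow> nat \<Rightarrow> (nat \<Rightarrow> nat) set" where
  "unshuffles i n = {\<sigma>. \<sigma> permutes {..<n}
      \<and> (\<forall>a b. a < b \<and> b < i \<longrightarrow> \<sigma> a < \<sigma> b)
      \<and> (\<forall>a b. i \<le> a \<and> a < b \<and> b < n \<longrightarrow> \<sigma> a < \<sigma> b)}"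

text \<open>Exponent of the Koszul sign of the rearrangement (x_1..x_n) |-> (x_sigma(1)..x_sigma(n))
  of elements of degrees ds: x_sigma(1) ... x_sigma(n) = (-1)^koszul x_1 ... x_n in the graded
  symmetric algebra.\<close>
definition koszul :: "int list \<Rightarrow> (nat \<Rightarrow> nat) \<Rightarrow> int" where
  "koszul ds \<sigma> = (\<Sum>(i,j) | i < j \<and> j < length ds \<and> \<sigma> j < \<sigma> i. ds ! (\<sigma> i) * ds ! (\<sigma> j))"

section \<open>L-infinity algebras (shifted convention: graded symmetric brackets of degree 1)\<close>

text \<open>A Z-graded vector space W = (+)_d H d, inside an ambient vector space 'w.\<close>
definition graded_vs :: "('k::field \<Rightarrow> 'w::ab_group_add \<Rightarrow> 'w) \<Rightarrow> (int \<Rightarrow> 'w set) \<Rightarrow> bool" where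
  "graded_vs sc H \<longleftrightarrow> vector_space sc \<and> (\<forall>d. 0 \<in> H d \<and> (\<forall>x\<in>H d. \<forall>y\<in>H d. x + y \<in> H d) \<and> (\<forall>c. \<forall>x\<in>H d. sc c x \<in> H d))
     \<and> (\<forall>D x. finite D \<and> (\<forall>d\<in>D. x d \<in> H d) \<and> sum x D = 0 \<longrightarrow> (\<forall>d\<in>D. x d = 0))"

definition homog_list :: "(int \<Rightarrow> 'w set) \<Rightarrow> int list \<Rightarrow> 'w list \<Rightarrow> bool" where
  "homog_list H ds xs \<longleftrightarrow> length xs = length ds \<and> (\<forall>i<length ds. xs ! i \<in> H (ds ! i))"

text \<open>The brackets are given by their values on homogeneous elements (which determine their
  multilinear extension to the direct sum).\<close>
definition linfty_algebra ::
  "('k::field \<Rightarrow> 'w::ab_group_add \<Rightarrow> 'w) \<Rightarrow> (int \<Rightarrow> 'w set) \<Rightarrow> (nat \<Rightarrow> 'w list \<Rightarrow> 'w) \<Rightarrow> bool" where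
  "linfty_algebra sc H l \<longleftrightarrow> graded_vs sc H
    \<and> (\<forall>k\<ge>1. \<forall>ds xs. length ds = k \<and> homog_list H ds xs \<longrightarrow> l k xs \<in> H (sum_list ds + 1))
    \<and> (\<forall>k\<ge>1. \<forall>ds xs i a b c. length ds = k \<and> homog_list H ds xs \<and> i < k
          \<and> a \<in> H (ds ! i) \<and> b \<in> H (ds ! i) \<longrightarrow>
          l k (xs[i := sc c a + b]) = sc c (l k (xs[i := a])) + l k (xs[i := b]))
    \<and> (\<forall>k\<ge>1. \<forall>ds xs \<sigma>. length ds = k \<and> homog_list H ds xs \<and> \<sigma> permutes {..<k} \<longrightarrow>
          l k (permute_list \<sigma> xs) = sgnv (koszul ds \<sigma>) (l k xs))
    \<and> (\<forall>n\<ge>1. \<forall>ds xs. length ds = n \<and> homog_list H ds xs \<longrightarrow>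
          (\<Sum>i\<in>{1..n}. \<Sum>\<sigma>\<in>unshuffles i n.
              sgnv (koszul ds \<sigma>)
                (l (n - i + 1) (l i (take i (permute_list \<sigma> xs)) # drop i (permute_list \<sigma> xs)))) = 0)"

definition maurer_cartan ::
  "('k::field_char_0 \<Rightarrow> 'w::ab_group_add \<Rightarrow> 'w) \<Rightarrow> (int \<Rightarrow> 'w set) \<Rightarrow> (nat \<Rightarrow> 'w list \<Rightarrow> 'w) \<Rightarrow> 'w \<Rightarrow> bool" where
  "maurer_cartan sc H l a \<longleftrightarrow> a \<in> H 0
     \<and> finite {k. 1 \<le> k \<and> l k (replicate k a) \<noteq> 0}
     \<and> (\<Sum>k | 1 \<le> k \<and> l k (replicate k a) \<noteq> 0. sc (inverse (fact k)) (l k (replicate k a))) = 0"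

definition twisted ::
  "('k::field_char_0 \<Rightarrow> 'w::ab_group_add \<Rightarrow> 'w) \<Rightarrow> (nat \<Rightarrow> 'w list \<Rightarrow> 'w) \<Rightarrow> 'w \<Rightarrow> nat \<Rightarrow> 'w list \<Rightarrow> 'w" where
  "twisted sc l a k xs = (\<Sum>n | l (k + n) (replicate n a @ xs) \<noteq> 0.
       sc (inverse (fact n)) (l (k + n) (replicate n a @ xs)))"

definition twisting_finite :: "(int \<Rightarrow> 'w set) \<Rightarrow> (nat \<Rightarrow> 'w::zero list \<Rightarrow> 'w) \<Rightarrow> 'w \<Rightarrow> bool" where
  "twisting_finite H l a \<longleftrightarrow> (\<forall>k\<ge>1. \<forall>ds xs. length ds = k \<and> homog_list H ds xs \<longrightarrow>
       finite {n. l (k + n) (replicate n a @ xs) \<noteq> 0})"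

text \<open>An element of L(V) = (+)_n Hom(wedge^(n+1) V, V), V = g x h, is represented as a function on
  lists of vectors: its restriction to lists of length n+1 is its component of degree n.\<close>
type_synonym ('g, 'h) cochain = "('g \<times> 'h) list \<Rightarrow> ('g \<times> 'h)"

definition sV :: "('k \<Rightarrow> 'g \<Rightarrow> 'g) \<Rightarrow> ('k \<Rightarrow> 'h \<Rightarrow> 'h) \<Rightarrow> 'k \<Rightarrow> 'g \<times> 'h \<Rightarrow> 'g \<times> 'h" where
  "sV sg sh c v = (sg c (fst v), sh c (snd v))"

text \<open>Sign-weighted composition: the sign exponent s n m depends on the arity n of the inner and
  m of the outer map.  With s = 0 and homogeneous f (arity m), g (arity n) this is exactly
  (f o g)(v_1..v_{m+n-1}) = sum_{sigma in S(n,m-1)} sgn(sigma) f(g(v_sigma(1..n)), v_sigma(n+1..)).\<close>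
definition comp_sgn :: "(nat \<Rightarrow> nat \<Rightarrow> int) \<Rightarrow> ('g::ab_group_add, 'h::ab_group_add) cochain
     \<Rightarrow> ('g, 'h) cochain \<Rightarrow> ('g, 'h) cochain" where
  "comp_sgn s f g vs = (let N = length vs in
     \<Sum>n\<in>{1..N}. \<Sum>\<sigma>\<in>unshuffles n N.
        sgnv (s n (N - n + 1))
          (psgn \<sigma> (f (g (take n (permute_list \<sigma> vs)) # drop n (permute_list \<sigma> vs)))))"

text \<open>Nijenhuis-Richardson bracket [f,g] = f o g - (-1)^((m-1)(n-1)) g o f (extended bilinearly).\<close>
definition nr :: "('g::ab_group_add, 'h::ab_group_add) cochain \<Rightarrow> ('g, 'h) cochain \<Rightarrow> ('g, 'h) cochain" where
  "nr f g = (\<lambda>vs. comp_sgn (\<lambda>_ _. 0) f g vs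
                 + comp_sgn (\<lambda>n m. 1 + int ((n - 1) * (m - 1))) g f vs)"

text \<open>Projection P of L onto F = (+)_n Hom(wedge^(n+1) g, h).\<close>
definition projF :: "('g::zero, 'h::zero) cochain \<Rightarrow> ('g, 'h) cochain" where
  "projF f vs = (if vs = [] then 0 else (0, snd (f (map (\<lambda>v. (fst v, 0)) vs))))"

definition lift :: "nat \<Rightarrow> nat \<Rightarrow> ('g list \<Rightarrow> 'h list \<Rightarrow> 'g \<times> 'h) \<Rightarrow> ('g::ab_group_add, 'h::ab_group_add) cochain" where
  "lift k l \<kappa> vs = (if length vs = k + l then
     (\<Sum>\<tau>\<in>unshuffles k (k + l). psgn \<tau>
        (\<kappa> (map fst (take k (permute_list \<tau> vs))) (map snd (drop k (permute_list \<tau> vs)))))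
     else 0)"

definition hom_block :: "('k::field \<Rightarrow> 'g::ab_group_add \<Rightarrow> 'g) \<Rightarrow> ('k \<Rightarrow> 'h::ab_group_add \<Rightarrow> 'h)
     \<Rightarrow> nat \<Rightarrow> nat \<Rightarrow> ('g list \<Rightarrow> 'h list \<Rightarrow> 'g \<times> 'h) \<Rightarrow> bool" where
  "hom_block sg sh k l \<kappa> \<longleftrightarrow>
     (\<forall>xs us. length xs = k \<and> length us = l \<longrightarrow>
        (\<forall>i<k. \<forall>a b c. \<kappa> (xs[i := sg c a + b]) us = sV sg sh c (\<kappa> (xs[i := a]) us) + \<kappa> (xs[i := b]) us)
      \<and> (\<forall>i<l. \<forall>a b c. \<kappa> xs (us[i := sh c a + b]) = sV sg sh c (\<kappa> xs (us[i := a])) + \<kappa> xs (us[i := b]))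
      \<and> (\<forall>i j. i < j \<and> j < k \<and> xs ! i = xs ! j \<longrightarrow> \<kappa> xs us = 0)
      \<and> (\<forall>i j. i < j \<and> j < l \<and> us ! i = us ! j \<longrightarrow> \<kappa> xs us = 0))"

definition g_valued :: "('g list \<Rightarrow> 'h list \<Rightarrow> 'g \<times> 'h::zero) \<Rightarrow> bool" where
  "g_valued \<kappa> \<longleftrightarrow> (\<forall>xs us. snd (\<kappa> xs us) = 0)"

definition h_valued :: "('g list \<Rightarrow> 'h list \<Rightarrow> 'g::zero \<times> 'h) \<Rightarrow> bool" where
  "h_valued \<kappa> \<longleftrightarrow> (\<forall>xs us. fst (\<kappa> xs us) = 0)"

text \<open>Component of M of arity n (n >= 1):
  Hom(wedge^n g, g) (+) (+)_{i+j=n, j>=1} Hom(wedge^i g (x) wedge^j h, h), via lifts.\<close>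
definition inM :: "('k::field \<Rightarrow> 'g::ab_group_add \<Rightarrow> 'g) \<Rightarrow> ('k \<Rightarrow> 'h::ab_group_add \<Rightarrow> 'h)
     \<Rightarrow> nat \<Rightarrow> ('g, 'h) cochain \<Rightarrow> bool" where
  "inM sg sh n f \<longleftrightarrow> 1 \<le> n \<and> (\<exists>\<kappa>0 \<kappa>.
      hom_block sg sh n 0 \<kappa>0 \<and> g_valued \<kappa>0
      \<and> (\<forall>j\<in>{1..n}. hom_block sg sh (n - j) j (\<kappa> j) \<and> h_valued (\<kappa> j))
      \<and> f = (\<lambda>vs. lift n 0 \<kappa>0 vs + (\<Sum>j\<in>{1..n}. lift (n - j) j (\<kappa> j) vs)))"

definition inF :: "('k::field \<Rightarrow> 'g::ab_group_add \<Rightarrow> 'g) \<Rightarrow> ('k \<Rightarrow> 'h::ab_group_add \<Rightarrow> 'h)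
     \<Rightarrow> nat \<Rightarrow> ('g, 'h) cochain \<Rightarrow> bool" where
  "inF sg sh n \<theta> \<longleftrightarrow> 1 \<le> n \<and> (\<exists>\<kappa>. hom_block sg sh n 0 \<kappa> \<and> h_valued \<kappa> \<and> \<theta> = lift n 0 \<kappa>)"

text \<open>An element is a pair (f, theta) standing for s^{-1} f + theta, f in M, theta in F.
  Degree d part: f in M^{d+1} (arity d+2), theta in F^d (arity d+1).\<close>
definition Hdeg :: "('k::field \<Rightarrow> 'g::ab_group_add \<Rightarrow> 'g) \<Rightarrow> ('k \<Rightarrow> 'h::ab_group_add \<Rightarrow> 'h)
     \<Rightarrow> int \<Rightarrow> (('g, 'h) cochain \<times> ('g, 'h) cochain) set" where
  "Hdeg sg sh d = {(f, \<theta>).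
      (f = 0 \<or> (1 \<le> d + 2 \<and> inM sg sh (nat (d + 2)) f))
    \<and> (\<theta> = 0 \<or> (1 \<le> d + 1 \<and> inF sg sh (nat (d + 1)) \<theta>))}"

definition scW :: "('k \<Rightarrow> 'g \<Rightarrow> 'g) \<Rightarrow> ('k \<Rightarrow> 'h \<Rightarrow> 'h) \<Rightarrow> 'k
     \<Rightarrow> ('g, 'h) cochain \<times> ('g, 'h) cochain \<Rightarrow> ('g, 'h) cochain \<times> ('g, 'h) cochain" where
  "scW sg sh c w = ((\<lambda>vs. sV sg sh c (fst w vs)), (\<lambda>vs. sV sg sh c (snd w vs)))"

text \<open>Arity of a nonzero homogeneous cochain (irrelevant for the zero cochain).\<close>
definition arity :: "('g::zero, 'h::zero) cochain \<Rightarrow> nat" where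
  "arity f = (LEAST n. \<exists>vs. length vs = n \<and> f vs \<noteq> 0)"

text \<open>Degree of a "pure" homogeneous element: Inl f stands for s^{-1} f (degree |f| - 1),
  Inr theta stands for theta in F (degree |theta|).\<close>
definition pdeg :: "('g::zero, 'h::zero) cochain + ('g, 'h) cochain \<Rightarrow> int" where
  "pdeg p = (case p of Inl f \<Rightarrow> int (arity f) - 2 | Inr \<theta> \<Rightarrow> int (arity \<theta>) - 1)"

definition fsg :: "int \<Rightarrow> ('g::ab_group_add, 'h::ab_group_add) cochain \<Rightarrow> ('g, 'h) cochain" where
  "fsg e f = (\<lambda>vs. sgnv e (f vs))"

text \<open>The brackets on pure homogeneous elements:
  l_1(s^{-1}f) = P f;  l_2(s^{-1}f, s^{-1}g) = (-1)^|f| s^{-1}[f,g];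
  l_k(s^{-1}f, theta_1, ..., theta_{k-1}) = P[...[f,theta_1]...,theta_{k-1}] (k >= 2),
  with the other orderings obtained by graded symmetry (Koszul sign of moving s^{-1}f to the
  front); all other brackets vanish.\<close>
definition lpure :: "(('g::ab_group_add, 'h::ab_group_add) cochain + ('g, 'h) cochain) list
     \<Rightarrow> ('g, 'h) cochain \<times> ('g, 'h) cochain" where
  "lpure ps = (let k = length ps; L = filter (\<lambda>i. isl (ps ! i)) [0..<k] in
     if k = 1 then (case ps ! 0 of Inl f \<Rightarrow> (0, projF f) | Inr _ \<Rightarrow> (0, 0))
     else if k = 2 \<and> length L = 2 then
       (fsg (int (arity (projl (ps ! 0))) - 1) (nr (projl (ps ! 0)) (projl (ps ! 1))), 0)
     else if 2 \<le> k \<and> length L = 1 then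
       (let p = hd L; f = projl (ps ! p);
            \<theta>s = map projr (take p ps @ drop (p + 1) ps) in
        (0, fsg (pdeg (ps ! p) * sum_list (map pdeg (take p ps))) (projF (foldl nr f \<theta>s))))
     else (0, 0))"

text \<open>Multilinear expansion: (f, theta) = s^{-1} f + theta.\<close>
fun expand :: "('a \<times> 'b) list \<Rightarrow> ('a + 'b) list list" where
  "expand [] = [[]]"
| "expand (x # xs) = map (\<lambda>r. Inl (fst x) # r) (expand xs) @ map (\<lambda>r. Inr (snd x) # r) (expand xs)"

definition lbr :: "nat \<Rightarrow> (('g::ab_group_add, 'h::ab_group_add) cochain \<times> ('g, 'h) cochain) list
     \<Rightarrow> ('g, 'h) cochain \<times> ('g, 'h) cochain" where
  "lbr k xs = (if length xs = k then sum_list (map lpure (expand xs)) else 0)"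

definition bilinear_map :: "('k::field \<Rightarrow> 'a::ab_group_add \<Rightarrow> 'a) \<Rightarrow> ('k \<Rightarrow> 'b::ab_group_add \<Rightarrow> 'b)
     \<Rightarrow> ('k \<Rightarrow> 'c::ab_group_add \<Rightarrow> 'c) \<Rightarrow> ('a \<Rightarrow> 'b \<Rightarrow> 'c) \<Rightarrow> bool" where
  "bilinear_map sa sb sc br \<longleftrightarrow>
     (\<forall>c x x' y. br (sa c x + x') y = sc c (br x y) + br x' y)
   \<and> (\<forall>c x y y'. br x (sb c y + y') = sc c (br x y) + br x y')"

definition alt_bilinear :: "('k::field \<Rightarrow> 'a::ab_group_add \<Rightarrow> 'a) \<Rightarrow> ('a \<Rightarrow> 'a \<Rightarrow> 'a) \<Rightarrow> bool" where
  "alt_bilinear sa br \<longleftrightarrow> bilinear_map sa sa sa br \<and> (\<forall>x. br x x = 0)"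

definition lin_map :: "('k::field \<Rightarrow> 'a::ab_group_add \<Rightarrow> 'a) \<Rightarrow> ('k \<Rightarrow> 'b::ab_group_add \<Rightarrow> 'b)
     \<Rightarrow> ('a \<Rightarrow> 'b) \<Rightarrow> bool" where
  "lin_map sa sb D \<longleftrightarrow> (\<forall>c x y. D (sa c x + y) = sb c (D x) + D y)"

definition lie_algebra :: "('k::field \<Rightarrow> 'a::ab_group_add \<Rightarrow> 'a) \<Rightarrow> ('a \<Rightarrow> 'a \<Rightarrow> 'a) \<Rightarrow> bool" where
  "lie_algebra sa br \<longleftrightarrow> alt_bilinear sa br
     \<and> (\<forall>x y z. br x (br y z) + br y (br z x) + br z (br x y) = 0)"

definition lie_action :: "('k::field \<Rightarrow> 'g::ab_group_add \<Rightarrow> 'g) \<Rightarrow> ('k \<Rightarrow> 'h::ab_group_add \<Rightarrow> 'h)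
     \<Rightarrow> ('g \<Rightarrow> 'g \<Rightarrow> 'g) \<Rightarrow> ('h \<Rightarrow> 'h \<Rightarrow> 'h) \<Rightarrow> ('g \<Rightarrow> 'h \<Rightarrow> 'h) \<Rightarrow> bool" where
  "lie_action sg sh \<pi> \<mu> \<rho> \<longleftrightarrow> bilinear_map sg sh sh \<rho>
     \<and> (\<forall>x u v. \<rho> x (\<mu> u v) = \<mu> (\<rho> x u) v + \<mu> u (\<rho> x v))
     \<and> (\<forall>x y u. \<rho> (\<pi> x y) u = \<rho> x (\<rho> y u) - \<rho> y (\<rho> x u))"

definition rel_diff_op :: "('k::field \<Rightarrow> 'g::ab_group_add \<Rightarrow> 'g) \<Rightarrow> ('k \<Rightarrow> 'h::ab_group_add \<Rightarrow> 'h)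
     \<Rightarrow> ('g \<Rightarrow> 'g \<Rightarrow> 'g) \<Rightarrow> ('h \<Rightarrow> 'h \<Rightarrow> 'h) \<Rightarrow> ('g \<Rightarrow> 'h \<Rightarrow> 'h) \<Rightarrow> ('g \<Rightarrow> 'h) \<Rightarrow> bool" where
  "rel_diff_op sg sh \<pi> \<mu> \<rho> D \<longleftrightarrow> lin_map sg sh D
     \<and> (\<forall>x y. D (\<pi> x y) = \<rho> x (D y) - \<rho> y (D x) + \<mu> (D x) (D y))"

definition rel_diff_lie :: "('k::field \<Rightarrow> 'g::ab_group_add \<Rightarrow> 'g) \<Rightarrow> ('k \<Rightarrow> 'h::ab_group_add \<Rightarrow> 'h)
     \<Rightarrow> ('g \<Rightarrow> 'g \<Rightarrow> 'g) \<Rightarrow> ('h \<Rightarrow> 'h \<Rightarrow> 'h) \<Rightarrow> ('g \<Rightarrow> 'h \<Rightarrow> 'h) \<Rightarrow> ('g \<Rightarrow> 'h) \<Rightarrow> bool" where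
  "rel_diff_lie sg sh \<pi> \<mu> \<rho> D \<longleftrightarrow> lie_algebra sg \<pi> \<and> lie_algebra sh \<mu>
     \<and> lie_action sg sh \<pi> \<mu> \<rho> \<and> rel_diff_op sg sh \<pi> \<mu> \<rho> D"

definition Pi_lift :: "('g \<Rightarrow> 'g \<Rightarrow> 'g) \<Rightarrow> ('g \<Rightarrow> 'h \<Rightarrow> 'h) \<Rightarrow> ('h \<Rightarrow> 'h \<Rightarrow> 'h)
     \<Rightarrow> ('g::ab_group_add, 'h::ab_group_add) cochain" where
  "Pi_lift \<pi> \<rho> \<mu> = (\<lambda>vs. lift 2 0 (\<lambda>xs us. (\<pi> (xs ! 0) (xs ! 1), 0)) vs
                        + lift 1 1 (\<lambda>xs us. (0, \<rho> (xs ! 0) (us ! 0))) vs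
                        + lift 0 2 (\<lambda>xs us. (0, \<mu> (us ! 0) (us ! 1))) vs)"

definition D_lift :: "('g \<Rightarrow> 'h) \<Rightarrow> ('g::ab_group_add, 'h::ab_group_add) cochain" where
  "D_lift D = lift 1 0 (\<lambda>xs us. (0, D (xs ! 0)))"

end

theory Submission
  imports Defs
begin

text \<open>Sums over unshuffles are rewritten as a coproduct on lists, for which coassociativity and
  cocommutativity are immediate. With them the composition of cochains is seen to be pre-Lie, so
  the Nijenhuis-Richardson bracket is a graded Lie bracket on \<open>L(g \<oplus> h)\<close>. Here \<open>F\<close> is an abelian
  subalgebra and the kernel of the projection \<open>P\<close> is a subalgebra, hence
  \<open>P[a,b] = P[a,Pb] + P[Pa,b]\<close>; together with the Leibniz rule for iterated brackets this gives the
  L-infinity relations of the derived brackets. Iterated brackets with more elements of \<open>F\<close> than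
  arguments vanish, so twisting involves finite sums only, and it turns an L-infinity algebra
  into an L-infinity algebra whose Maurer-Cartan elements \<open>a'\<close> are those with \<open>a + a'\<close>
  Maurer-Cartan in the original one. Finally the Maurer-Cartan equation of \<open>(s\<^sup>-\<^sup>1 \<Pi>, D)\<close> is
  \<open>[\<Pi>,\<Pi>] = 0\<close> and \<open>P([\<Pi>,D] + 1/2 [[\<Pi>,D],D]) = 0\<close>, which spells out the Lie, action and
  difference operator conditions.\<close>

section \<open>Signed sums over unshuffles\<close>

text \<open>Signs are the first obstacle. A Koszul sign counted by inversions of a permutation is
  awkward under nesting of sums; the recursion of \<open>unsh\<close> pays the sign of an entry at
  the moment the entry is placed, so that sign identities become parity statements about degrees.
  Permutations occur only at the boundary with the definitions, in
  \<open>sum_unshuffles_koszul\<close>, \<open>permute_sign\<close> and \<open>psgn_eq_sgnv\<close>.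

  The second obstacle is that \<open>lpure\<close> reads degrees off cochains through
  \<open>arity\<close>, which says nothing about the zero cochain. Arguments are therefore carried
  with their degrees as tags, and the abstract brackets \<open>dbr\<close> take their signs from the
  tags; \<open>lbr_eq\<close> compares the two.

  Finiteness of twisting cannot come from the degree, since inserting elements of degree 0 leaves
  the degree of a bracket's value unchanged. It comes from a second grading that counts arguments in
  \<open>h\<close>: every bracket with an element of \<open>F\<close> raises it, and
  \<open>P\<close> sees only a bounded part of it. The resulting bound is kept as an axiom of
  \<open>nil_linfty\<close>, so that the twisted brackets satisfy it again.\<close>

lemma sgnv_0 [simp]: "sgnv 0 v = v"
  and sgnv_1 [simp]: "sgnv 1 v = - v"
  and sgnv_zero [simp]: "sgnv e 0 = 0"
  by (simp_all add: sgnv_def)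

lemma sgnv_add: "sgnv e (x + y) = sgnv e x + sgnv e y"
  and sgnv_diff: "sgnv e (x - y) = sgnv e x - sgnv e y"
  by (simp_all add: sgnv_def)

lemma sgnv_sgnv [simp]: "sgnv e (sgnv f x) = sgnv (e + f) x"
  by (simp add: sgnv_def)

lemma sgnv_cong: "even (e + f) \<Longrightarrow> sgnv e x = sgnv f x"
  by (auto simp: sgnv_def)

lemma sgnv_sum: "sgnv e (sum f A) = (\<Sum>x\<in>A. sgnv e (f x))"
  by (simp add: sgnv_def sum_negf)

definition tdeg :: "('a \<Rightarrow> int) \<Rightarrow> 'a list \<Rightarrow> int" where
  "tdeg p xs = sum_list (map p xs)"

lemma tdeg_simps [simp]:
  "tdeg p [] = 0" "tdeg p (x # xs) = p x + tdeg p xs" "tdeg p (xs @ ys) = tdeg p xs + tdeg p ys"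
  by (simp_all add: tdeg_def)

text \<open>A splitting is known to \<open>unsh_cong\<close> only through an equation of multisets.
  These are the consequences used throughout: membership, lengths, and additivity of the total
  weight for arbitrary \<open>p\<close>, which later is the degree or its absolute value.\<close>

lemma mset_parts:
  assumes "mset A + mset B = mset zs" "set zs \<subseteq> T"
  shows "set A \<subseteq> T" "set B \<subseteq> T" "length A + length B = length zs" "tdeg p A + tdeg p B = tdeg p zs"
proof -
  have "set A \<union> set B = set zs" using assms(1) by (metis set_mset_mset set_mset_union)
  then show "set A \<subseteq> T" "set B \<subseteq> T" using assms(2) by auto
  show "length A + length B = length zs" using assms(1) by (metis size_mset size_union)
  show "tdeg p A + tdeg p B = tdeg p zs" unfolding tdeg_def by (metis assms(1) image_mset_union mset_append mset_map sum_mset_sum_list sum_list_append map_append)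
qed

lemma tdeg_replicate [simp]: "tdeg p (replicate n x) = int n * p x"
  by (induction n) (simp_all add: algebra_simps)

lemma tdeg_one: "tdeg (\<lambda>_. 1) xs = int (length xs)"
  by (induction xs) simp_all

text \<open>The signed sum of \<open>F A B\<close> over all splittings of a list into two complementary sublists \<open>A\<close>, \<open>B\<close>,
  i.e. over unshuffles, with the Koszul sign of moving \<open>A\<close> to the front. Being the coproduct of the
  graded symmetric coalgebra, it is coassociative and cocommutative, and both facts are list
  inductions; the exterior case is \<open>p = (\<lambda>_. 1)\<close>.\<close>

primrec unsh :: "('a \<Rightarrow> int) \<Rightarrow> 'a list \<Rightarrow> ('a list \<Rightarrow> 'a list \<Rightarrow> 'w) \<Rightarrow> 'w::ab_group_add" where
  "unsh p [] F = F [] []"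
| "unsh p (x # xs) F = unsh p xs (\<lambda>A B. F (x # A) B)
     + unsh p xs (\<lambda>A B. sgnv (p x * tdeg p A) (F A (x # B)))"

lemma unsh_cong:
  assumes "\<And>A B. mset A + mset B = mset xs \<Longrightarrow> F A B = G A B"
  shows "unsh p xs F = unsh p xs G"
  using assms
proof (induction xs arbitrary: F G)
  case (Cons x xs)
  have "unsh p xs (\<lambda>A B. F (x # A) B) = unsh p xs (\<lambda>A B. G (x # A) B)"
    by (rule Cons.IH) (auto intro!: Cons.prems)
  moreover have "unsh p xs (\<lambda>A B. sgnv (p x * tdeg p A) (F A (x # B))) =
      unsh p xs (\<lambda>A B. sgnv (p x * tdeg p A) (G A (x # B)))"
    by (rule Cons.IH) (auto intro!: Cons.prems arg_cong[where f = "sgnv _"])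
  ultimately show ?case by simp
qed simp

lemma unsh_add: "unsh p xs (\<lambda>A B. F A B + G A B) = unsh p xs F + unsh p xs G"
  by (induction xs arbitrary: F G) (simp_all add: sgnv_add)

lemma unsh_zero [simp]: "unsh p xs (\<lambda>A B. 0) = 0"
  by (induction xs) simp_all

lemma unsh_eq_0: "(\<And>A B. mset A + mset B = mset xs \<Longrightarrow> F A B = 0) \<Longrightarrow> unsh p xs F = 0"
  using unsh_cong[of xs F "\<lambda>_ _. 0" p] by simp

lemma unsh_sgnv: "unsh p xs (\<lambda>A B. sgnv e (F A B)) = sgnv e (unsh p xs F)"
proof (induction xs arbitrary: F)
  case (Cons x xs)
  have "unsh p xs (\<lambda>A B. sgnv (p x * tdeg p A) (sgnv e (F A (x # B)))) =
     unsh p xs (\<lambda>A B. sgnv e (sgnv (p x * tdeg p A) (F A (x # B))))"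
    by (simp add: add.commute)
  then show ?case by (simp only: unsh.simps Cons.IH sgnv_add)
qed simp

lemma unsh_sum: "finite I \<Longrightarrow> unsh p xs (\<lambda>A B. \<Sum>i\<in>I. F i A B) = (\<Sum>i\<in>I. unsh p xs (F i))"
  by (induction I rule: finite_induct) (simp_all add: unsh_add)

text \<open>Additivity is only required on a set \<open>S\<close>: the brackets below are additive in their second
  argument only on homogeneous elements.\<close>

lemma unsh_mem_hom:
  assumes add: "\<And>x y. x \<in> S \<Longrightarrow> y \<in> S \<Longrightarrow> x + y \<in> S \<and> \<phi> (x + y) = \<phi> x + \<phi> y"
    and minus: "\<And>x. x \<in> S \<Longrightarrow> - x \<in> S \<and> \<phi> (- x) = - \<phi> x"
    and "\<And>A B. mset A + mset B = mset xs \<Longrightarrow> F A B \<in> S"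
  shows "unsh p xs F \<in> S \<and> \<phi> (unsh p xs F) = unsh p xs (\<lambda>A B. \<phi> (F A B))"
  using assms(3)
proof (induction xs arbitrary: F)
  case (Cons x xs)
  have sg: "sgnv e y \<in> S \<and> \<phi> (sgnv e y) = sgnv e (\<phi> y)" if "y \<in> S" for e y
    using minus that by (simp add: sgnv_def)
  have 1: "unsh p xs (\<lambda>A B. F (x # A) B) \<in> S \<and> \<phi> (unsh p xs (\<lambda>A B. F (x # A) B))
      = unsh p xs (\<lambda>A B. \<phi> (F (x # A) B))"
    by (rule Cons.IH) (auto intro!: Cons.prems)
  have 2: "unsh p xs (\<lambda>A B. sgnv (p x * tdeg p A) (F A (x # B))) \<in> S \<and>
      \<phi> (unsh p xs (\<lambda>A B. sgnv (p x * tdeg p A) (F A (x # B))))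
      = unsh p xs (\<lambda>A B. \<phi> (sgnv (p x * tdeg p A) (F A (x # B))))"
    by (rule Cons.IH) (auto intro!: Cons.prems conjunct1[OF sg])
  have 3: "unsh p xs (\<lambda>A B. \<phi> (sgnv (p x * tdeg p A) (F A (x # B))))
     = unsh p xs (\<lambda>A B. sgnv (p x * tdeg p A) (\<phi> (F A (x # B))))"
    by (rule unsh_cong) (auto intro!: Cons.prems conjunct2[OF sg])
  show ?case using 1 2 3 add by simp
qed simp

lemmas unsh_mem = unsh_mem_hom[where \<phi> = "\<lambda>x. x", THEN conjunct1]
lemmas unsh_hom = unsh_mem_hom[THEN conjunct2]

lemma unsh_additive:
  assumes "\<And>x y. \<phi> (x + y) = \<phi> x + \<phi> y"
  shows "\<phi> (unsh p xs F) = unsh p xs (\<lambda>A B. \<phi> (F A B))"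
proof (rule unsh_hom[where S = UNIV])
  show "- x \<in> UNIV \<and> \<phi> (- x) = - \<phi> x" for x
  proof -
    have "\<phi> 0 = 0" using assms[of 0 0] by simp
    then show ?thesis using assms[of x "- x"] by (simp add: eq_neg_iff_add_eq_0 add.commute)
  qed
qed (use assms in auto)

lemma unsh_map: "unsh p (map h xs) F = unsh (p \<circ> h) xs (\<lambda>A B. F (map h A) (map h B))"
  by (induction xs arbitrary: F) (simp_all add: tdeg_def)

text \<open>The counit law: the head must go to the right block, and passing an empty left block
  costs no sign.\<close>

lemma unsh_Nil_left: "unsh p xs (\<lambda>A B. if A = [] then F B else 0) = F xs"
proof (induction xs arbitrary: F)
  case (Cons x xs)
  have "unsh p xs (\<lambda>A B. sgnv (p x * tdeg p A) (if A = [] then F (x # B) else 0))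
      = unsh p xs (\<lambda>A B. if A = [] then F (x # B) else 0)"
    by (rule unsh_cong) simp
  also have "\<dots> = F (x # xs)" using Cons.IH[of "\<lambda>B. F (x # B)"] by simp
  finally show ?case by simp
qed simp

lemma unsh_Nil_right: "unsh p xs (\<lambda>A B. if B = [] then F A else 0) = F xs"
  by (induction xs arbitrary: F) simp_all

text \<open>The two summands of the recursion exchange roles: a head placed left on one side is
  placed right on the other. The exponent \<open>p x * tdeg p A\<close> then occurs twice and drops
  out.\<close>

lemma unsh_cocomm: "unsh p xs F = unsh p xs (\<lambda>A B. sgnv (tdeg p A * tdeg p B) (F B A))"
proof (induction xs arbitrary: F)
  case (Cons x xs)
  have 1: "unsh p xs (\<lambda>A B. F (x # A) B)
     = unsh p xs (\<lambda>A B. sgnv (p x * tdeg p A) (sgnv (tdeg p A * tdeg p (x # B)) (F (x # B) A)))"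
    unfolding Cons.IH[of "\<lambda>A B. F (x # A) B"]
    by (rule unsh_cong) (auto simp: algebra_simps intro!: sgnv_cong)
  have 2: "unsh p xs (\<lambda>A B. sgnv (p x * tdeg p A) (F A (x # B)))
     = unsh p xs (\<lambda>A B. sgnv (tdeg p (x # A) * tdeg p B) (F B (x # A)))"
    unfolding Cons.IH[of "\<lambda>A B. sgnv (p x * tdeg p A) (F A (x # B))"]
    by (rule unsh_cong) (auto simp: algebra_simps intro!: sgnv_cong)
  show ?case using 1 2 by simp
qed simp

text \<open>Both sides split the list into three blocks. The head goes to one of the three and pays
  \<open>p x\<close> times the total degree of the blocks in front of its own, whichever way the
  blocks are nested.\<close>

lemma unsh_coassoc:
  "unsh p xs (\<lambda>A B. unsh p A (\<lambda>C E. F C E B)) = unsh p xs (\<lambda>A B. unsh p B (\<lambda>C E. F A C E))"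
proof (induction xs arbitrary: F)
  case (Cons x xs)
  have 1: "unsh p xs (\<lambda>A B. sgnv (p x * tdeg p A) (unsh p A (\<lambda>C E. F C E (x # B))))
      = unsh p xs (\<lambda>A B. unsh p A (\<lambda>C E. sgnv (p x * (tdeg p C + tdeg p E)) (F C E (x # B))))"
    unfolding unsh_sgnv[symmetric]
    by (intro unsh_cong) (auto simp: algebra_simps dest: mset_parts(4)[OF _ subset_refl, of _ _ _ p, symmetric])
  have 2: "unsh p xs (\<lambda>A B. sgnv (p x * tdeg p A) (unsh p (x # B) (\<lambda>C E. F A C E)))
     = unsh p xs (\<lambda>A B. unsh p B (\<lambda>C E. sgnv (p x * tdeg p A) (F A (x # C) E)))
     + unsh p xs (\<lambda>A B. unsh p B (\<lambda>C E. sgnv (p x * (tdeg p A + tdeg p C)) (F A C (x # E))))"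
    by (simp add: sgnv_add unsh_add unsh_sgnv[symmetric] algebra_simps)
  show ?case
    by (simp only: unsh.simps(2)[of p x xs] 1 2) (simp add: unsh_add Cons.IH add.assoc)
qed simp

text \<open>If the two swapped entries land in the same block, the hypotheses provide the sign. If
  they land in different blocks, the terms of the two expansions coincide and only the placement
  signs differ, by exactly \<open>p a * p b\<close>.\<close>

lemma unsh_swap:
  assumes left: "\<And>X u v Y B. set (X @ u # v # Y @ B) \<subseteq> S \<Longrightarrow>
       F (X @ u # v # Y) B = sgnv (p u * p v) (F (X @ v # u # Y) B)"
    and right: "\<And>A X u v Y. set (A @ X @ u # v # Y) \<subseteq> S \<Longrightarrow>
       F A (X @ u # v # Y) = sgnv (p u * p v) (F A (X @ v # u # Y))"
    and "set (Z @ a # b # W) \<subseteq> S"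
  shows "unsh p (Z @ a # b # W) F = sgnv (p a * p b) (unsh p (Z @ b # a # W) F)"
  using assms
proof (induction Z arbitrary: F)
  case Nil
  have 1: "unsh p W (\<lambda>A B. F (a # b # A) B) = sgnv (p a * p b) (unsh p W (\<lambda>A B. F (b # a # A) B))"
    unfolding unsh_sgnv[symmetric]
    apply (rule unsh_cong)
    subgoal for A B
      using Nil(1)[of "[]" a b A B] Nil(3) mset_parts(1,2)[of A B W S] by auto
    done
  have 4: "unsh p W (\<lambda>A B. sgnv (p b * tdeg p A) (sgnv (p a * tdeg p A) (F A (a # b # B)))) =
     sgnv (p a * p b) (unsh p W (\<lambda>A B. sgnv (p a * tdeg p A) (sgnv (p b * tdeg p A) (F A (b # a # B)))))"
    unfolding unsh_sgnv[symmetric]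
    apply (rule unsh_cong)
    subgoal for A B
      using Nil(2)[of A "[]" a b B] Nil(3) mset_parts(1,2)[of A B W S] by (simp add: algebra_simps)
    done
  \<comment> \<open>The mixed terms: with \<open>a\<close> to the left, \<open>b\<close> passes
    \<open>a\<close> in one order of the entries and not in the other.\<close>
  have 2: "unsh p W (\<lambda>A B. sgnv (p b * tdeg p A) (F (a # A) (b # B)))
     = sgnv (p a * p b) (unsh p W (\<lambda>A B. sgnv (p b * tdeg p (a # A)) (F (a # A) (b # B))))"
    unfolding unsh_sgnv[symmetric]
    by (rule unsh_cong) (auto simp: algebra_simps intro!: sgnv_cong)
  have 3: "unsh p W (\<lambda>A B. sgnv (p a * tdeg p (b # A)) (F (b # A) (a # B)))
     = sgnv (p a * p b) (unsh p W (\<lambda>A B. sgnv (p a * tdeg p A) (F (b # A) (a # B))))"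
    unfolding unsh_sgnv[symmetric]
    by (rule unsh_cong) (auto simp: algebra_simps intro!: sgnv_cong)
  show ?case using 1 2 3 4 by (simp add: sgnv_add algebra_simps)
next
  case (Cons x Z)
  have S: "x \<in> S" "set (Z @ a # b # W) \<subseteq> S" using Cons.prems(3) by auto
  have 1: "unsh p (Z @ a # b # W) (\<lambda>A B. F (x # A) B) = sgnv (p a * p b) (unsh p (Z @ b # a # W) (\<lambda>A B. F (x # A) B))"
    apply (rule Cons.IH)
    subgoal for X u v Y B using Cons.prems(1)[of "x # X" u v Y B] S by simp
    subgoal for A X u v Y using Cons.prems(2)[of "x # A" X u v Y] S by simp
    using S by simp
  have 2: "unsh p (Z @ a # b # W) (\<lambda>A B. sgnv (p x * tdeg p A) (F A (x # B)))
     = sgnv (p a * p b) (unsh p (Z @ b # a # W) (\<lambda>A B. sgnv (p x * tdeg p A) (F A (x # B))))"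
    apply (rule Cons.IH)
    subgoal for X u v Y B using Cons.prems(1)[of X u v Y "x # B"] S by (simp add: algebra_simps)
    subgoal for A X u v Y using Cons.prems(2)[of A "x # X" u v Y] S by (simp add: algebra_simps)
    using S by simp
  show ?case using 1 2 by (simp add: sgnv_add)
qed

lemma (in vector_space) scale_sgnv: "scale c (sgnv e x) = sgnv e (scale c x)"
  by (simp add: sgnv_def)

lemma (in vector_space) unsh_scale: "unsh p xs (\<lambda>A B. scale c (F A B)) = scale c (unsh p xs F)"
  by (rule unsh_additive[symmetric]) (simp add: scale_right_distrib)

text \<open>A linear combination of tagged entries \<open>(d, x)\<close> must leave the tag alone,
  so \<open>w\<close> is only required to behave like \<open>scale c a + b\<close> inside
  \<open>F\<close>. Equal degrees make the placement signs of the three expansions agree.\<close>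

lemma (in vector_space) unsh_linear:
  assumes "p w = p a" "p b = p a"
    and left: "\<And>X Y B. set (X @ Y @ B) \<subseteq> S \<Longrightarrow>
       F (X @ w # Y) B = scale c (F (X @ a # Y) B) + F (X @ b # Y) B"
    and right: "\<And>A X Y. set (A @ X @ Y) \<subseteq> S \<Longrightarrow>
       F A (X @ w # Y) = scale c (F A (X @ a # Y)) + F A (X @ b # Y)"
    and "set (Z @ W) \<subseteq> S"
  shows "unsh p (Z @ w # W) F = scale c (unsh p (Z @ a # W) F) + unsh p (Z @ b # W) F"
  using assms
proof (induction Z arbitrary: F)
  case Nil
  have 1: "unsh p W (\<lambda>A B. F (w # A) B) = scale c (unsh p W (\<lambda>A B. F (a # A) B)) + unsh p W (\<lambda>A B. F (b # A) B)"
    unfolding unsh_scale[symmetric] unsh_add[symmetric]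
    apply (rule unsh_cong)
    subgoal for A B
      using Nil(3)[of "[]" A B] Nil(5) mset_parts(1,2)[of A B W S] by simp
    done
  have 2: "unsh p W (\<lambda>A B. sgnv (p a * tdeg p A) (F A (w # B))) = scale c (unsh p W (\<lambda>A B. sgnv (p a * tdeg p A) (F A (a # B))))
     + unsh p W (\<lambda>A B. sgnv (p a * tdeg p A) (F A (b # B)))"
    unfolding unsh_scale[symmetric] unsh_add[symmetric]
    apply (rule unsh_cong)
    subgoal for A B
      using Nil(4)[of A "[]" B] Nil(5) mset_parts(1,2)[of A B W S] by (simp add: sgnv_add scale_sgnv)
    done
  show ?case using 1 2 Nil(1,2) by (simp add: scale_right_distrib)
next
  case (Cons x Z)
  have S: "x \<in> S" "set (Z @ W) \<subseteq> S" using Cons.prems(5) by auto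
  have 1: "unsh p (Z @ w # W) (\<lambda>A B. F (x # A) B) = scale c (unsh p (Z @ a # W) (\<lambda>A B. F (x # A) B))
     + unsh p (Z @ b # W) (\<lambda>A B. F (x # A) B)"
    apply (rule Cons.IH)
    subgoal by fact
    subgoal by fact
    subgoal for X Y B using Cons.prems(3)[of "x # X" Y B] S by simp
    subgoal for A X Y using Cons.prems(4)[of "x # A" X Y] S by simp
    using S by simp
  have 2: "unsh p (Z @ w # W) (\<lambda>A B. sgnv (p x * tdeg p A) (F A (x # B)))
     = scale c (unsh p (Z @ a # W) (\<lambda>A B. sgnv (p x * tdeg p A) (F A (x # B))))
     + unsh p (Z @ b # W) (\<lambda>A B. sgnv (p x * tdeg p A) (F A (x # B)))"
    apply (rule Cons.IH)
    subgoal by fact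
    subgoal by fact
    subgoal for X Y B using Cons.prems(1,2) Cons.prems(3)[of X Y "x # B"] S
      by (simp add: sgnv_add scale_sgnv)
    subgoal for A X Y using Cons.prems(4)[of A "x # X" Y] S by (simp add: sgnv_add scale_sgnv)
    using S by simp
  show ?case using 1 2 by (simp add: scale_right_distrib)
qed

section \<open>Unshuffles and permutations as words\<close>

text \<open>The Koszul exponent of sorting a word: the sum of \<open>q a * q b\<close> over its
  inversions. The recursion on the first letter suits both insertion sort and the recursion of
  \<open>unsh\<close>.\<close>

primrec word_koszul :: "(nat \<Rightarrow> int) \<Rightarrow> nat list \<Rightarrow> int" where
  "word_koszul q [] = 0"
| "word_koszul q (a # w) = (\<Sum>b\<leftarrow>w. if b < a then q a * q b else 0) + word_koszul q w"

lemma word_koszul_double_sum: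
  "word_koszul q w = (\<Sum>i<length w. \<Sum>j<length w. if i < j \<and> w ! j < w ! i then q (w ! i) * q (w ! j) else 0)"
proof (induction w)
  case (Cons a w)
  have 1: "(\<Sum>b\<leftarrow>w. if b < a then q a * q b else 0)
      = (\<Sum>j<length w. if w ! j < a then q a * q (w ! j) else 0)"
    by (simp add: sum_list_sum_nth atLeast0LessThan)
  show ?case
    unfolding word_koszul.simps 1 Cons.IH length_Cons sum.lessThan_Suc_shift
    by (simp cong: if_cong)
qed simp

lemma koszul_eq_word_koszul:
  assumes "\<sigma> permutes {..<length xs}"
  shows "koszul (map p xs) \<sigma> = word_koszul (p \<circ> nth xs) (map \<sigma> [0..<length xs])"
proof -
  let ?n = "length xs"
  have lt: "\<sigma> i < ?n" if "i < ?n" for i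
    using permutes_in_image[OF assms] that by simp
  have "koszul (map p xs) \<sigma> = (\<Sum>(i,j) | i < j \<and> j < ?n \<and> \<sigma> j < \<sigma> i. p (xs ! \<sigma> i) * p (xs ! \<sigma> j))"
    unfolding koszul_def by (intro sum.cong) (auto simp: lt)
  also have "\<dots> = (\<Sum>x\<in>{..<?n} \<times> {..<?n}. if (case x of (i, j) \<Rightarrow> i < j \<and> \<sigma> j < \<sigma> i)
        then (case x of (i, j) \<Rightarrow> p (xs ! \<sigma> i) * p (xs ! \<sigma> j)) else 0)"
    by (subst sum.inter_filter[symmetric]) (auto intro!: sum.cong)
  also have "\<dots> = (\<Sum>i<?n. \<Sum>j<?n. if i < j \<and> \<sigma> j < \<sigma> i then p (xs ! \<sigma> i) * p (xs ! \<sigma> j) else 0)"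
    by (subst sum.cartesian_product) (auto intro!: sum.cong)
  also have "\<dots> = word_koszul (p \<circ> nth xs) (map \<sigma> [0..<?n])"
    unfolding word_koszul_double_sum by (auto intro!: sum.cong)
  finally show ?thesis .
qed

text \<open>The least letter is inverted with precisely the letters standing in front of it. This is
  the sign that \<open>unsh\<close> pays for placing the head to the right.\<close>

lemma word_koszul_insert_least:
  "(\<And>a. a \<in> set (A @ B) \<Longrightarrow> x < a) \<Longrightarrow> word_koszul q (A @ x # B) = word_koszul q (A @ B) + q x * tdeg q A"
proof (induction A)
  case Nil
  have "(\<Sum>b\<leftarrow>B. if b < x then q x * q b else 0) = (\<Sum>b\<leftarrow>B. 0)"
    by (rule arg_cong[where f = sum_list], rule map_cong) (use Nil in fastforce)+
  then show ?case by simp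
next
  case (Cons a A)
  then have "word_koszul q (A @ x # B) = word_koszul q (A @ B) + q x * tdeg q A" "x < a" by auto
  then show ?case by (simp add: algebra_simps)
qed

abbreviation sel :: "'a set \<Rightarrow> 'a list \<Rightarrow> 'a list" where "sel I \<equiv> filter (\<lambda>x. x \<in> I)"
abbreviation rej :: "'a set \<Rightarrow> 'a list \<Rightarrow> 'a list" where "rej I \<equiv> filter (\<lambda>x. x \<notin> I)"

text \<open>A splitting of a strictly increasing list is determined by the set of entries in its
  left block. Subsets containing the head and subsets avoiding it match the two summands of the
  recursion; the head being least, \<open>word_koszul_insert_least\<close> gives the sign.\<close>

lemma unsh_eq_sum_Pow:
  assumes "sorted_wrt (<) (xs :: nat list)"
  shows "unsh q xs F = (\<Sum>I\<in>Pow (set xs).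
    sgnv (word_koszul q (sel I xs @ rej I xs))
      (F (sel I xs) (rej I xs)))"
  using assms
proof (induction xs arbitrary: F)
  case Nil
  then show ?case by simp
next
  case (Cons x xs)
  then have x: "\<And>a. a \<in> set xs \<Longrightarrow> x < a" and xn: "x \<notin> set xs" and s: "sorted_wrt (<) xs" by auto
  define h where "h = (\<lambda>I. sgnv (word_koszul q (sel I (x # xs) @ rej I (x # xs)))
      (F (sel I (x # xs)) (rej I (x # xs))))"
  have inj: "inj_on (insert x) (Pow (set xs))"
    using xn by (auto simp: inj_on_def)
  have "(\<Sum>I\<in>Pow (set (x # xs)). h I) = (\<Sum>I\<in>Pow (set xs). h I) + (\<Sum>I\<in>insert x ` Pow (set xs). h I)"
    unfolding list.set Pow_insert by (rule sum.union_disjoint) (use xn in auto)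
  also have "\<dots> = (\<Sum>I\<in>Pow (set xs). h (insert x I)) + (\<Sum>I\<in>Pow (set xs). h I)"
    by (simp add: sum.reindex[OF inj] add.commute)
  also have "(\<Sum>I\<in>Pow (set xs). h (insert x I)) = unsh q xs (\<lambda>A B. F (x # A) B)"
  proof -
    have "h (insert x I) = sgnv (word_koszul q (sel I xs @ rej I xs))
      (F (x # sel I xs) (rej I xs))" if "I \<subseteq> set xs" for I
    proof -
      have f: "filter (\<lambda>z. z = x \<or> z \<in> I) xs = sel I xs"
        "filter (\<lambda>z. z \<noteq> x \<and> z \<notin> I) xs = rej I xs"
        using xn by (auto intro!: filter_cong)
      have "word_koszul q (x # sel I xs @ rej I xs) = word_koszul q (sel I xs @ rej I xs)"
        using word_koszul_insert_least[of "[]" "sel I xs @ rej I xs" x q] x by auto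
      then show ?thesis by (simp add: h_def f)
    qed
    then show ?thesis unfolding Cons.IH[OF s] by (intro sum.cong) auto
  qed
  also have "(\<Sum>I\<in>Pow (set xs). h I) = unsh q xs (\<lambda>A B. sgnv (q x * tdeg q A) (F A (x # B)))"
  proof -
    have "h I = sgnv (word_koszul q (sel I xs @ rej I xs))
      (sgnv (q x * tdeg q (sel I xs)) (F (sel I xs) (x # rej I xs)))"
      if "I \<subseteq> set xs" for I
    proof -
      have "x \<notin> I" using xn that by auto
      moreover have "word_koszul q (sel I xs @ x # rej I xs)
         = word_koszul q (sel I xs @ rej I xs) + q x * tdeg q (sel I xs)"
        by (rule word_koszul_insert_least) (use x in auto)
      ultimately show ?thesis by (simp add: h_def)
    qed
    then show ?thesis unfolding Cons.IH[OF s] by (intro sum.cong) auto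
  qed
  finally show ?case by (simp add: h_def)
qed

text \<open>An unshuffle is increasing on each of its two blocks, so each block is the unique
  increasing enumeration of its set of values.\<close>

lemma unshuffle_word:
  assumes \<sigma>: "\<sigma> \<in> unshuffles i n" and "i \<le> n"
  shows "sel (\<sigma> ` {..<i}) [0..<n] = map \<sigma> [0..<i]"
    and "rej (\<sigma> ` {..<i}) [0..<n] = map \<sigma> [i..<n]"
proof -
  from \<sigma> have p: "\<sigma> permutes {..<n}"
    and a: "\<And>a b. a < b \<Longrightarrow> b < i \<Longrightarrow> \<sigma> a < \<sigma> b"
    and b: "\<And>a b. i \<le> a \<Longrightarrow> a < b \<Longrightarrow> b < n \<Longrightarrow> \<sigma> a < \<sigma> b"
    by (auto simp: unshuffles_def)
  have inj: "inj \<sigma>" and im: "\<sigma> ` {..<n} = {..<n}"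
    using p by (auto simp: permutes_inj permutes_image)
  have s1: "sorted_wrt (<) (map \<sigma> [0..<i])"
    by (auto simp: sorted_wrt_iff_nth_less intro!: a)
  have s2: "sorted_wrt (<) (map \<sigma> [i..<n])"
    by (auto simp: sorted_wrt_iff_nth_less intro!: b)
  have set1: "set (map \<sigma> [0..<i]) = \<sigma> ` {..<i}" by auto
  have "\<sigma> ` {..<i} \<subseteq> {..<n}" using im \<open>i \<le> n\<close> by auto
  then have f1: "set (sel (\<sigma> ` {..<i}) [0..<n]) = \<sigma> ` {..<i}" by auto
  have "\<sigma> ` {i..<n} = \<sigma> ` {..<n} - \<sigma> ` {..<i}"
    by (subst image_set_diff[OF inj, symmetric]) (rule arg_cong[where f = "image \<sigma>"], auto)
  then have f2: "set (rej (\<sigma> ` {..<i}) [0..<n]) = set (map \<sigma> [i..<n])"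
    using im by auto
  show "sel (\<sigma> ` {..<i}) [0..<n] = map \<sigma> [0..<i]"
    by (rule sorted_distinct_set_unique)
       (use s1 set1 f1 in \<open>auto simp: strict_sorted_iff sorted_wrt_filter\<close>)
  show "rej (\<sigma> ` {..<i}) [0..<n] = map \<sigma> [i..<n]"
    by (rule sorted_distinct_set_unique)
       (use s2 f2 in \<open>auto simp: strict_sorted_iff sorted_wrt_filter\<close>)
qed

text \<open>The inverse of sending an unshuffle to the image of its first \<open>i\<close> places:
  enumerate \<open>I\<close>, then its complement, both increasingly, and fix everything from
  \<open>n\<close> on.\<close>

lemma word_unshuffle:
  fixes I :: "nat set"
  assumes I: "I \<subseteq> {..<n}" and i: "card I = i"
  defines "W \<equiv> sel I [0..<n] @ rej I [0..<n]"
  defines "\<sigma> \<equiv> \<lambda>k. if k < n then W ! k else k"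
  shows "\<sigma> \<in> unshuffles i n" and "\<sigma> ` {..<i} = I" and "i \<le> n"
proof -
  let ?A = "sel I [0..<n]" and ?B = "rej I [0..<n]"
  have setA: "set ?A = I" using I by auto
  have lA: "length ?A = i"
    using distinct_card[of ?A] setA i by simp
  have lW: "length W = n"
    unfolding W_def using sum_length_filter_compl[of "\<lambda>k. k \<in> I" "[0..<n]"] by simp
  show "i \<le> n" using lW lA unfolding W_def by simp
  have dW: "distinct W" and sW: "set W = {..<n}" unfolding W_def using I by auto
  have "bij_betw (\<lambda>k. W ! k) {..<n} {..<n}"
    using bij_betw_nth[OF dW] lW sW by simp
  then have "bij_betw \<sigma> {..<n} {..<n}"
    by (rule bij_betw_cong[THEN iffD1, rotated]) (simp add: \<sigma>_def)
  then have p: "\<sigma> permutes {..<n}"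
    by (rule bij_imp_permutes) (simp add: \<sigma>_def)
  have sA: "sorted_wrt (<) ?A" and sB: "sorted_wrt (<) ?B"
    by (simp_all add: sorted_wrt_filter)
  have "\<sigma> a < \<sigma> b" if "a < b" "b < i" for a b
    using sorted_wrt_nth_less[OF sA, of a b] that lA \<open>i \<le> n\<close> by (simp add: \<sigma>_def W_def nth_append)
  moreover have "\<sigma> a < \<sigma> b" if "i \<le> a" "a < b" "b < n" for a b
    using sorted_wrt_nth_less[OF sB, of "a - i" "b - i"] that lA lW
    by (simp add: \<sigma>_def W_def nth_append)
  ultimately show "\<sigma> \<in> unshuffles i n" using p by (simp add: unshuffles_def)
  have "\<sigma> ` {..<i} = (\<lambda>k. ?A ! k) ` {..<length ?A}"
    using lA \<open>i \<le> n\<close> by (auto simp: \<sigma>_def W_def nth_append image_def)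
  also have "\<dots> = set ?A"
    using nth_image[of "length ?A" ?A] by (simp add: atLeast0LessThan del: set_filter)
  finally show "\<sigma> ` {..<i} = I" using setA by simp
qed

lemma sum_unshuffles:
  assumes "i \<le> n"
  shows "(\<Sum>\<sigma>\<in>unshuffles i n. \<Phi> (map \<sigma> [0..<i]) (map \<sigma> [i..<n]))
    = (\<Sum>I | I \<subseteq> {..<n} \<and> card I = i. \<Phi> (sel I [0..<n]) (rej I [0..<n]))"
proof (rule sum.reindex_bij_witness[where i = "\<lambda>I k. if k < n then
    (sel I [0..<n] @ rej I [0..<n]) ! k else k"
    and j = "\<lambda>\<sigma>. \<sigma> ` {..<i}"])
  fix \<sigma> assume \<sigma>: "\<sigma> \<in> unshuffles i n"
  then have p: "\<sigma> permutes {..<n}" by (simp add: unshuffles_def)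
  note w = unshuffle_word[OF \<sigma> assms]
  have "map \<sigma> [0..<i] @ map \<sigma> [i..<n] = map \<sigma> [0..<n]"
    using assms by (metis map_append le_add_diff_inverse upt_add_eq_append zero_le)
  then show "(\<lambda>k. if k < n then (sel (\<sigma> ` {..<i}) [0..<n] @ rej (\<sigma> ` {..<i}) [0..<n]) ! k else k) = \<sigma>"
    unfolding w using permutes_not_in[OF p] by auto
  have "card (\<sigma> ` {..<i}) = i"
    using card_image[of \<sigma> "{..<i}"] permutes_inj[OF p] by (simp add: inj_on_def)
  moreover have "\<sigma> ` {..<i} \<subseteq> {..<n}"
    using permutes_image[OF p] assms by auto
  ultimately show "\<sigma> ` {..<i} \<in> {I. I \<subseteq> {..<n} \<and> card I = i}" by simp
  show "\<Phi> (sel (\<sigma> ` {..<i}) [0..<n]) (rej (\<sigma> ` {..<i}) [0..<n])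
     = \<Phi> (map \<sigma> [0..<i]) (map \<sigma> [i..<n])"
    unfolding w ..
qed (use word_unshuffle in auto)

text \<open>The bridge from sums over permutations to the coproduct. It is proved for the word of
  positions \<open>[0..<length xs]\<close>, whose letters are distinct and ordered even if
  \<open>xs\<close> has repetitions, and then carried over by \<open>unsh_map\<close>.\<close>

lemma sum_unshuffles_koszul:
  assumes "i \<le> length xs"
  shows "(\<Sum>\<sigma>\<in>unshuffles i (length xs). sgnv (koszul (map p xs) \<sigma>)
       (F (take i (permute_list \<sigma> xs)) (drop i (permute_list \<sigma> xs))))
    = unsh p xs (\<lambda>A B. if length A = i then F A B else 0)"
proof -
  let ?n = "length xs"
  let ?q = "p \<circ> nth xs"
  let ?h = "\<lambda>A B. sgnv (word_koszul ?q (A @ B)) (F (map (nth xs) A) (map (nth xs) B))"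
  have upt_split: "[0..<?n] = [0..<i] @ [i..<?n]"
    using assms by (metis le_add_diff_inverse upt_add_eq_append zero_le)
  have t: "take i (permute_list \<sigma> xs) = map (nth xs) (map \<sigma> [0..<i])"
    "drop i (permute_list \<sigma> xs) = map (nth xs) (map \<sigma> [i..<?n])" for \<sigma>
    using assms by (simp_all add: permute_list_def take_map drop_map)
  have "(\<Sum>\<sigma>\<in>unshuffles i ?n. sgnv (koszul (map p xs) \<sigma>)
       (F (take i (permute_list \<sigma> xs)) (drop i (permute_list \<sigma> xs))))
     = (\<Sum>\<sigma>\<in>unshuffles i ?n. ?h (map \<sigma> [0..<i]) (map \<sigma> [i..<?n]))"
    by (intro sum.cong refl)
      (simp add: t koszul_eq_word_koszul unshuffles_def upt_split del: map_map)
  also have "\<dots> = (\<Sum>I | I \<subseteq> {..<?n} \<and> card I = i. ?h (sel I [0..<?n]) (rej I [0..<?n]))"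
    by (rule sum_unshuffles[OF assms])
  also have "\<dots> = (\<Sum>I\<in>Pow {..<?n}. if card I = i then ?h (sel I [0..<?n]) (rej I [0..<?n]) else 0)"
    by (subst sum.inter_filter[symmetric]) (auto intro!: sum.cong)
  also have "\<dots> = (\<Sum>I\<in>Pow (set [0..<?n]). sgnv (word_koszul ?q (sel I [0..<?n] @ rej I [0..<?n]))
      (if length (sel I [0..<?n]) = i then F (map (nth xs) (sel I [0..<?n]))
         (map (nth xs) (rej I [0..<?n])) else 0))"
  proof (intro sum.cong)
    fix I assume "I \<in> Pow (set [0..<?n])"
    then have "set (sel I [0..<?n]) = I" by auto
    then have "length (sel I [0..<?n]) = card I"
      by (metis distinct_card distinct_filter distinct_upt)
    then show "(if card I = i then ?h (sel I [0..<?n]) (rej I [0..<?n]) else 0)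
      = sgnv (word_koszul ?q (sel I [0..<?n] @ rej I [0..<?n]))
      (if length (sel I [0..<?n]) = i then F (map (nth xs) (sel I [0..<?n]))
         (map (nth xs) (rej I [0..<?n])) else 0)"
      by simp
  qed auto
  also have "\<dots> = unsh ?q [0..<?n] (\<lambda>A B. if length A = i then F (map (nth xs) A) (map (nth xs) B) else 0)"
    by (subst unsh_eq_sum_Pow) simp_all
  also have "\<dots> = unsh p (map (nth xs) [0..<?n]) (\<lambda>A B. if length A = i then F A B else 0)"
    by (simp add: unsh_map)
  finally show ?thesis by (simp add: map_nth)
qed

section \<open>Signs of arbitrary permutations from adjacent transpositions\<close>

lemma sum_list_map_sort: "(\<Sum>b\<leftarrow>sort w. f b :: int) = (\<Sum>b\<leftarrow>w. f b)"
  using sum_mset_sum_list[of "map f (sort w)"] sum_mset_sum_list[of "map f w"] by simp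

text \<open>Insertion moves \<open>a\<close> past exactly the letters smaller than itself, one
  adjacent swap for each.\<close>

lemma insort_sign:
  fixes w :: "nat list"
  assumes sw: "\<And>X a b Y. set (X @ a # b # Y) \<subseteq> S \<Longrightarrow> G (X @ a # b # Y) = sgnv (q a * q b) (G (X @ b # a # Y))"
  shows "sorted w \<Longrightarrow> set (Z @ a # w) \<subseteq> S \<Longrightarrow>
    G (Z @ a # w) = sgnv (\<Sum>b\<leftarrow>w. if b < a then q a * q b else 0) (G (Z @ insort a w))"
proof (induction w arbitrary: Z)
  case (Cons b w)
  show ?case
  proof (cases "a \<le> b")
    case True
    then have "(\<Sum>c\<leftarrow>b # w. if c < a then q a * q c else 0) = (\<Sum>c\<leftarrow>b # w. 0)"
      using Cons.prems(1) by (intro arg_cong[where f = sum_list] map_cong) auto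
    then show ?thesis using True by simp
  next
    case False
    have "G ((Z @ [b]) @ a # w) = sgnv (\<Sum>b\<leftarrow>w. if b < a then q a * q b else 0) (G ((Z @ [b]) @ insort a w))"
      by (rule Cons.IH) (use Cons.prems in auto)
    moreover have "G (Z @ a # b # w) = sgnv (q a * q b) (G (Z @ b # a # w))"
      by (rule sw) (use Cons.prems in auto)
    ultimately show ?thesis using False by simp
  qed
qed simp

lemma sort_sign:
  fixes w :: "nat list"
  assumes sw: "\<And>X a b Y. set (X @ a # b # Y) \<subseteq> S \<Longrightarrow> G (X @ a # b # Y) = sgnv (q a * q b) (G (X @ b # a # Y))"
  shows "set (Z @ w) \<subseteq> S \<Longrightarrow> G (Z @ w) = sgnv (word_koszul q w) (G (Z @ sort w))"
proof (induction w arbitrary: Z)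
  case (Cons a w)
  have "G ((Z @ [a]) @ w) = sgnv (word_koszul q w) (G ((Z @ [a]) @ sort w))"
    by (rule Cons.IH) (use Cons.prems in auto)
  moreover have "G (Z @ a # sort w) = sgnv (\<Sum>b\<leftarrow>sort w. if b < a then q a * q b else 0) (G (Z @ insort a (sort w)))"
    apply (rule insort_sign[where S = S and G = G and q = q])
    subgoal by (rule sw)
    using Cons.prems by auto
  moreover have "(\<Sum>b\<leftarrow>sort w. if b < a then q a * q b else 0) = (\<Sum>b\<leftarrow>w. if b < a then q a * q b else 0)"
    by (rule sum_list_map_sort)
  ultimately show ?case by (simp add: add.commute)
qed simp

lemma permutes_lessThan_less: "\<sigma> permutes {..<n} \<Longrightarrow> k < n \<Longrightarrow> \<sigma> k < (n::nat)"
  using permutes_in_image[of \<sigma> "{..<n}" k] by simp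

lemma sort_permutation_word:
  assumes "\<sigma> permutes {..<n}"
  shows "sort (map \<sigma> [0..<n]) = [0..<n]"
proof (rule properties_for_sort)
  have "mset (permute_list \<sigma> [0..<n]) = mset [0..<n]"
    using assms by (intro mset_permute_list) simp
  moreover have "permute_list \<sigma> [0..<n] = map \<sigma> [0..<n]"
    using permutes_in_image[OF assms] by (auto simp: permute_list_def)
  ultimately show "mset [0..<n] = mset (map \<sigma> [0..<n])" by metis
qed simp

text \<open>Insertion sort turns the word of \<open>\<sigma>\<close> into the identity by adjacent
  swaps, and the swaps performed correspond to the inversions. Graded symmetry thus has to be
  checked for neighbours only; \<open>S\<close> restricts this to lists of homogeneous
  entries.\<close>

lemma permute_sign:
  assumes sw: "\<And>X a b Y. set (X @ a # b # Y) \<subseteq> S \<Longrightarrow> G (X @ a # b # Y) = sgnv (p a * p b) (G (X @ b # a # Y))"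
    and "set xs \<subseteq> S" and \<sigma>: "\<sigma> permutes {..<length xs}"
  shows "G (permute_list \<sigma> xs) = sgnv (koszul (map p xs) \<sigma>) (G xs)"
proof -
  let ?n = "length xs"
  let ?q = "p \<circ> nth xs"
  have "(\<lambda>w. G (map (nth xs) w)) ([] @ map \<sigma> [0..<?n]) = sgnv (word_koszul ?q (map \<sigma> [0..<?n])) ((\<lambda>w. G (map (nth xs) w)) ([] @ sort (map \<sigma> [0..<?n])))"
    apply (rule sort_sign[where S = "{..<?n}"])
    subgoal for X a b Y
    proof -
      assume "set (X @ a # b # Y) \<subseteq> {..<?n}"
      then have "set (map (nth xs) (X @ a # b # Y)) \<subseteq> set xs" by (auto simp: subset_iff)
      then have "set (map (nth xs) (X @ a # b # Y)) \<subseteq> S" using \<open>set xs \<subseteq> S\<close> by (rule order_trans)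
      then show ?thesis
        using sw[of "map (nth xs) X" "xs ! a" "xs ! b" "map (nth xs) Y"] by simp
    qed
    subgoal by (simp add: atLeast0LessThan permutes_image[OF \<sigma>])
    done
  then show ?thesis
    unfolding sort_permutation_word[OF \<sigma>] koszul_eq_word_koszul[OF \<sigma>]
    by (simp add: permute_list_def comp_def map_nth)
qed

text \<open>Parity is compared with the inversion count by applying \<open>permute_sign\<close>,
  with all degrees 1, to the function that sends a word spelling a permutation to its sign: an
  adjacent swap composes with a transposition.\<close>

lemma psgn_eq_sgnv:
  assumes "\<sigma> permutes {..<n}"
  shows "psgn \<sigma> v = sgnv (koszul (replicate n 1) \<sigma>) v"
proof -
  define pf where "pf = (\<lambda>(w :: nat list) k. if k < length w then w ! k else k)"
  \<comment> \<open>The value 0 on words that spell no permutation keeps the swap rule valid for all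
    words.\<close>
  define G :: "nat list \<Rightarrow> int" where
    "G = (\<lambda>w. if distinct w \<and> set w = {..<length w} then sign (pf w) else 0)"
  have pf: "pf w permutes {..<length w}" if "distinct w" "set w = {..<length w}" for w
  proof (rule bij_imp_permutes)
    show "bij_betw (pf w) {..<length w} {..<length w}"
      using bij_betw_nth[OF that(1) refl that(2)[symmetric]]
      by (rule bij_betw_cong[THEN iffD1, rotated]) (simp add: pf_def)
  qed (simp add: pf_def)
  have sw: "G (X @ a # b # Y) = sgnv (1 * 1) (G (X @ b # a # Y))" for X a b Y
  proof (cases "distinct (X @ a # b # Y) \<and> set (X @ a # b # Y) = {..<length (X @ a # b # Y)}")
    case True
    let ?w = "X @ a # b # Y" and ?w' = "X @ b # a # Y"
    let ?k = "length X"
    have T': "distinct ?w' \<and> set ?w' = {..<length ?w'}" using True by auto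
    have "pf ?w = pf ?w' \<circ> transpose ?k (Suc ?k)"
      by (auto simp: pf_def fun_eq_iff transpose_def nth_append nth_Cons split: nat.splits)
    moreover have "permutation (pf ?w')" using pf[of ?w'] T' permutation_permutes by blast
    ultimately have "sign (pf ?w) = sign (pf ?w') * sign (transpose ?k (Suc ?k))"
      by (metis sign_compose permutation_swap_id)
    then have "sign (pf ?w) = - sign (pf ?w')"
      by (simp add: sign_swap_id)
    then show ?thesis unfolding G_def if_P[OF True] if_P[OF T'] by simp
  next
    case False
    then have F': "\<not> (distinct (X @ b # a # Y) \<and> set (X @ b # a # Y) = {..<length (X @ b # a # Y)})" by auto
    show ?thesis unfolding G_def if_not_P[OF False] if_not_P[OF F'] by simp
  qed
  let ?w = "permute_list \<sigma> [0..<n]"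
  have "G ?w = sgnv (koszul (map (\<lambda>_. 1) [0..<n]) \<sigma>) (G [0..<n])"
    apply (rule permute_sign[where S = UNIV])
    subgoal by (rule sw)
    using assms by simp_all
  moreover have "pf ?w = \<sigma>"
    using permutes_not_in[OF assms] assms by (auto simp: pf_def fun_eq_iff permute_list_nth permutes_lessThan_less[OF assms])
  moreover have "pf [0..<n] = id" by (auto simp: pf_def)
  moreover have "set ?w = {..<n}" "distinct ?w" using assms by (auto simp: set_permute_list)
  ultimately have "sign \<sigma> = sgnv (koszul (map (\<lambda>_. 1) [0..<n]) \<sigma>) 1"
    by (simp add: G_def atLeast0LessThan)
  then show ?thesis
    by (auto simp: psgn_def sgnv_def sign_def map_replicate_const split: if_splits)
qed

lemma sum_unshuffles_psgn:
  assumes "i \<le> length xs"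
  shows "(\<Sum>\<sigma>\<in>unshuffles i (length xs). psgn \<sigma>
       (F (take i (permute_list \<sigma> xs)) (drop i (permute_list \<sigma> xs))))
    = unsh (\<lambda>_. 1) xs (\<lambda>A B. if length A = i then F A B else 0)"
  unfolding sum_unshuffles_koszul[OF assms, symmetric]
  by (intro sum.cong refl) (simp add: psgn_eq_sgnv[of _ "length xs"] unshuffles_def map_replicate_const)

section \<open>Twisting of nilpotent L-infinity algebras\<close>

text \<open>The sum over all ways of sending \<open>N\<close> equal objects to one of two places.
  This form, rather than one with binomial coefficients, is what both the splitting of
  \<open>replicate N a\<close> and the expansion of a bracket in \<open>a + a'\<close> produce
  directly.\<close>

primrec binomial_rec :: "nat \<Rightarrow> (nat \<Rightarrow> nat \<Rightarrow> 'w) \<Rightarrow> 'w::ab_group_add" where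
  "binomial_rec 0 G = G 0 0"
| "binomial_rec (Suc N) G = binomial_rec N (\<lambda>i j. G (Suc i) j) + binomial_rec N (\<lambda>i j. G i (Suc j))"

lemma unsh_replicate:
  assumes "p a = 0"
  shows "unsh p (replicate N a @ xs) F
    = binomial_rec N (\<lambda>i j. unsh p xs (\<lambda>A B. F (replicate i a @ A) (replicate j a @ B)))"
  by (induction N arbitrary: F) (simp_all add: assms)

lemma (in vector_space) binomial_rec_eq_sum:
  "binomial_rec N G = (\<Sum>i\<le>N. scale (of_nat (N choose i)) (G i (N - i)))"
proof (induction N arbitrary: G)
  case (Suc N)
  \<comment> \<open>The extra term \<open>i = Suc N\<close> has coefficient 0; with it the sum is
    aligned for Pascal's rule.\<close>
  have "(\<Sum>i\<le>N. scale (of_nat (N choose i)) (G i (Suc (N - i))))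
      = (\<Sum>i\<le>Suc N. scale (of_nat (N choose i)) (G i (Suc N - i)))"
    by (simp add: Suc_diff_le binomial_eq_0)
  also have "\<dots> = G 0 (Suc N) + (\<Sum>i\<le>N. scale (of_nat (N choose Suc i)) (G (Suc i) (N - i)))"
    unfolding sum.atMost_Suc_shift by simp
  finally show ?case
    unfolding binomial_rec.simps Suc.IH sum.atMost_Suc_shift[of _ N]
    by (simp add: scale_left_distrib sum.distrib algebra_simps)
qed simp

abbreviation absdeg :: "(int \<times> 'w) list \<Rightarrow> int" where
  "absdeg zs \<equiv> \<Sum>z\<leftarrow>zs. \<bar>fst z\<bar>"

lemma absdeg_nonneg: "0 \<le> absdeg zs"
  by (rule sum_list_nonneg) auto

text \<open>Homogeneous elements are carried around with their degree as pairs \<open>(d, x)\<close>. The splitting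
  with \<open>A = []\<close> contributes nothing to the Jacobi identity because \<open>l 0 [] = 0\<close>. The bound in
  \<open>nilpotent\<close> does not grow when elements of degree 0 are inserted, which makes all twisting sums
  finite.\<close>

locale nil_linfty = vector_space sc for sc :: "'k::field_char_0 \<Rightarrow> 'w::ab_group_add \<Rightarrow> 'w" +
  fixes H :: "int \<Rightarrow> 'w set" and l :: "nat \<Rightarrow> 'w list \<Rightarrow> 'w"
  fixes brk :: "(int \<times> 'w) list \<Rightarrow> 'w" and S :: "(int \<times> 'w) set"
  defines "brk \<equiv> \<lambda>zs. l (length zs) (map snd zs)" and "S \<equiv> {z. snd z \<in> H (fst z)}"
  assumes graded: "graded_vs sc H"
    and l_Nil: "l 0 [] = 0"
    and degree: "set zs \<subseteq> S \<Longrightarrow> brk zs \<in> H (tdeg fst zs + 1)"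
    and linear: "set (X @ Y) \<subseteq> S \<Longrightarrow> x \<in> H d \<Longrightarrow> y \<in> H d \<Longrightarrow>
      brk (X @ (d, sc c x + y) # Y) = sc c (brk (X @ (d, x) # Y)) + brk (X @ (d, y) # Y)"
    and symmetric: "set (X @ u # v # Y) \<subseteq> S \<Longrightarrow>
      brk (X @ u # v # Y) = sgnv (fst u * fst v) (brk (X @ v # u # Y))"
    and jacobi: "set zs \<subseteq> S \<Longrightarrow> unsh fst zs (\<lambda>A B. brk ((tdeg fst A + 1, brk A) # B)) = 0"
    and nilpotent: "set zs \<subseteq> S \<Longrightarrow> 3 + absdeg zs < int (length zs) \<Longrightarrow> brk zs = 0"
begin

lemma H_zero: "0 \<in> H d" and H_add: "x \<in> H d \<Longrightarrow> y \<in> H d \<Longrightarrow> x + y \<in> H d"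
  and H_scale: "x \<in> H d \<Longrightarrow> sc c x \<in> H d"
  using graded by (auto simp: graded_vs_def)

lemma H_sum: "(\<And>i. i \<in> I \<Longrightarrow> f i \<in> H d) \<Longrightarrow> sum f I \<in> H d"
  by (induction I rule: infinite_finite_induct) (auto intro: H_zero H_add)

lemma brk_Nil [simp]: "brk [] = 0"
  by (simp add: brk_def l_Nil)

lemma linfty: "linfty_algebra sc H l"
  unfolding linfty_algebra_def
proof (intro conjI allI impI; (elim conjE)?)
  show "graded_vs sc H" by (rule graded)
next
  fix k ds xs assume "length ds = k" and h: "homog_list H ds xs"
  then have "set (zip ds xs) \<subseteq> S"
    by (auto simp: homog_list_def S_def set_zip)
  from degree[OF this] show "l k xs \<in> H (sum_list ds + 1)"
    using h \<open>length ds = k\<close> by (simp add: brk_def tdeg_def homog_list_def)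
next
  fix k ds xs i a b c
  assume k: "length ds = k" and h: "homog_list H ds xs" and i: "i < k"
    and a: "a \<in> H (ds ! i)" and b: "b \<in> H (ds ! i)"
  let ?zs = "zip ds xs"
  let ?X = "take i ?zs" and ?Y = "drop (Suc i) ?zs"
  have "set ?zs \<subseteq> S" using h by (auto simp: homog_list_def S_def set_zip)
  then have XY: "set (?X @ ?Y) \<subseteq> S"
    using set_take_subset[of i ?zs] set_drop_subset[of "Suc i" ?zs] by auto
  have u: "l k (xs[i := y]) = brk (?X @ (ds ! i, y) # ?Y)" for y
    using h k i by (simp add: brk_def homog_list_def take_map[symmetric] drop_map[symmetric] upd_conv_take_nth_drop)
  show "l k (xs[i := sc c a + b]) = sc c (l k (xs[i := a])) + l k (xs[i := b])"
    unfolding u by (rule linear[OF XY a b])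
next
  fix k ds xs \<sigma> assume k: "length ds = k" and h: "homog_list H ds xs" and \<sigma>: "\<sigma> permutes {..<k}"
  let ?zs = "zip ds xs"
  have len: "length ?zs = k" and fst: "map fst ?zs = ds" and snd: "map snd ?zs = xs"
    using h k by (simp_all add: homog_list_def)
  have "set ?zs \<subseteq> S" using h by (auto simp: homog_list_def S_def set_zip)
  then have "brk (permute_list \<sigma> ?zs) = sgnv (koszul (map fst ?zs) \<sigma>) (brk ?zs)"
    using \<sigma> len by (intro permute_sign[where S = S] symmetric) auto
  moreover have "map snd (permute_list \<sigma> ?zs) = permute_list \<sigma> xs"
    using permute_list_map[of \<sigma> ?zs snd] \<sigma> len snd by simp
  ultimately show "l k (permute_list \<sigma> xs) = sgnv (koszul ds \<sigma>) (l k xs)"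
    using len by (simp add: brk_def fst snd)
next
  fix n ds xs assume n: "length ds = n" and h: "homog_list H ds xs"
  let ?zs = "zip ds xs"
  have len: "length ?zs = n" and fst: "map fst ?zs = ds" and snd: "map snd ?zs = xs"
    using h n by (simp_all add: homog_list_def)
  have S: "set ?zs \<subseteq> S" using h by (auto simp: homog_list_def S_def set_zip)
  have lens: "length ds = n" "length xs = n"
    using h n by (simp_all add: homog_list_def)
  let ?J = "\<lambda>A B. brk ((tdeg fst A + 1, brk A) # B)"
  have sndp: "permute_list \<sigma> xs = map snd (permute_list \<sigma> ?zs)" if "\<sigma> \<in> unshuffles i n" for \<sigma> i
    using permute_list_map[of \<sigma> ?zs snd] that len snd by (simp add: unshuffles_def)
  have "(\<Sum>i\<in>{1..n}. \<Sum>\<sigma>\<in>unshuffles i n. sgnv (koszul ds \<sigma>)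
      (l (n - i + 1) (l i (take i (permute_list \<sigma> xs)) # drop i (permute_list \<sigma> xs))))
    = (\<Sum>i\<in>{1..n}. \<Sum>\<sigma>\<in>unshuffles i n. sgnv (koszul (map fst ?zs) \<sigma>)
      (?J (take i (permute_list \<sigma> ?zs)) (drop i (permute_list \<sigma> ?zs))))"
    by (intro sum.cong refl) (simp add: sndp brk_def take_map drop_map len fst min_absorb2 lens)
  also have "\<dots> = (\<Sum>i\<in>{1..n}. unsh fst ?zs (\<lambda>A B. if length A = i then ?J A B else 0))"
    using sum_unshuffles_koszul[of _ ?zs fst ?J] len by (intro sum.cong refl) auto
  also have "\<dots> = unsh fst ?zs (\<lambda>A B. \<Sum>i\<in>{1..n}. if length A = i then ?J A B else 0)"
    by (rule unsh_sum[symmetric]) simp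
  also have "\<dots> = unsh fst ?zs ?J"
  proof (rule unsh_cong)
    fix A B assume m: "mset A + mset B = mset ?zs"
    then have l: "length A + length B = n" using len mset_parts(3)[OF m subset_refl] by simp
    show "(\<Sum>i\<in>{1..n}. if length A = i then ?J A B else 0) = ?J A B"
    proof (cases "A = []")
      \<comment> \<open>The definition of an L-infinity algebra sums over \<open>i\<close> from 1,
        whereas \<open>unsh\<close> also has the splitting with empty left block. Its inner bracket
        is \<open>brk [] = 0\<close>, and a bracket with an entry 0 vanishes by additivity.\<close>
      case True
      have "set B \<subseteq> S" using m S True by (metis add_0 mset.simps(1) set_mset_mset)
      then have "brk ([] @ (1, sc 0 0 + 0) # B) = sc 0 (brk ([] @ (1, 0) # B)) + brk ([] @ (1, 0) # B)"
        using H_zero by (intro linear) auto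
      moreover have "brk ([] @ (1, sc 1 0 + 0) # B) = sc 1 (brk ([] @ (1, 0) # B)) + brk ([] @ (1, 0) # B)"
        using H_zero \<open>set B \<subseteq> S\<close> by (intro linear) auto
      ultimately show ?thesis using True by auto
    next
      case False
      then have "length A \<in> {1..n}" using l by (cases A) auto
      then show ?thesis by simp
    qed
  qed
  also have "\<dots> = 0" by (rule jacobi[OF S])
  finally show "(\<Sum>i\<in>{1..n}. \<Sum>\<sigma>\<in>unshuffles i n. sgnv (koszul ds \<sigma>)
      (l (n - i + 1) (l i (take i (permute_list \<sigma> xs)) # drop i (permute_list \<sigma> xs)))) = 0" .
qed

lemma brk_zero:
  assumes "set (X @ Y) \<subseteq> S"
  shows "brk (X @ (d, 0) # Y) = 0"
  using linear[OF assms H_zero[of d] H_zero[of d], of 1] by simp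

lemma brk_sum:
  assumes "set (X @ Y) \<subseteq> S" and "\<And>i. i \<in> I \<Longrightarrow> x i \<in> H d"
  shows "brk (X @ (d, \<Sum>i\<in>I. sc (c i) (x i)) # Y) = (\<Sum>i\<in>I. sc (c i) (brk (X @ (d, x i) # Y)))"
  using assms(2)
proof (induction I rule: infinite_finite_induct)
  case (insert i I)
  have "(\<Sum>i\<in>I. sc (c i) (x i)) \<in> H d" using insert.prems by (intro H_sum H_scale) auto
  then show ?case using insert linear[OF assms(1), of "x i" d] by simp
qed (simp_all add: brk_zero[OF assms(1)])

lemma brk_move:
  assumes "set (X @ y # Y) \<subseteq> S" and "a \<in> H 0"
  shows "brk (X @ replicate n (0, a) @ y # Y) = brk (X @ y # replicate n (0, a) @ Y)"
  using assms(1)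
proof (induction n arbitrary: X)
  case (Suc n)
  have "(0, a) \<in> S" using assms(2) by (simp add: S_def)
  then have "brk ((X @ [(0, a)]) @ replicate n (0, a) @ y # Y) = brk ((X @ [(0, a)]) @ y # replicate n (0, a) @ Y)"
    by (intro Suc.IH) (use Suc.prems in auto)
  also have "\<dots> = brk (X @ y # (0, a) # replicate n (0, a) @ Y)"
    using symmetric[of X "(0, a)" y "replicate n (0, a) @ Y"] Suc.prems \<open>(0, a) \<in> S\<close>
    by (simp add: set_replicate_conv_if)
  finally show ?case by simp
qed simp

lemma brk_binomial:
  assumes "set X \<subseteq> S" and a: "a \<in> H 0" and a': "a' \<in> H 0"
  shows "brk (X @ replicate N (0, a + a')) = binomial_rec N (\<lambda>i j. brk (X @ replicate i (0, a) @ replicate j (0, a')))"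
  using assms(1)
proof (induction N arbitrary: X)
  case (Suc N)
  have S: "(0, a) \<in> S" "(0, a') \<in> S" "(0, a + a') \<in> S" using a a' H_add by (simp_all add: S_def)
  have "brk (X @ (0, sc 1 a + a') # replicate N (0, a + a'))
      = sc 1 (brk (X @ (0, a) # replicate N (0, a + a'))) + brk (X @ (0, a') # replicate N (0, a + a'))"
    using Suc.prems S a a' by (intro linear) auto
  then have "brk (X @ replicate (Suc N) (0, a + a'))
      = brk ((X @ [(0, a)]) @ replicate N (0, a + a')) + brk ((X @ [(0, a')]) @ replicate N (0, a + a'))"
    by simp
  also have "brk ((X @ [(0, a)]) @ replicate N (0, a + a')) = binomial_rec N (\<lambda>i j. brk (X @ replicate (Suc i) (0, a) @ replicate j (0, a')))"
    using Suc.IH[of "X @ [(0, a)]"] Suc.prems S by simp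
  also have "brk ((X @ [(0, a')]) @ replicate N (0, a + a')) = binomial_rec N (\<lambda>i j. brk (X @ (0, a') # replicate i (0, a) @ replicate j (0, a')))"
    using Suc.IH[of "X @ [(0, a')]"] Suc.prems S by simp
  also have "\<dots> = binomial_rec N (\<lambda>i j. brk (X @ replicate i (0, a) @ replicate (Suc j) (0, a')))"
  proof -
    have "set (X @ (0, a') # replicate j (0, a')) \<subseteq> S" for j
      using Suc.prems S by auto
    from brk_move[OF this a] show ?thesis by simp
  qed
  finally show ?case by simp
qed simp

text \<open>The product rule for exponential series: collecting the terms with
  \<open>i + j = N\<close> turns \<open>1 / (i! j!)\<close> into \<open>1 / N!\<close> times a
  binomial coefficient.\<close>

lemma sum_binomial_rec:
  assumes z: "\<And>i j. K \<le> i \<or> K \<le> j \<Longrightarrow> g i j = 0"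
  shows "(\<Sum>i<K. \<Sum>j<K. sc (inverse (fact i) * inverse (fact j)) (g i j))
    = (\<Sum>N<2 * K. sc (inverse (fact N)) (binomial_rec N g))"
proof -
  let ?h = "\<lambda>i j. sc (inverse (fact i) * inverse (fact j)) (g i j)"
  have "(\<Sum>N<2 * K. sc (inverse (fact N)) (binomial_rec N g)) = (\<Sum>N<2 * K. \<Sum>i\<le>N. ?h i (N - i))"
  proof (intro sum.cong refl)
    fix N
    have "sc (inverse (fact N)) (binomial_rec N g) = (\<Sum>i\<le>N. sc (inverse (fact N) * of_nat (N choose i)) (g i (N - i)))"
      by (simp add: binomial_rec_eq_sum scale_sum_right)
    also have "\<dots> = (\<Sum>i\<le>N. ?h i (N - i))"
      by (intro sum.cong refl) (simp add: binomial_fact field_simps)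
    finally show "sc (inverse (fact N)) (binomial_rec N g) = (\<Sum>i\<le>N. ?h i (N - i))" .
  qed
  also have "\<dots> = (\<Sum>(i, j)\<in>{(i, j). i + j < 2 * K}. ?h i j)"
    by (rule sum.triangle_reindex[symmetric])
  \<comment> \<open>The triangle below \<open>2 * K\<close> contains the square of side
    \<open>K\<close>, and \<open>g\<close> vanishes outside the square.\<close>
  also have "\<dots> = (\<Sum>(i, j)\<in>{..<K} \<times> {..<K}. ?h i j)"
  proof (rule sum.mono_neutral_right)
    have "{(i, j). i + j < 2 * K} \<subseteq> {..<2 * K} \<times> {..<2 * K}" by auto
    then show "finite {(i, j). i + j < 2 * K}" by (rule finite_subset) simp
  next
    show "\<forall>x\<in>{(i, j). i + j < 2 * K} - {..<K} \<times> {..<K}. (case x of (i, j) \<Rightarrow> ?h i j) = 0"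
    proof
      fix x assume "x \<in> {(i, j). i + j < 2 * K} - {..<K} \<times> {..<K}"
      then have "K \<le> fst x \<or> K \<le> snd x" by auto
      then show "(case x of (i, j) \<Rightarrow> ?h i j) = 0" using z by (simp add: case_prod_unfold)
    qed
  qed auto
  also have "\<dots> = (\<Sum>i<K. \<Sum>j<K. ?h i j)"
    by (simp add: sum.cartesian_product)
  finally show ?thesis by simp
qed

lemma nilpotent_replicate:
  assumes "set zs \<subseteq> S" and "a \<in> H 0" and "3 + absdeg zs < int n"
  shows "brk (replicate n (0, a) @ zs) = 0"
  by (rule nilpotent) (use assms in \<open>auto simp: S_def sum_list_replicate\<close>)

lemma twisting_finite:
  assumes "a \<in> H 0"
  shows "twisting_finite H l a"
  unfolding twisting_finite_def
proof (intro allI impI; elim conjE)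
  fix k ds xs assume k: "length ds = k" and h: "homog_list H ds xs"
  let ?zs = "zip ds xs"
  let ?K = "nat (4 + absdeg ?zs)"
  have "set ?zs \<subseteq> S" using h by (auto simp: homog_list_def S_def set_zip)
  then have "brk (replicate n (0, a) @ ?zs) = 0" if "?K \<le> n" for n
    using that absdeg_nonneg[of ?zs] by (intro nilpotent_replicate assms) auto
  moreover have "brk (replicate n (0, a) @ ?zs) = l (k + n) (replicate n a @ xs)" for n
    using h k by (simp add: brk_def homog_list_def map_replicate add.commute)
  ultimately have "{n. l (k + n) (replicate n a @ xs) \<noteq> 0} \<subseteq> {..<?K}"
    by (auto simp: not_le[symmetric])
  then show "finite {n. l (k + n) (replicate n a @ xs) \<noteq> 0}" by (rule finite_subset) simp
qed

section \<open>Twisted brackets and Maurer-Cartan sums over a common finite range\<close>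

definition tw :: "'w \<Rightarrow> (int \<times> 'w) list \<Rightarrow> 'w" where
  "tw a zs = twisted sc l a (length zs) (map snd zs)"

text \<open>\<open>twisted\<close> sums over the support, which changes with the arguments. Any
  large enough common range gives the same value, so identities between several twisted brackets can
  be checked term by term.\<close>

lemma tw_eq:
  assumes "set zs \<subseteq> S" and "a \<in> H 0" and K: "3 + absdeg zs < int K"
  shows "tw a zs = (\<Sum>n<K. sc (inverse (fact n)) (brk (replicate n (0, a) @ zs)))"
proof -
  have e: "l (length zs + n) (replicate n a @ map snd zs) = brk (replicate n (0, a) @ zs)" for n
    by (simp add: brk_def map_replicate add.commute)
  have z: "brk (replicate n (0, a) @ zs) = 0" if "K \<le> n" for n
    by (rule nilpotent_replicate) (use assms that in auto)
  have "tw a zs = (\<Sum>n | brk (replicate n (0, a) @ zs) \<noteq> 0. sc (inverse (fact n)) (brk (replicate n (0, a) @ zs)))"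
    by (simp add: tw_def twisted_def e)
  also have "\<dots> = (\<Sum>n<K. sc (inverse (fact n)) (brk (replicate n (0, a) @ zs)))"
    by (rule sum.mono_neutral_left) (use z in \<open>auto simp: not_le[symmetric]\<close>)
  finally show ?thesis .
qed

text \<open>For arguments of degree 0 the nilpotency bound kills all brackets with more than three
  entries, whence the 4. The term \<open>n = 0\<close> is harmless because
  \<open>brk [] = 0\<close>. Leaving \<open>K\<close> free allows different ranges to be matched
  later.\<close>

lemma maurer_cartan_iff:
  assumes "a \<in> H 0" and "4 \<le> K"
  shows "maurer_cartan sc H l a \<longleftrightarrow> (\<Sum>n<K. sc (inverse (fact n)) (brk (replicate n (0, a)))) = 0"
proof -
  have e: "l n (replicate n a) = brk (replicate n (0, a))" for n
    by (simp add: brk_def map_replicate)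
  have z: "brk (replicate n (0, a)) = 0" if "K \<le> n" for n
    using nilpotent_replicate[of "[]" a n] assms that by simp
  have sub: "{n. 1 \<le> n \<and> brk (replicate n (0, a)) \<noteq> 0} \<subseteq> {..<K}"
    using z by (auto simp: not_le[symmetric])
  have "(\<Sum>n | 1 \<le> n \<and> brk (replicate n (0, a)) \<noteq> 0. sc (inverse (fact n)) (brk (replicate n (0, a))))
    = (\<Sum>n<K. sc (inverse (fact n)) (brk (replicate n (0, a))))"
  proof (rule sum.mono_neutral_left[OF _ sub])
    show "\<forall>n\<in>{..<K} - {n. 1 \<le> n \<and> brk (replicate n (0, a)) \<noteq> 0}. sc (inverse (fact n)) (brk (replicate n (0, a))) = 0"
    proof
      fix n assume "n \<in> {..<K} - {n. 1 \<le> n \<and> brk (replicate n (0, a)) \<noteq> 0}"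
      then have "n = 0 \<or> brk (replicate n (0, a)) = 0" by auto
      then show "sc (inverse (fact n)) (brk (replicate n (0, a))) = 0" by auto
    qed
  qed simp
  then show ?thesis
    using finite_subset[OF sub] assms(1) by (simp add: maurer_cartan_def e)
qed

text \<open>The twisted bracket without arguments is the curvature, that is, the left side of the
  Maurer-Cartan equation.\<close>

lemma tw_Nil: "maurer_cartan sc H l a \<Longrightarrow> tw a [] = 0"
proof -
  assume mc: "maurer_cartan sc H l a"
  then have a: "a \<in> H 0" by (simp add: maurer_cartan_def)
  show "tw a [] = 0"
    using mc tw_eq[of "[]" a 4] maurer_cartan_iff[OF a, of 4] a by simp
qed

text \<open>Sum the Jacobi identities of \<open>replicate N (0, a) @ zs\<close> with weights \<open>1 / N!\<close>. Splittings in which the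
  inner bracket receives only copies of \<open>a\<close> add up to the Maurer-Cartan equation.\<close>

lemma tw_jacobi:
  assumes mc: "maurer_cartan sc H l a" and zs: "set zs \<subseteq> S"
  shows "unsh fst zs (\<lambda>A B. tw a ((tdeg fst A + 1, tw a A) # B)) = 0"
proof -
  have a: "a \<in> H 0" using mc by (simp add: maurer_cartan_def)
  let ?R = "\<lambda>n. replicate n (0::int, a)"
  have R: "set (?R n) \<subseteq> S" for n using a by (auto simp: S_def)
  \<comment> \<open>The outer bracket has the additional entry of degree
    \<open>tdeg fst A + 1\<close>, which may raise \<open>absdeg\<close> by 1. The range must
    therefore exceed \<open>3 + (1 + absdeg zs)\<close>.\<close>
  define K where "K = nat (5 + absdeg zs)"
  have K: "int K = 5 + absdeg zs" using absdeg_nonneg[of zs] by (simp add: K_def)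
  define G where "G = (\<lambda>i j A B. brk ((tdeg fst A + 1, brk (?R i @ A)) # ?R j @ B))"
  have parts: "set A \<subseteq> S" "set B \<subseteq> S" "absdeg A + absdeg B = absdeg zs"
    if m: "mset A + mset B = mset zs" for A B
    using mset_parts(1,2)[OF m zs] mset_parts(4)[OF m zs, of "\<lambda>z. \<bar>fst z\<bar>"] by (simp_all add: tdeg_def)
  have inH: "brk (?R i @ A) \<in> H (tdeg fst A + 1)" if "set A \<subseteq> S" for i A
    using degree[of "?R i @ A"] that R by simp
  have dgb: "\<bar>tdeg fst X\<bar> \<le> absdeg X" for X :: "(int \<times> 'w) list"
    by (induction X) auto
  have 1: "tw a ((tdeg fst A + 1, tw a A) # B)
     = (\<Sum>j<K. \<Sum>i<K. sc (inverse (fact i) * inverse (fact j)) (G i j A B))"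
    if m: "mset A + mset B = mset zs" for A B
  proof -
    note AB = parts[OF m]
    let ?y = "(tdeg fst A + 1, tw a A)"
    have twA: "tw a A = (\<Sum>i<K. sc (inverse (fact i)) (brk (?R i @ A)))"
      by (rule tw_eq) (use AB a K absdeg_nonneg[of B] in auto)
    then have "tw a A \<in> H (tdeg fst A + 1)"
      using inH[OF AB(1)] by (simp add: H_sum H_scale)
    then have y: "?y \<in> S" by (simp add: S_def)
    have "\<bar>tdeg fst A + 1\<bar> \<le> 1 + absdeg A" using dgb[of A] by simp
    then have "tw a (?y # B) = (\<Sum>j<K. sc (inverse (fact j)) (brk (?R j @ ?y # B)))"
      by (intro tw_eq) (use AB a K y in auto)
    also have "\<dots> = (\<Sum>j<K. sc (inverse (fact j)) (brk (?y # ?R j @ B)))"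
      using brk_move[of "[]" ?y B a] AB y a by simp
    also have "\<dots> = (\<Sum>j<K. sc (inverse (fact j)) (\<Sum>i<K. sc (inverse (fact i)) (G i j A B)))"
      using brk_sum[of "[]" "?R _ @ B" "{..<K}" "\<lambda>i. brk (?R i @ A)" "tdeg fst A + 1"] AB R inH
      by (simp add: twA G_def)
    finally show ?thesis by (simp add: scale_sum_right mult.commute)
  qed
  have "unsh fst zs (\<lambda>A B. tw a ((tdeg fst A + 1, tw a A) # B))
    = unsh fst zs (\<lambda>A B. \<Sum>j<K. \<Sum>i<K. sc (inverse (fact i) * inverse (fact j)) (G i j A B))"
    by (rule unsh_cong) (rule 1)
  also have "\<dots> = (\<Sum>j<K. \<Sum>i<K. sc (inverse (fact i) * inverse (fact j)) (unsh fst zs (G i j)))"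
    by (simp add: unsh_sum unsh_scale)
  also have "\<dots> = (\<Sum>i<K. \<Sum>j<K. sc (inverse (fact i) * inverse (fact j)) (unsh fst zs (G i j)))"
    by (rule sum.swap)
  also have "\<dots> = (\<Sum>N<2 * K. sc (inverse (fact N)) (binomial_rec N (\<lambda>i j. unsh fst zs (G i j))))"
  proof (rule sum_binomial_rec)
    fix i j assume ij: "K \<le> i \<or> K \<le> j"
    show "unsh fst zs (G i j) = 0"
    proof (rule unsh_eq_0)
      fix A B assume m: "mset A + mset B = mset zs"
      note AB = parts[OF m]
      show "G i j A B = 0"
      proof (cases "K \<le> i")
        case True
        then have "brk (?R i @ A) = 0"
          by (intro nilpotent_replicate) (use AB a K absdeg_nonneg[of B] in auto)
        then show ?thesis
          using brk_zero[of "[]" "?R j @ B"] AB R by (simp add: G_def)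
      next
        case False
        have "\<bar>tdeg fst A + 1\<bar> \<le> 1 + absdeg A" using dgb[of A] by simp
        then show ?thesis unfolding G_def
          by (intro nilpotent)
            (use False ij AB a K inH[OF AB(1), of i] R[of j] in \<open>auto simp: S_def sum_list_replicate\<close>)
      qed
    qed
  qed
  also have "\<dots> = 0"
  proof (rule sum.neutral, rule ballI)
    fix N
    have "binomial_rec N (\<lambda>i j. unsh fst zs (G i j)) = unsh fst (?R N @ zs) (\<lambda>A B. brk ((tdeg fst A + 1, brk A) # B))"
      by (subst unsh_replicate) (simp_all add: G_def)
    also have "\<dots> = 0" using zs R by (intro jacobi) auto
    finally show "sc (inverse (fact N)) (binomial_rec N (\<lambda>i j. unsh fst zs (G i j))) = 0" by simp
  qed
  finally show ?thesis .
qed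

text \<open>Degree, linearity, symmetry and nilpotency pass termwise to brackets with extra copies
  of \<open>a\<close>, since entries of degree 0 change neither signs nor \<open>absdeg\<close>. The
  Maurer-Cartan equation enters through the empty bracket and the Jacobi identity. Staying inside
  the locale makes \<open>maurer_cartan_iff\<close> available for the twisted brackets too.\<close>

theorem nil_linfty_twisted:
  assumes mc: "maurer_cartan sc H l a"
  shows "nil_linfty sc H (twisted sc l a)"
proof -
  have a: "a \<in> H 0" using mc by (simp add: maurer_cartan_def)
  let ?R = "\<lambda>n. replicate n (0::int, a)"
  have R: "set (?R n) \<subseteq> S" for n using a by (auto simp: S_def)
  have big: "\<exists>K. 3 + absdeg X < int K" for X :: "(int \<times> 'w) list"
    by (rule exI[of _ "nat (4 + absdeg X)"]) (use absdeg_nonneg[of X] in simp)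
  have "nil_linfty_axioms sc H (twisted sc l a)"
    unfolding nil_linfty_axioms_def tw_def[symmetric] S_def[symmetric]
  proof (intro conjI allI impI)
    show "graded_vs sc H" by (rule graded)
    show "twisted sc l a 0 [] = 0" using tw_Nil[OF mc] by (simp add: tw_def)
    show "tw a zs \<in> H (tdeg fst zs + 1)" if "set zs \<subseteq> S" for zs
    proof -
      obtain K where K: "3 + absdeg zs < int K" using big by blast
      have "brk (?R n @ zs) \<in> H (tdeg fst zs + 1)" for n
        using degree[of "?R n @ zs"] that R by simp
      then show ?thesis unfolding tw_eq[OF that a K] by (intro H_sum H_scale)
    qed
    show "tw a (X @ (d, sc c x + y) # Y) = sc c (tw a (X @ (d, x) # Y)) + tw a (X @ (d, y) # Y)"
      if XY: "set (X @ Y) \<subseteq> S" and xy: "x \<in> H d" "y \<in> H d" for X Y x d y c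
    proof -
      obtain K where K: "3 + absdeg (X @ (d, 0) # Y) < int K" using big by blast
      have t: "tw a (X @ (d, w) # Y) = (\<Sum>n<K. sc (inverse (fact n)) (brk ((?R n @ X) @ (d, w) # Y)))"
        if "w \<in> H d" for w
        by (subst tw_eq[of _ _ K]) (use that XY K a in \<open>auto simp: S_def\<close>)
      have "brk ((?R n @ X) @ (d, sc c x + y) # Y) = sc c (brk ((?R n @ X) @ (d, x) # Y)) + brk ((?R n @ X) @ (d, y) # Y)" for n
        using XY xy R by (intro linear) auto
      then show ?thesis
        unfolding t[OF H_add[OF H_scale[OF xy(1)] xy(2)]] t[OF xy(1)] t[OF xy(2)]
        by (simp add: sum.distrib scale_right_distrib scale_sum_right mult.commute)
    qed
    show "tw a (X @ u # v # Y) = sgnv (fst u * fst v) (tw a (X @ v # u # Y))"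
      if s: "set (X @ u # v # Y) \<subseteq> S" for X u v Y
    proof -
      obtain K where K: "3 + absdeg (X @ u # v # Y) < int K" using big by blast
      have s': "set (X @ v # u # Y) \<subseteq> S" and K': "3 + absdeg (X @ v # u # Y) < int K"
        using s K by auto
      have "brk ((?R n @ X) @ u # v # Y) = sgnv (fst u * fst v) (brk ((?R n @ X) @ v # u # Y))" for n
        using s R by (intro symmetric) auto
      then show ?thesis
        unfolding tw_eq[OF s a K] tw_eq[OF s' a K'] sgnv_sum by (simp add: scale_sgnv)
    qed
    show "unsh fst zs (\<lambda>A B. tw a ((tdeg fst A + 1, tw a A) # B)) = 0" if "set zs \<subseteq> S" for zs
      by (rule tw_jacobi[OF mc that])
    show "tw a zs = 0" if s: "set zs \<subseteq> S" and g: "3 + absdeg zs < int (length zs)" for zs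
    proof -
      obtain K where K: "3 + absdeg zs < int K" using big by blast
      have "brk (?R n @ zs) = 0" for n
        using s R g by (intro nilpotent) (auto simp: sum_list_replicate)
      then show ?thesis unfolding tw_eq[OF s a K] by simp
    qed
  qed
  then show ?thesis by (intro nil_linfty.intro vector_space_axioms)
qed

text \<open>Both sides are the sum of \<open>1 / (i! j!)\<close> times the bracket of
  \<open>i\<close> copies of \<open>a\<close> and \<open>j\<close> copies of \<open>a'\<close>: on
  the left by twisting, on the right by multilinear expansion. Regrouping a square of side 4 gives
  eight values of \<open>N\<close>, which \<open>maurer_cartan_iff\<close> accepts as a
  range.\<close>

theorem maurer_cartan_twisted_iff:
  assumes mc: "maurer_cartan sc H l a" and a': "a' \<in> H 0"
  shows "maurer_cartan sc H (twisted sc l a) a' \<longleftrightarrow> maurer_cartan sc H l (a + a')"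
proof -
  have a: "a \<in> H 0" using mc by (simp add: maurer_cartan_def)
  let ?g = "\<lambda>i j. brk (replicate i (0, a) @ replicate j (0, a'))"
  have S: "set (replicate j (0, a')) \<subseteq> S" "set (replicate j (0, a)) \<subseteq> S" for j
    using a a' by (auto simp: S_def)
  have "maurer_cartan sc H (twisted sc l a) a' \<longleftrightarrow> (\<Sum>j<4. sc (inverse (fact j)) (tw a (replicate j (0, a')))) = 0"
    using nil_linfty.maurer_cartan_iff[OF nil_linfty_twisted[OF mc] a', of 4] by (simp add: tw_def)
  also have "(\<Sum>j<4. sc (inverse (fact j)) (tw a (replicate j (0, a'))))
     = (\<Sum>j<4. \<Sum>i<4. sc (inverse (fact i) * inverse (fact j)) (?g i j))"
    by (subst tw_eq[of _ _ 4]) (use S a in \<open>auto simp: sum_list_replicate scale_sum_right mult.commute\<close>)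
  also have "\<dots> = (\<Sum>i<4. \<Sum>j<4. sc (inverse (fact i) * inverse (fact j)) (?g i j))"
    by (rule sum.swap)
  also have "\<dots> = (\<Sum>N<2 * 4. sc (inverse (fact N)) (binomial_rec N ?g))"
    using S by (intro sum_binomial_rec nilpotent) (auto simp: sum_list_replicate)
  also have "\<dots> = (\<Sum>N<8. sc (inverse (fact N)) (brk (replicate N (0, a + a'))))"
    using brk_binomial[of "[]", OF _ a a'] by simp
  also have "\<dots> = 0 \<longleftrightarrow> maurer_cartan sc H l (a + a')"
    by (rule maurer_cartan_iff[symmetric]) (use a a' H_add in auto)
  finally show ?thesis .
qed

end

section \<open>Higher derived brackets\<close>

lemma sgnv_1_add: "sgnv (1 + e) v = - sgnv e v"
  by (simp add: sgnv_def)

lemma unsh_commute: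
  "unsh p xs (\<lambda>A B. unsh q ys (\<lambda>C E. F A B C E)) = unsh q ys (\<lambda>C E. unsh p xs (\<lambda>A B. F A B C E))"
  by (induction xs arbitrary: F) (simp_all add: unsh_add unsh_sgnv[symmetric])

text \<open>Of four blocks the two middle ones are exchanged. In the Jacobi identity this changes
  the grouping from inner against outer arguments to the two elements contributing their
  \<open>M\<close>-parts against all others.\<close>

lemma unsh_middle_swap:
  "unsh p xs (\<lambda>A B. unsh p A (\<lambda>A1 A2. unsh p B (\<lambda>C E. Q A1 A2 C E)))
   = unsh p xs (\<lambda>A B. unsh p A (\<lambda>A1 C. unsh p B (\<lambda>A2 E. sgnv (tdeg p A2 * tdeg p C) (Q A1 A2 C E))))"
proof -
  have "unsh p B (\<lambda>A2 B'. unsh p B' (\<lambda>C E. Q A1 A2 C E))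
    = unsh p B (\<lambda>C B'. unsh p B' (\<lambda>A2 E. sgnv (tdeg p A2 * tdeg p C) (Q A1 A2 C E)))" for A1 B
    unfolding unsh_coassoc[symmetric] by (subst unsh_cocomm) (simp add: mult.commute)
  then show ?thesis by (simp add: unsh_coassoc)
qed

lemma unsh_singletons:
  "unsh p A (\<lambda>B C. if length B = 1 \<and> length C = 1 then F B C else 0)
   = (if length A = 2 then F [A ! 0] [A ! 1] + sgnv (p (A ! 0) * p (A ! 1)) (F [A ! 1] [A ! 0]) else 0)"
proof (cases "length A = 2")
  case True
  then obtain a c where "A = [a, c]" by (auto simp: numeral_2_eq_2 length_Suc_conv)
  then show ?thesis by (simp add: mult.commute)
next
  case False
  have "unsh p A (\<lambda>B C. if length B = 1 \<and> length C = 1 then F B C else 0) = 0"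
  proof (rule unsh_eq_0)
    fix B C assume "mset B + mset C = mset A"
    then have "length B + length C = length A" using mset_parts(3) by blast
    then show "(if length B = 1 \<and> length C = 1 then F B C else 0) = 0" using False by auto
  qed
  then show ?thesis using False by simp
qed

text \<open>A graded Lie algebra \<open>L\<close> with an abelian subalgebra \<open>Fs\<close> and a projection \<open>P\<close> onto it whose kernel
  is a subalgebra (V-data), together with a subalgebra \<open>M\<close>.\<close>

locale derived_data = vector_space sc for sc :: "'k::field_char_0 \<Rightarrow> 'c::ab_group_add \<Rightarrow> 'c" +
  fixes L M Fs :: "int \<Rightarrow> 'c set" and br :: "'c \<Rightarrow> 'c \<Rightarrow> 'c" and P :: "'c \<Rightarrow> 'c"
  assumes L_zero: "0 \<in> L d" and L_lin: "f \<in> L d \<Longrightarrow> g \<in> L d \<Longrightarrow> sc c f + g \<in> L d"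
    and M_zero: "0 \<in> M d" and M_lin: "f \<in> M d \<Longrightarrow> g \<in> M d \<Longrightarrow> sc c f + g \<in> M d"
    and F_zero: "0 \<in> Fs d" and F_lin: "f \<in> Fs d \<Longrightarrow> g \<in> Fs d \<Longrightarrow> sc c f + g \<in> Fs d"
    and M_L: "f \<in> M d \<Longrightarrow> f \<in> L d" and F_L: "f \<in> Fs d \<Longrightarrow> f \<in> L d"
    and L_indep: "finite D \<Longrightarrow> (\<And>d. d \<in> D \<Longrightarrow> x d \<in> L d) \<Longrightarrow> sum x D = 0 \<Longrightarrow> d \<in> D \<Longrightarrow> x d = 0"
    and br_L: "f \<in> L d \<Longrightarrow> g \<in> L e \<Longrightarrow> br f g \<in> L (d + e)"
    and br_M: "f \<in> M d \<Longrightarrow> g \<in> M e \<Longrightarrow> br f g \<in> M (d + e)"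
    and br_lin_left: "f \<in> L d \<Longrightarrow> f' \<in> L d \<Longrightarrow> g \<in> L e \<Longrightarrow> br (sc c f + f') g = sc c (br f g) + br f' g"
    and br_lin_right: "f \<in> L d \<Longrightarrow> g \<in> L e \<Longrightarrow> g' \<in> L e \<Longrightarrow> br f (sc c g + g') = sc c (br f g) + br f g'"
    and br_anti: "f \<in> L d \<Longrightarrow> g \<in> L e \<Longrightarrow> br f g = sgnv (1 + d * e) (br g f)"
    and br_jacobi: "f \<in> L d \<Longrightarrow> g \<in> L e \<Longrightarrow> h \<in> L k \<Longrightarrow>
      br (br f g) h = br f (br g h) + sgnv (e * k) (br (br f h) g)"
    and P_F: "f \<in> L d \<Longrightarrow> P f \<in> Fs d"
    and P_lin: "P (sc c f + g) = sc c (P f) + P g"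
    and P_F_id: "f \<in> Fs d \<Longrightarrow> P f = f"
    and F_abelian: "f \<in> Fs d \<Longrightarrow> g \<in> Fs e \<Longrightarrow> br f g = 0"
    and P_ker: "f \<in> L d \<Longrightarrow> g \<in> L e \<Longrightarrow> P f = 0 \<Longrightarrow> P g = 0 \<Longrightarrow> P (br f g) = 0"
    and P_nilpotent: "f \<in> M d \<Longrightarrow> (\<And>\<theta>. \<theta> \<in> set \<theta>s \<Longrightarrow> \<exists>e. \<theta> \<in> Fs e) \<Longrightarrow>
      \<bar>d\<bar> + 1 < int (length \<theta>s) \<Longrightarrow> P (foldl br f \<theta>s) = 0"
begin

lemma L_add: "f \<in> L d \<Longrightarrow> g \<in> L d \<Longrightarrow> f + g \<in> L d"
  and L_scale: "f \<in> L d \<Longrightarrow> sc c f \<in> L d"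
  and M_scale: "f \<in> M d \<Longrightarrow> sc c f \<in> M d"
  using L_lin[of f d g 1] L_lin[of f d 0 c] L_zero M_lin[of f d 0 c] M_zero by simp_all

lemma L_minus: "f \<in> L d \<Longrightarrow> - f \<in> L d"
  and L_diff: "f \<in> L d \<Longrightarrow> g \<in> L d \<Longrightarrow> f - g \<in> L d"
  using L_scale[of f d "-1"] L_lin[of g d f "-1"] by simp_all

lemma L_sgnv: "f \<in> L d \<Longrightarrow> sgnv e f \<in> L d"
  by (simp add: sgnv_def L_minus)

lemma M_sgnv: "f \<in> M d \<Longrightarrow> sgnv e f \<in> M d"
  using M_scale[of f d "-1"] by (simp add: sgnv_def)

lemma F_add: "f \<in> Fs d \<Longrightarrow> g \<in> Fs d \<Longrightarrow> f + g \<in> Fs d"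
  and F_minus: "f \<in> Fs d \<Longrightarrow> - f \<in> Fs d"
  using F_lin[of f d g 1] F_lin[of f d 0 "-1"] F_zero by simp_all

lemma br_add_left: "f \<in> L d \<Longrightarrow> f' \<in> L d \<Longrightarrow> g \<in> L e \<Longrightarrow> br (f + f') g = br f g + br f' g"
  using br_lin_left[of f d f' g e 1] by simp

lemma br_add_right: "f \<in> L d \<Longrightarrow> g \<in> L e \<Longrightarrow> g' \<in> L e \<Longrightarrow> br f (g + g') = br f g + br f g'"
  using br_lin_right[of f d g e g' 1] by simp

lemma br_zero_left: "g \<in> L e \<Longrightarrow> br 0 g = 0"
  using br_add_left[OF L_zero L_zero, of g e] by simp

lemma br_zero_right: "f \<in> L d \<Longrightarrow> br f 0 = 0"
  using br_add_right[OF _ L_zero L_zero, of f d] by simp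

lemma br_minus_left: "f \<in> L d \<Longrightarrow> g \<in> L e \<Longrightarrow> br (- f) g = - br f g"
  using br_lin_left[of f d 0 g e "-1"] L_zero br_zero_left by simp

lemma br_minus_right: "f \<in> L d \<Longrightarrow> g \<in> L e \<Longrightarrow> br f (- g) = - br f g"
  using br_lin_right[of f d g e 0 "-1"] L_zero br_zero_right by simp

lemma br_sgnv_left: "f \<in> L d \<Longrightarrow> g \<in> L e \<Longrightarrow> br (sgnv k f) g = sgnv k (br f g)"
  by (simp add: sgnv_def br_minus_left)

lemma br_diff_left: "f \<in> L d \<Longrightarrow> f' \<in> L d \<Longrightarrow> g \<in> L e \<Longrightarrow> br (f - f') g = br f g - br f' g"
  using br_add_left[of f d "- f'" g e] br_minus_left[of f' d g e] L_minus[of f' d] by simp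

lemma br_diff_right: "f \<in> L d \<Longrightarrow> g \<in> L e \<Longrightarrow> g' \<in> L e \<Longrightarrow> br f (g - g') = br f g - br f g'"
  using br_add_right[of f d g e "- g'"] br_minus_right[of f d g' e] L_minus[of g' e] by simp

lemma P_add: "P (f + g) = P f + P g"
  using P_lin[of 1 f g] by simp

lemma P_zero [simp]: "P 0 = 0"
  using P_add[of 0 0] by simp

lemma P_minus: "P (- f) = - P f"
  using P_lin[of "-1" f 0] by simp

lemma P_diff: "P (f - g) = P f - P g"
  using P_add[of f "- g"] by (simp add: P_minus)

lemma P_sgnv: "P (sgnv e f) = sgnv e (P f)"
  by (simp add: sgnv_def P_minus)

text \<open>Write each argument as its image under \<open>P\<close> plus a remainder in the kernel
  of \<open>P\<close>. The bracket of the remainders stays in the kernel and that of the images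
  vanishes, so only the mixed terms survive.\<close>

lemma P_br:
  assumes f: "f \<in> L d" and g: "g \<in> L e"
  shows "P (br f g) = P (br f (P g)) + P (br (P f) g)"
proof -
  have Pf: "P f \<in> L d" "P (P f) = P f" and Pg: "P g \<in> L e" "P (P g) = P g"
    using P_F[OF f] P_F[OF g] by (auto intro: F_L P_F_id)
  have "P (br (f - P f) (g - P g)) = 0"
    by (rule P_ker) (use f g Pf Pg in \<open>auto intro: L_diff simp: P_diff\<close>)
  moreover have "br (f - P f) (g - P g) = br f g - br (P f) g - (br f (P g) - br (P f) (P g))"
    using br_diff_left[OF f Pf(1) L_diff[OF g Pg(1)]] br_diff_right[OF f g Pg(1)]
      br_diff_right[OF Pf(1) g Pg(1)] by simp
  moreover have "br (P f) (P g) = 0" by (rule F_abelian[OF P_F[OF f] P_F[OF g]])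
  ultimately show ?thesis by (simp add: P_diff P_add algebra_simps)
qed

section \<open>The shifted graded space and iterated brackets with elements of
  \<open>Fs\<close>\<close>

definition H :: "int \<Rightarrow> ('c \<times> 'c) set" where
  "H d = M (d + 1) \<times> Fs d"

definition S :: "(int \<times> 'c \<times> 'c) set" where
  "S = {z. snd z \<in> H (fst z)}"

lemma S_iff: "(d, f, \<theta>) \<in> S \<longleftrightarrow> f \<in> M (d + 1) \<and> \<theta> \<in> Fs d"
  by (simp add: S_def H_def)

text \<open>The iterated bracket of \<open>f\<close> with the \<open>Fs\<close>-components of the
  entries. Whole tagged entries are kept in the list so that splittings and signs can be read off
  their tags.\<close>

definition ad_fold :: "'c \<Rightarrow> (int \<times> 'c \<times> 'c) list \<Rightarrow> 'c" where
  "ad_fold f B = foldl br f (map (snd \<circ> snd) B)"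

lemma ad_fold_simps [simp]:
  "ad_fold f [] = f" "ad_fold f (z # B) = ad_fold (br f (snd (snd z))) B" "ad_fold f (X @ Y) = ad_fold (ad_fold f X) Y"
  by (simp_all add: ad_fold_def)

lemma S_F: "z \<in> S \<Longrightarrow> snd (snd z) \<in> Fs (fst z)" and S_M: "z \<in> S \<Longrightarrow> fst (snd z) \<in> M (fst z + 1)"
  by (auto simp: S_def H_def)

lemma ad_fold_L: "f \<in> L e \<Longrightarrow> set B \<subseteq> S \<Longrightarrow> ad_fold f B \<in> L (e + tdeg fst B)"
proof (induction B arbitrary: f e)
  case (Cons z B)
  have "br f (snd (snd z)) \<in> L (e + fst z)"
    using Cons.prems S_F[of z] by (auto intro: br_L F_L)
  from Cons.IH[OF this] show ?case using Cons.prems by (simp add: add.assoc)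
qed simp

lemma ad_fold_lin: "f \<in> L e \<Longrightarrow> f' \<in> L e \<Longrightarrow> set B \<subseteq> S \<Longrightarrow> ad_fold (sc c f + f') B = sc c (ad_fold f B) + ad_fold f' B"
proof (induction B arbitrary: f f' e)
  case (Cons z B)
  have z: "snd (snd z) \<in> L (fst z)" using Cons.prems S_F[of z] by (auto intro: F_L)
  then show ?case
    using Cons.IH[of "br f (snd (snd z))" "e + fst z" "br f' (snd (snd z))"] Cons.prems
    by (simp add: br_lin_left br_L)
qed simp

lemma ad_fold_add: "f \<in> L e \<Longrightarrow> f' \<in> L e \<Longrightarrow> set B \<subseteq> S \<Longrightarrow> ad_fold (f + f') B = ad_fold f B + ad_fold f' B"
  using ad_fold_lin[of f e f' B 1] by simp

lemma ad_fold_zero: "set B \<subseteq> S \<Longrightarrow> ad_fold 0 B = 0"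
  using ad_fold_add[OF L_zero L_zero] by simp

lemma ad_fold_sgnv: "f \<in> L e \<Longrightarrow> set B \<subseteq> S \<Longrightarrow> ad_fold (sgnv k f) B = sgnv k (ad_fold f B)"
  using ad_fold_lin[of f e 0 B "-1"] ad_fold_zero[of B] L_zero by (simp add: sgnv_def)

text \<open>In the Jacobi identity for \<open>f\<close>, \<open>\<theta>\<close>,
  \<open>\<theta>'\<close> the term with the bracket of \<open>\<theta>\<close> and
  \<open>\<theta>'\<close> vanishes because \<open>Fs\<close> is abelian.\<close>

lemma br_F_swap:
  assumes "f \<in> L e" "\<theta> \<in> Fs d" "\<theta>' \<in> Fs d'"
  shows "br (br f \<theta>) \<theta>' = sgnv (d * d') (br (br f \<theta>') \<theta>)"
  using br_jacobi[OF assms(1) F_L[OF assms(2)] F_L[OF assms(3)]] F_abelian[OF assms(2,3)]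
    br_zero_right[OF assms(1)] by simp

lemma ad_fold_swap:
  assumes f: "f \<in> L e" and s: "set (X @ u # v # Y) \<subseteq> S"
  shows "ad_fold f (X @ u # v # Y) = sgnv (fst u * fst v) (ad_fold f (X @ v # u # Y))"
proof -
  have g: "ad_fold f X \<in> L (e + tdeg fst X)" using f s by (intro ad_fold_L) auto
  have u: "snd (snd u) \<in> Fs (fst u)" and v: "snd (snd v) \<in> Fs (fst v)"
    using s by (auto intro: S_F)
  show ?thesis
    using br_F_swap[OF g u v] ad_fold_sgnv[OF br_L[OF br_L[OF g F_L[OF v]] F_L[OF u]], of Y] s by simp
qed

text \<open>Bracketing from the right with one element is a graded derivation, by
  \<open>br_jacobi\<close>. Iteration distributes the entries over both factors as the coproduct
  does, and the remaining sign moves \<open>g\<close>, of degree \<open>e\<close>, past the entries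
  acting on \<open>f\<close>.\<close>

lemma ad_fold_leibniz:
  "f \<in> L d \<Longrightarrow> g \<in> L e \<Longrightarrow> set B \<subseteq> S \<Longrightarrow>
    ad_fold (br f g) B = unsh fst B (\<lambda>C E. sgnv (e * tdeg fst C) (br (ad_fold f C) (ad_fold g E)))"
proof (induction B arbitrary: f g d e)
  case (Cons z B)
  let ?\<theta> = "snd (snd z)"
  have t: "?\<theta> \<in> L (fst z)" using Cons.prems S_F[of z] by (auto intro: F_L)
  have B: "set B \<subseteq> S" using Cons.prems by simp
  note f = Cons.prems(1) and g = Cons.prems(2)
  have "ad_fold (br f g) (z # B) = ad_fold (br f (br g ?\<theta>) + sgnv (e * fst z) (br (br f ?\<theta>) g)) B"
    using br_jacobi[OF f g t] by simp
  also have "\<dots> = ad_fold (br f (br g ?\<theta>)) B + sgnv (e * fst z) (ad_fold (br (br f ?\<theta>) g) B)"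
  proof -
    have 1: "br f (br g ?\<theta>) \<in> L (d + e + fst z)" using br_L[OF f br_L[OF g t]] by (simp add: add.assoc)
    have 2: "br (br f ?\<theta>) g \<in> L (d + e + fst z)" using br_L[OF br_L[OF f t] g] by (simp add: algebra_simps)
    show ?thesis using ad_fold_add[OF 1 L_sgnv[OF 2] B] ad_fold_sgnv[OF 2 B] by simp
  qed
  also have "\<dots> = unsh fst B (\<lambda>C E. sgnv ((e + fst z) * tdeg fst C) (br (ad_fold f C) (ad_fold g (z # E))))
      + sgnv (e * fst z) (unsh fst B (\<lambda>C E. sgnv (e * tdeg fst C) (br (ad_fold f (z # C)) (ad_fold g E))))"
    using Cons.IH[OF f br_L[OF g t] B] Cons.IH[OF br_L[OF f t] g B] by simp
  finally show ?case by (simp add: unsh_sgnv[symmetric] algebra_simps)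
qed simp

lemma ad_fold_move:
  "f \<in> L d \<Longrightarrow> y \<in> Fs e \<Longrightarrow> set B \<subseteq> S \<Longrightarrow> ad_fold (br f y) B = sgnv (e * tdeg fst B) (br (ad_fold f B) y)"
proof (induction B arbitrary: f d)
  case (Cons z B)
  let ?\<theta> = "snd (snd z)"
  have t: "?\<theta> \<in> Fs (fst z)" using Cons.prems S_F[of z] by auto
  have B: "set B \<subseteq> S" using Cons.prems by simp
  note f = Cons.prems(1) and y = Cons.prems(2)
  have "ad_fold (br f y) (z # B) = ad_fold (sgnv (e * fst z) (br (br f ?\<theta>) y)) B"
    using br_F_swap[OF f y t] by simp
  also have "\<dots> = sgnv (e * fst z) (ad_fold (br (br f ?\<theta>) y) B)"
    by (rule ad_fold_sgnv[OF br_L[OF br_L[OF f F_L[OF t]] F_L[OF y]] B])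
  also have "\<dots> = sgnv (e * tdeg fst (z # B)) (br (ad_fold f (z # B)) y)"
    using Cons.IH[OF br_L[OF f F_L[OF t]] y B] by (simp add: algebra_simps)
  finally show ?case .
qed simp

text \<open>The \<open>Fs\<close>-component of the brackets on all of \<open>M \<times> Fs\<close>: the splittings with a singleton \<open>A\<close>
  choose the argument whose \<open>M\<close>-part is used.\<close>

definition dbrF :: "(int \<times> 'c \<times> 'c) list \<Rightarrow> 'c" where
  "dbrF zs = unsh fst zs (\<lambda>A B. if length A = 1 then P (ad_fold (fst (snd (hd A))) B) else 0)"

text \<open>The first component is the binary bracket of the desuspended elements. Its sign exponent
  is the degree of the first cochain in \<open>M\<close>, one more than its tag.\<close>

definition dbr :: "(int \<times> 'c \<times> 'c) list \<Rightarrow> 'c \<times> 'c" where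
  "dbr zs = (if length zs = 2 then sgnv (fst (zs ! 0) + 1) (br (fst (snd (zs ! 0))) (fst (snd (zs ! 1)))) else 0, dbrF zs)"

lemma snd_dbr: "snd (dbr zs) = dbrF zs"
  by (simp add: dbr_def)

lemma length_1_E: "length A = 1 \<Longrightarrow> (\<And>a. A = [a] \<Longrightarrow> Q) \<Longrightarrow> Q"
  by (auto simp: length_Suc_conv)

lemma ad_fold_hd_L:
  assumes "length A = 1" "set A \<subseteq> S" "set B \<subseteq> S"
  shows "ad_fold (fst (snd (hd A))) B \<in> L (tdeg fst A + tdeg fst B + 1)"
proof -
  obtain a where "A = [a]" using assms(1) by (rule length_1_E)
  then show ?thesis using ad_fold_L[OF M_L[OF S_M[of a]] assms(3)] assms(2) by (simp add: algebra_simps)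
qed

lemma dbrF_F: "set zs \<subseteq> S \<Longrightarrow> dbrF zs \<in> Fs (tdeg fst zs + 1)"
  unfolding dbrF_def
proof (rule unsh_mem[where S = "Fs (tdeg fst zs + 1)"])
  fix A B assume s: "set zs \<subseteq> S" and m: "mset A + mset B = mset zs"
  note AB = mset_parts[OF m s]
  show "(if length A = 1 then P (ad_fold (fst (snd (hd A))) B) else 0) \<in> Fs (tdeg fst zs + 1)"
    using ad_fold_hd_L[of A B] AB(1,2) AB(4)[of fst] by (auto intro: F_zero P_F)
qed (auto intro: F_add F_minus)

lemma dbr_H: "set zs \<subseteq> S \<Longrightarrow> dbr zs \<in> H (tdeg fst zs + 1)"
proof -
  assume s: "set zs \<subseteq> S"
  have "fst (dbr zs) \<in> M (tdeg fst zs + 1 + 1)"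
  proof (cases "length zs = 2")
    case True
    then obtain a c where "zs = [a, c]" by (auto simp: numeral_2_eq_2 length_Suc_conv)
    then show ?thesis
      using s br_M[OF S_M[of a] S_M[of c]] by (simp add: dbr_def M_sgnv algebra_simps)
  qed (simp add: dbr_def M_zero)
  then show ?thesis using dbrF_F[OF s] by (auto simp: H_def dbr_def)
qed

lemma dbrF_linear:
  assumes XY: "set (X @ Y) \<subseteq> S" and x: "(d, f, \<theta>) \<in> S" and y: "(d, f', \<theta>') \<in> S"
  shows "dbrF (X @ (d, sc c f + f', sc c \<theta> + \<theta>') # Y) = sc c (dbrF (X @ (d, f, \<theta>) # Y)) + dbrF (X @ (d, f', \<theta>') # Y)"
  unfolding dbrF_def
proof (rule unsh_linear[where S = S])
  have f: "f \<in> L (d + 1)" "f' \<in> L (d + 1)" and t: "\<theta> \<in> L d" "\<theta>' \<in> L d"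
    using x y by (auto simp: S_iff intro: M_L F_L)
  fix X Y B assume s: "set (X @ Y @ B) \<subseteq> S"
  let ?F = "\<lambda>A B. if length A = 1 then P (ad_fold (fst (snd (hd A))) B) else 0"
  show "?F (X @ (d, sc c f + f', sc c \<theta> + \<theta>') # Y) B = sc c (?F (X @ (d, f, \<theta>) # Y) B) + ?F (X @ (d, f', \<theta>') # Y) B"
    using ad_fold_lin[OF f, of B c] s by (auto simp: P_lin)
  show "?F X (Y @ (d, sc c f + f', sc c \<theta> + \<theta>') # B) = sc c (?F X (Y @ (d, f, \<theta>) # B)) + ?F X (Y @ (d, f', \<theta>') # B)"
  proof (cases "length X = 1")
    case True
    let ?g = "ad_fold (fst (snd (hd X))) Y"
    have g: "?g \<in> L (tdeg fst X + tdeg fst Y + 1)" using s True by (intro ad_fold_hd_L) auto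
    have "ad_fold (br ?g (sc c \<theta> + \<theta>')) B = sc c (ad_fold (br ?g \<theta>) B) + ad_fold (br ?g \<theta>') B"
      using br_lin_right[OF g t] ad_fold_lin[OF br_L[OF g t(1)] br_L[OF g t(2)], of B c] s by simp
    then show ?thesis using True by (simp add: P_lin)
  qed simp
qed (use XY in auto)

lemma dbr_linear:
  assumes XY: "set (X @ Y) \<subseteq> S" and x: "(d, f, \<theta>) \<in> S" and y: "(d, f', \<theta>') \<in> S"
  shows "fst (dbr (X @ (d, sc c f + f', sc c \<theta> + \<theta>') # Y))
    = sc c (fst (dbr (X @ (d, f, \<theta>) # Y))) + fst (dbr (X @ (d, f', \<theta>') # Y))"
proof -
  have f: "f \<in> L (d + 1)" "f' \<in> L (d + 1)" using x y by (auto simp: S_iff intro: M_L)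
  show ?thesis
  proof (cases "length X + length Y = 1")
    case True
    then consider a where "X = []" "Y = [a]" | a where "X = [a]" "Y = []"
      by (cases X; cases Y) auto
    then show ?thesis
    proof cases
      case 1
      then have "fst (snd a) \<in> L (fst a + 1)" using XY by (auto intro: M_L S_M)
      then show ?thesis using 1 br_lin_left[OF f] by (simp add: dbr_def sgnv_add scale_sgnv)
    next
      case 2
      then have "fst (snd a) \<in> L (fst a + 1)" using XY by (auto intro: M_L S_M)
      then show ?thesis using 2 br_lin_right[OF _ f] by (simp add: dbr_def sgnv_add scale_sgnv)
    qed
  qed (auto simp: dbr_def)
qed

lemma dbrF_symmetric:
  assumes "set (X @ u # v # Y) \<subseteq> S"
  shows "dbrF (X @ u # v # Y) = sgnv (fst u * fst v) (dbrF (X @ v # u # Y))"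
  unfolding dbrF_def
proof (rule unsh_swap[where S = S, OF _ _ assms])
  fix A X u v Y assume s: "set (A @ X @ u # v # Y) \<subseteq> S"
  let ?F = "\<lambda>A B. if length A = 1 then P (ad_fold (fst (snd (hd A))) B) else 0"
  show "?F A (X @ u # v # Y) = sgnv (fst u * fst v) (?F A (X @ v # u # Y))"
  proof (cases "length A = 1")
    case True
    have "fst (snd (hd A)) \<in> L (tdeg fst A + tdeg fst [] + 1)" using ad_fold_hd_L[of A "[]"] True s by simp
    then have "ad_fold (fst (snd (hd A))) (X @ u # v # Y) = sgnv (fst u * fst v) (ad_fold (fst (snd (hd A))) (X @ v # u # Y))"
      using s by (intro ad_fold_swap) auto
    then show ?thesis using True by (simp only: P_sgnv if_True simp_thms)
  qed simp
qed auto

lemma dbr_symmetric: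
  assumes "set (X @ u # v # Y) \<subseteq> S"
  shows "fst (dbr (X @ u # v # Y)) = sgnv (fst u * fst v) (fst (dbr (X @ v # u # Y)))"
proof (cases "X = [] \<and> Y = []")
  case True
  have "fst (snd u) \<in> L (fst u + 1)" "fst (snd v) \<in> L (fst v + 1)"
    using assms by (auto intro: M_L S_M)
  from br_anti[OF this] show ?thesis
    using True by (auto simp: dbr_def algebra_simps intro!: sgnv_cong)
qed (auto simp: dbr_def)

text \<open>Either the head supplies its \<open>M\<close>-part, or it is one of the elements
  bracketed with the chosen one; in the second case \<open>ad_fold_move\<close> makes it act last.
  This is the shape needed when the head is the value of an inner bracket.\<close>

lemma dbrF_Cons:
  assumes y: "(d, y) \<in> S" and B: "set B \<subseteq> S"
  shows "dbrF ((d, y) # B) = P (ad_fold (fst y) B) + unsh fst B (\<lambda>C D. if length C = 1 then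
      sgnv (d * (tdeg fst C + tdeg fst D)) (P (br (ad_fold (fst (snd (hd C))) D) (snd y))) else 0)"
proof -
  have "unsh fst B (\<lambda>C D. if length ((d, y) # C) = 1 then P (ad_fold (fst (snd (hd ((d, y) # C)))) D) else 0)
    = unsh fst B (\<lambda>C D. if C = [] then P (ad_fold (fst y) D) else 0)"
    by (rule unsh_cong) auto
  also have "\<dots> = P (ad_fold (fst y) B)" by (rule unsh_Nil_left)
  finally have 1: "unsh fst B (\<lambda>C D. if length ((d, y) # C) = 1 then P (ad_fold (fst (snd (hd ((d, y) # C)))) D) else 0) = P (ad_fold (fst y) B)" .
  have 2: "unsh fst B (\<lambda>C D. sgnv (fst (d, y) * tdeg fst C) (if length C = 1 then P (ad_fold (fst (snd (hd C))) ((d, y) # D)) else 0))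
    = unsh fst B (\<lambda>C D. if length C = 1 then
      sgnv (d * (tdeg fst C + tdeg fst D)) (P (br (ad_fold (fst (snd (hd C))) D) (snd y))) else 0)"
  proof (rule unsh_cong)
    fix C D assume "mset C + mset D = mset B"
    note CD = mset_parts[OF this B]
    show "sgnv (fst (d, y) * tdeg fst C) (if length C = 1 then P (ad_fold (fst (snd (hd C))) ((d, y) # D)) else 0)
      = (if length C = 1 then sgnv (d * (tdeg fst C + tdeg fst D)) (P (br (ad_fold (fst (snd (hd C))) D) (snd y))) else 0)"
    proof (cases "length C = 1")
      case True
      have "fst (snd (hd C)) \<in> L (tdeg fst C + tdeg fst [] + 1)" using ad_fold_hd_L[of C "[]"] True CD by simp
      from ad_fold_move[OF this _ CD(2)] y have "ad_fold (br (fst (snd (hd C))) (snd y)) D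
         = sgnv (d * tdeg fst D) (br (ad_fold (fst (snd (hd C))) D) (snd y))" by (simp add: S_def H_def mem_Times_iff)
      then show ?thesis using True by (simp add: P_sgnv algebra_simps)
    qed simp
  qed
  show ?thesis unfolding dbrF_def unsh.simps 1 2 ..
qed

text \<open>With \<open>f\<close>, \<open>g\<close> the two chosen elements of \<open>M\<close>, the Leibniz rule expands the iterated bracket of
  \<open>br f g\<close> into brackets of the iterated brackets of \<open>f\<close> and \<open>g\<close>; then \<open>P_br\<close> splits each of them
  into the two terms \<open>?U\<close>, \<open>?V\<close> that cancel against the nested brackets.\<close>

lemma dbrF_jacobi:
  assumes zs: "set zs \<subseteq> S"
  shows "unsh fst zs (\<lambda>A B. dbrF ((tdeg fst A + 1, dbr A) # B)) = 0"
proof -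
  let ?f = "\<lambda>A :: (int \<times> 'c \<times> 'c) list. fst (snd (hd A))"
  let ?P = "\<lambda>A1 A2. if length A1 = 1 then P (ad_fold (?f A1) A2) else 0"
  let ?w = "\<lambda>A C D y. sgnv ((tdeg fst A + 1) * (tdeg fst C + tdeg fst D)) (P (br (ad_fold (?f C) D) y))"
  \<comment> \<open>\<open>A1\<close> and \<open>C\<close> are the singletons supplying the
    \<open>M\<close>-parts of the inner and the outer bracket; \<open>A2\<close> and
    \<open>D\<close> hold the entries acting on them.\<close>
  define Q where "Q = (\<lambda>A1 A2 C (D :: (int \<times> 'c \<times> 'c) list). if length A1 = 1 \<and> length C = 1
    then sgnv ((tdeg fst A1 + tdeg fst A2 + 1) * (tdeg fst C + tdeg fst D)) (P (br (ad_fold (?f C) D) (P (ad_fold (?f A1) A2)))) else 0)"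
  have second: "unsh fst B (\<lambda>C D. if length C = 1 then
        ?w A C D (dbrF A) else 0)
     = unsh fst A (\<lambda>A1 A2. unsh fst B (\<lambda>C D. Q A1 A2 C D))"
    if A: "set A \<subseteq> S" and B: "set B \<subseteq> S" for A B
    unfolding unsh_commute[of fst A]
  proof (rule unsh_cong)
    fix C D assume "mset C + mset D = mset B"
    note CD = mset_parts[OF this B]
    show "(if length C = 1 then ?w A C D (dbrF A) else 0)
      = unsh fst A (\<lambda>A1 A2. Q A1 A2 C D)"
    proof (cases "length C = 1")
      case True
      have X: "ad_fold (?f C) D \<in> L (tdeg fst C + tdeg fst D + 1)" by (rule ad_fold_hd_L[OF True CD(1,2)])
      have "P (br (ad_fold (?f C) D) (dbrF A)) = unsh fst A (\<lambda>A1 A2. P (br (ad_fold (?f C) D) (?P A1 A2)))"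
        unfolding dbrF_def
      proof (rule unsh_hom[where S = "L (tdeg fst A + 1)"])
        fix A1 A2 assume "mset A1 + mset A2 = mset A"
        note m = mset_parts[OF this A]
        show "?P A1 A2 \<in> L (tdeg fst A + 1)"
          using ad_fold_hd_L[of A1 A2] m(1,2) m(4)[of fst] by (auto intro: L_zero F_L P_F)
      qed (use X in \<open>auto simp: br_add_right br_minus_right P_add P_minus intro: L_add L_minus\<close>)
      then have "?w A C D (dbrF A)
        = unsh fst A (\<lambda>A1 A2. ?w A C D (?P A1 A2))"
        by (simp only: unsh_sgnv)
      also have "\<dots> = unsh fst A (\<lambda>A1 A2. Q A1 A2 C D)"
      proof (rule unsh_cong)
        fix A1 A2 assume "mset A1 + mset A2 = mset A"
        note m = mset_parts[OF this A]
        show "?w A C D (?P A1 A2)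
          = Q A1 A2 C D"
          using True m(4)[of fst] br_zero_right[OF X] by (simp add: Q_def)
      qed
      finally show ?thesis using True by simp
    qed (simp add: Q_def)
  qed
  \<comment> \<open>After regrouping, the pair \<open>A1\<close>, \<open>C\<close> is split off
    first and the other entries are distributed over the two, exactly as in
    \<open>ad_fold_leibniz\<close>.\<close>
  define R where "R = (\<lambda>B A1 C. unsh fst B (\<lambda>A2 D. sgnv (tdeg fst A2 * tdeg fst C) (Q A1 A2 C D)))"
  have first: "P (ad_fold (fst (dbr A)) B) + unsh fst A (\<lambda>A1 C. R B A1 C) = 0"
    if A: "set A \<subseteq> S" and B: "set B \<subseteq> S" for A B
  proof -
    have "unsh fst A (\<lambda>A1 C. R B A1 C) = unsh fst A (\<lambda>A1 C. if length A1 = 1 \<and> length C = 1 then R B A1 C else 0)"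
      by (rule unsh_cong) (auto simp: R_def Q_def)
    also have "\<dots> = (if length A = 2 then R B [A ! 0] [A ! 1] + sgnv (fst (A ! 0) * fst (A ! 1)) (R B [A ! 1] [A ! 0]) else 0)"
      by (rule unsh_singletons)
    finally have R: "unsh fst A (\<lambda>A1 C. R B A1 C) = \<dots>" .
    show ?thesis
    proof (cases "length A = 2")
      case False
      then show ?thesis unfolding R by (simp add: dbr_def ad_fold_zero[OF B])
    next
      case True
      then obtain a c where A': "A = [a, c]" by (auto simp: numeral_2_eq_2 length_Suc_conv)
      let ?a = "fst (snd a)" and ?c = "fst (snd c)"
      have a: "?a \<in> L (fst a + 1)" and c: "?c \<in> L (fst c + 1)" using A A' by (auto intro: M_L S_M)
      let ?U = "\<lambda>X Y. sgnv (fst a + 1 + (fst c + 1) * tdeg fst X) (P (br (ad_fold ?a X) (P (ad_fold ?c Y))))"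
      let ?V = "\<lambda>X Y. sgnv (fst a + 1 + (fst c + 1) * tdeg fst X) (P (br (P (ad_fold ?a X)) (ad_fold ?c Y)))"
      have "P (ad_fold (fst (dbr A)) B) = sgnv (fst a + 1) (P (ad_fold (br ?a ?c) B))"
        using ad_fold_sgnv[OF br_L[OF a c] B] by (simp add: dbr_def A' P_sgnv)
      also have "\<dots> = unsh fst B (\<lambda>X Y. sgnv (fst a + 1) (P (sgnv ((fst c + 1) * tdeg fst X) (br (ad_fold ?a X) (ad_fold ?c Y)))))"
        unfolding ad_fold_leibniz[OF a c B] unsh_additive[of P, OF P_add] unsh_sgnv ..
      also have "\<dots> = unsh fst B (\<lambda>X Y. ?U X Y + ?V X Y)"
      proof (rule unsh_cong)
        fix X Y assume "mset X + mset Y = mset B"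
        note m = mset_parts[OF this B]
        show "sgnv (fst a + 1) (P (sgnv ((fst c + 1) * tdeg fst X) (br (ad_fold ?a X) (ad_fold ?c Y)))) = ?U X Y + ?V X Y"
          using P_br[OF ad_fold_L[OF a m(1)] ad_fold_L[OF c m(2)]] by (simp add: P_sgnv sgnv_add)
      qed
      finally have 1: "P (ad_fold (fst (dbr A)) B) = unsh fst B ?U + unsh fst B ?V" by (simp add: unsh_add)
      \<comment> \<open>With \<open>a\<close> inside and \<open>c\<close> outside, graded
        antisymmetry leads to \<open>?V\<close>. The opposite nesting already has the factors in the
        order of \<open>?U\<close>; there the two blocks of \<open>B\<close> are exchanged by
        cocommutativity.\<close>
      have 2: "R B [a] [c] = - unsh fst B ?V"
        unfolding R_def unsh_sgnv[of _ _ 1, simplified, symmetric]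
      proof (rule unsh_cong)
        fix X Y assume "mset X + mset Y = mset B"
        note m = mset_parts[OF this B]
        have "br (ad_fold ?c Y) (P (ad_fold ?a X)) = sgnv (1 + (fst c + 1 + tdeg fst Y) * (fst a + 1 + tdeg fst X)) (br (P (ad_fold ?a X)) (ad_fold ?c Y))"
          by (rule br_anti[OF ad_fold_L[OF c m(2)] F_L[OF P_F[OF ad_fold_L[OF a m(1)]]]])
        then have "sgnv (tdeg fst X * tdeg fst [c]) (Q [a] X [c] Y) = sgnv (1 + (fst a + 1 + (fst c + 1) * tdeg fst X)) (P (br (P (ad_fold ?a X)) (ad_fold ?c Y)))"
          by (auto simp: Q_def P_sgnv algebra_simps intro!: sgnv_cong)
        then show "sgnv (tdeg fst X * tdeg fst [c]) (Q [a] X [c] Y) = - ?V X Y"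
          by (simp only: sgnv_1_add)
      qed
      have 3: "sgnv (fst a * fst c) (R B [c] [a]) = - unsh fst B ?U"
        unfolding R_def unsh_sgnv[of _ _ 1, simplified, symmetric] unsh_sgnv[symmetric]
        apply (subst unsh_cocomm)
        apply (rule unsh_cong)
        subgoal for X Y
        proof -
          have "sgnv (tdeg fst X * tdeg fst Y) (sgnv (fst a * fst c) (sgnv (tdeg fst Y * tdeg fst [a]) (Q [c] Y [a] X)))
            = sgnv (1 + (fst a + 1 + (fst c + 1) * tdeg fst X)) (P (br (ad_fold ?a X) (P (ad_fold ?c Y))))"
            by (auto simp: Q_def algebra_simps intro!: sgnv_cong)
          then show ?thesis by (simp only: sgnv_1_add)
        qed
        done
      show ?thesis unfolding R using True 1 2 3 by (simp add: A')
    qed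
  qed
  have "unsh fst zs (\<lambda>A B. dbrF ((tdeg fst A + 1, dbr A) # B))
    = unsh fst zs (\<lambda>A B. P (ad_fold (fst (dbr A)) B) + unsh fst A (\<lambda>A1 A2. unsh fst B (\<lambda>C D. Q A1 A2 C D)))"
  proof (rule unsh_cong)
    fix A B assume "mset A + mset B = mset zs"
    note m = mset_parts[OF this zs]
    have "(tdeg fst A + 1, dbr A) \<in> S" using dbr_H[OF m(1)] by (simp add: S_def)
    from dbrF_Cons[OF this m(2)]
    show "dbrF ((tdeg fst A + 1, dbr A) # B) = P (ad_fold (fst (dbr A)) B) + unsh fst A (\<lambda>A1 A2. unsh fst B (\<lambda>C D. Q A1 A2 C D))"
      unfolding snd_dbr second[OF m(1,2)] .
  qed
  also have "\<dots> = unsh fst zs (\<lambda>A B. P (ad_fold (fst (dbr A)) B)) + unsh fst zs (\<lambda>A B. unsh fst A (\<lambda>A1 C. R B A1 C))"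
    by (subst unsh_add, subst unsh_middle_swap) (simp only: R_def)
  also have "\<dots> = unsh fst zs (\<lambda>A B. P (ad_fold (fst (dbr A)) B) + unsh fst A (\<lambda>A1 C. R B A1 C))"
    by (simp add: unsh_add)
  also have "\<dots> = 0"
    by (rule unsh_eq_0) (use first mset_parts[OF _ zs] in blast)
  finally show ?thesis .
qed

text \<open>The \<open>M\<close>-component is a binary bracket, so only three arguments with an
  inner pair can contribute. What remains is the graded Jacobi identity of \<open>br\<close> with
  all degrees shifted by 1, settled by parities.\<close>

lemma dbr_jacobi:
  assumes zs: "set zs \<subseteq> S"
  shows "unsh fst zs (\<lambda>A B. fst (dbr ((tdeg fst A + 1, dbr A) # B))) = 0"
proof (cases "length zs = 3")
  case False
  show ?thesis
  proof (rule unsh_eq_0)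
    fix A B assume "mset A + mset B = mset zs"
    note m = mset_parts[OF this zs]
    show "fst (dbr ((tdeg fst A + 1, dbr A) # B)) = 0"
    proof (cases "length B = 1")
      case True
      then obtain b where "B = [b]" by (rule length_1_E)
      moreover have "length A \<noteq> 2" using m(3) True False by simp
      ultimately show ?thesis using br_zero_left[OF M_L[OF S_M[of b]]] m(2) by (simp add: dbr_def)
    qed (simp add: dbr_def)
  qed
next
  case True
  then obtain x y z where zs': "zs = [x, y, z]" by (auto simp: numeral_3_eq_3 length_Suc_conv)
  let ?x = "fst (snd x)" and ?y = "fst (snd y)" and ?z = "fst (snd z)"
  have x: "?x \<in> L (fst x + 1)" and y: "?y \<in> L (fst y + 1)" and z: "?z \<in> L (fst z + 1)"
    using zs zs' by (auto intro: M_L S_M)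
  have 1: "br (br ?x ?y) ?z = sgnv (1 + (fst x + 1) * (fst y + 1 + (fst z + 1))) (br (br ?y ?z) ?x)
     + sgnv ((fst y + 1) * (fst z + 1)) (br (br ?x ?z) ?y)"
    using br_jacobi[OF x y z] br_anti[OF x br_L[OF y z]] by simp
  have s: "br (sgnv e (br ?x ?y)) ?z = sgnv e (br (br ?x ?y) ?z)"
    "br (sgnv e (br ?x ?z)) ?y = sgnv e (br (br ?x ?z) ?y)"
    "br (sgnv e (br ?y ?z)) ?x = sgnv e (br (br ?y ?z) ?x)" for e
    using br_sgnv_left[OF br_L[OF x y] z] br_sgnv_left[OF br_L[OF x z] y] br_sgnv_left[OF br_L[OF y z] x] by auto
  show ?thesis
    unfolding zs'
    using br_zero_left[OF x] br_zero_left[OF y] br_zero_left[OF z]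
    by (cases "even (fst x)"; cases "even (fst y)"; cases "even (fst z)")
      (simp_all add: dbr_def s 1 sgnv_def br_minus_left[OF br_L[OF x y] z] br_minus_left[OF br_L[OF x z] y]
        br_minus_left[OF br_L[OF y z] x])
qed

section \<open>The axioms of a nilpotent L-infinity algebra for the derived brackets\<close>

lemma graded: "graded_vs (\<lambda>c w. (sc c (fst w), sc c (snd w))) H"
proof -
  have "vector_space (\<lambda>c (w::'c \<times> 'c). (sc c (fst w), sc c (snd w)))"
    by unfold_locales (simp_all add: scale_right_distrib scale_left_distrib plus_prod_def)
  moreover have "0 \<in> H d" for d by (simp add: H_def M_zero F_zero zero_prod_def)
  moreover have "x + y \<in> H d" if "x \<in> H d" "y \<in> H d" for x y d
    using that M_lin[of "fst x" "d + 1" "fst y" 1] F_add by (auto simp: H_def)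
  moreover have "(sc c (fst x), sc c (snd x)) \<in> H d" if "x \<in> H d" for x c d
    using that M_scale F_lin[of "snd x" d 0 c] F_zero by (auto simp: H_def)
  moreover have "x d = 0" if D: "finite D" "\<forall>d\<in>D. x d \<in> H d" "sum x D = 0" "d \<in> D" for D x d
  proof -
    have "snd (x d) = 0"
      by (rule L_indep[of D "\<lambda>d. snd (x d)"])
        (use D in \<open>auto simp: H_def mem_Times_iff snd_sum[symmetric] intro: F_L\<close>)
    moreover have "fst (x d) = 0"
    proof -
      \<comment> \<open>The \<open>M\<close>-part of an element of degree \<open>d\<close> lies in
        \<open>L (d + 1)\<close>, so independence is applied to the family reindexed by this
        shift.\<close>
      have "sum (\<lambda>d. fst (x (d - 1))) ((\<lambda>d. d + 1) ` D) = 0"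
        using D by (simp add: sum.reindex fst_sum[symmetric])
      then have "fst (x (d + 1 - 1)) = 0"
        by (intro L_indep[of "(\<lambda>d. d + 1) ` D" "\<lambda>d. fst (x (d - 1))"])
          (use D in \<open>auto simp: H_def mem_Times_iff intro!: M_L\<close>)
      then show ?thesis by simp
    qed
    ultimately show ?thesis by (simp add: prod_eq_iff)
  qed
  ultimately show ?thesis unfolding graded_vs_def by blast
qed

lemma dbr_nilpotent:
  assumes zs: "set zs \<subseteq> S" and len: "3 + absdeg zs < int (length zs)"
  shows "dbr zs = 0"
proof -
  have "dbrF zs = 0"
    unfolding dbrF_def
  proof (rule unsh_eq_0)
    fix A B assume "mset A + mset B = mset zs"
    note m = mset_parts[OF this zs]
    show "(if length A = 1 then P (ad_fold (fst (snd (hd A))) B) else 0) = 0"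
    proof (cases "length A = 1")
      case True
      then obtain a where a: "A = [a]" by (rule length_1_E)
      have "\<bar>fst a\<bar> \<le> absdeg zs"
        using m(4)[of "\<lambda>z. \<bar>fst z\<bar>"] absdeg_nonneg[of B] a by (simp add: tdeg_def)
      \<comment> \<open>Origin of the constant 3: one unit for the entry \<open>a\<close> missing
        from \<open>B\<close>, one for the shift from the tag to the degree in \<open>M\<close>, and
        one from the bound in \<open>P_nilpotent\<close>.\<close>
      then have "\<bar>fst a + 1\<bar> + 1 < int (length (map (snd \<circ> snd) B))" using len m(3) a by simp
      then have "P (ad_fold (fst (snd a)) B) = 0"
        unfolding ad_fold_def using m(1,2) a by (intro P_nilpotent[where d = "fst a + 1"]) (auto intro: S_M S_F)
      then show ?thesis using a by simp
    qed simp
  qed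
  moreover have "length zs \<noteq> 2" using len absdeg_nonneg[of zs] by linarith
  ultimately show ?thesis by (simp add: dbr_def zero_prod_def)
qed

text \<open>Agreement of \<open>l\<close> with \<open>dbr\<close> is asked for on homogeneous lists
  only, the only place where tags and actual degrees can be compared. In the Jacobi identity it is
  used twice, the inner value being homogeneous by \<open>dbr_H\<close>.\<close>

theorem nil_linfty_derived:
  assumes l: "\<And>zs. set zs \<subseteq> S \<Longrightarrow> l (length zs) (map snd zs) = dbr zs"
  shows "nil_linfty (\<lambda>c w. (sc c (fst w), sc c (snd w))) H l"
proof -
  let ?b = "\<lambda>zs. l (length zs) (map snd zs)"
  have "nil_linfty_axioms (\<lambda>c w. (sc c (fst w), sc c (snd w))) H l"
    unfolding nil_linfty_axioms_def S_def[symmetric]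
  proof (intro conjI allI impI)
    show "graded_vs (\<lambda>c w. (sc c (fst w), sc c (snd w))) H" by (rule graded)
    show "l 0 [] = 0" using l[of "[]"] by (simp add: dbr_def dbrF_def zero_prod_def)
    show "?b zs \<in> H (tdeg fst zs + 1)" if "set zs \<subseteq> S" for zs
      unfolding l[OF that] by (rule dbr_H[OF that])
    show "?b (X @ (d, (sc c (fst x), sc c (snd x)) + y) # Y)
        = (sc c (fst (?b (X @ (d, x) # Y))), sc c (snd (?b (X @ (d, x) # Y)))) + ?b (X @ (d, y) # Y)"
      if XY: "set (X @ Y) \<subseteq> S" and x: "x \<in> H d" and y: "y \<in> H d" for X Y x d y c
    proof -
      have w: "(sc c (fst x), sc c (snd x)) + y \<in> H d"
        using graded x y by (simp add: graded_vs_def)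
      have xS: "(d, fst x, snd x) \<in> S" "(d, fst y, snd y) \<in> S" using x y by (simp_all add: S_def)
      have "set (X @ (d, x) # Y) \<subseteq> S" "set (X @ (d, y) # Y) \<subseteq> S"
        "set (X @ (d, (sc c (fst x), sc c (snd x)) + y) # Y) \<subseteq> S"
        using XY x y w by (auto simp: S_def)
      note e = this[THEN l]
      show ?thesis
        unfolding e using dbrF_linear[OF XY xS, of c] dbr_linear[OF XY xS, of c]
        by (simp add: prod_eq_iff) (simp add: dbr_def plus_prod_def)
    qed
    show "?b (X @ u # v # Y) = sgnv (fst u * fst v) (?b (X @ v # u # Y))"
      if s: "set (X @ u # v # Y) \<subseteq> S" for X u v Y
    proof -
      have s': "set (X @ v # u # Y) \<subseteq> S" using s by auto
      have "dbr (X @ u # v # Y) = sgnv (fst u * fst v) (dbr (X @ v # u # Y))"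
        using dbr_symmetric[OF s] dbrF_symmetric[OF s] by (simp add: prod_eq_iff sgnv_def dbr_def)
      then show ?thesis unfolding l[OF s] l[OF s'] .
    qed
    show "unsh fst zs (\<lambda>A B. ?b ((tdeg fst A + 1, ?b A) # B)) = 0" if zs: "set zs \<subseteq> S" for zs
    proof -
      have "unsh fst zs (\<lambda>A B. ?b ((tdeg fst A + 1, ?b A) # B))
        = unsh fst zs (\<lambda>A B. dbr ((tdeg fst A + 1, dbr A) # B))"
      proof (rule unsh_cong)
        fix A B assume "mset A + mset B = mset zs"
        note m = mset_parts[OF this zs]
        have "set ((tdeg fst A + 1, dbr A) # B) \<subseteq> S" using m dbr_H[OF m(1)] by (auto simp: S_def)
        from l[OF this] show "?b ((tdeg fst A + 1, ?b A) # B) = dbr ((tdeg fst A + 1, dbr A) # B)"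
          unfolding l[OF m(1)] .
      qed
      also have "\<dots> = 0"
      proof (rule prod_eqI)
        show "fst (unsh fst zs (\<lambda>A B. dbr ((tdeg fst A + 1, dbr A) # B))) = fst 0"
          by (subst unsh_additive[of fst]) (simp_all add: dbr_jacobi[OF zs])
        have "snd (unsh fst zs (\<lambda>A B. dbr ((tdeg fst A + 1, dbr A) # B)))
           = unsh fst zs (\<lambda>A B. snd (dbr ((tdeg fst A + 1, dbr A) # B)))"
          by (rule unsh_additive) simp
        also have "\<dots> = unsh fst zs (\<lambda>A B. dbrF ((tdeg fst A + 1, dbr A) # B))"
          by (simp add: dbr_def)
        finally show "snd (unsh fst zs (\<lambda>A B. dbr ((tdeg fst A + 1, dbr A) # B))) = snd 0"
          by (simp add: dbrF_jacobi[OF zs])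
      qed
      finally show ?thesis .
    qed
    show "?b zs = 0" if "set zs \<subseteq> S" "3 + absdeg zs < int (length zs)" for zs
      unfolding l[OF that(1)] by (rule dbr_nilpotent[OF that])
  qed
  moreover have "vector_space (\<lambda>c (w::'c \<times> 'c). (sc c (fst w), sc c (snd w)))"
    using graded by (simp add: graded_vs_def)
  ultimately show ?thesis by (rule nil_linfty.intro[rotated])
qed

end

section \<open>The Nijenhuis-Richardson algebra\<close>

lemma sgnv_fun_apply [simp]: "sgnv e f x = sgnv e (f x)"
  by (simp add: sgnv_def)

lemma fst_sgnv: "fst (sgnv e w) = sgnv e (fst w)"
  and snd_sgnv: "snd (sgnv e w) = sgnv e (snd w)"
  by (simp_all add: sgnv_def)

lemma fst_unsh: "fst (unsh p xs F) = unsh p xs (\<lambda>A B. fst (F A B))"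
  and snd_unsh: "snd (unsh p xs F) = unsh p xs (\<lambda>A B. snd (F A B))"
  by (rule unsh_additive; simp)+

lemma sum_fun_apply: "sum f A x = (\<Sum>a\<in>A. f a x)"
  by (induction A rule: infinite_finite_induct) simp_all

lemma psgn_sgnv_commute: "sgnv e (psgn \<sigma> v) = psgn \<sigma> (sgnv e v)"
  by (simp add: sgnv_def psgn_def)

text \<open>The composition as a sum over all splittings, of whatever size. For alternating cochains
  of fixed degree the terms of wrong arity vanish by themselves, so no arities need to be
  tracked.\<close>

definition circ :: "('g::ab_group_add, 'h::ab_group_add) cochain \<Rightarrow> ('g, 'h) cochain \<Rightarrow> ('g, 'h) cochain" where
  "circ f g vs = unsh (\<lambda>_. 1) vs (\<lambda>A B. f (g A # B))"

abbreviation gpart :: "'g \<times> 'h \<Rightarrow> 'g \<times> 'h::zero" where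
  "gpart v \<equiv> (fst v, 0)"

locale two_spaces = G: vector_space sg + K: vector_space sh
  for sg :: "'k::field_char_0 \<Rightarrow> 'g::ab_group_add \<Rightarrow> 'g" and sh :: "'k \<Rightarrow> 'h::ab_group_add \<Rightarrow> 'h"
begin

abbreviation sv :: "'k \<Rightarrow> 'g \<times> 'h \<Rightarrow> 'g \<times> 'h" where
  "sv \<equiv> sV sg sh"

sublocale V: vector_space sv
  by unfold_locales
    (simp_all add: sV_def G.scale_right_distrib G.scale_left_distrib K.scale_right_distrib K.scale_left_distrib)

text \<open>The degree \<open>d\<close> part of \<open>L(V)\<close>, as functions on all lists that
  vanish off length \<open>d + 1\<close>; the clause for the empty list excludes arity 0.
  Alternation is stated for adjacent swaps, the form that \<open>unsh_swap\<close> handles; in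
  characteristic 0 it implies vanishing on repeated arguments
  (\<open>Alt_alternating\<close>).\<close>

definition Alt :: "int \<Rightarrow> ('g, 'h) cochain set" where
  "Alt d = {f. (\<forall>vs. vs = [] \<or> int (length vs) \<noteq> d + 1 \<longrightarrow> f vs = 0)
    \<and> (\<forall>X Y c a b. f (X @ (sv c a + b) # Y) = sv c (f (X @ a # Y)) + f (X @ b # Y))
    \<and> (\<forall>X a b Y. f (X @ a # b # Y) = - f (X @ b # a # Y))}"

lemma Alt_support: "f \<in> Alt d \<Longrightarrow> vs = [] \<or> int (length vs) \<noteq> d + 1 \<Longrightarrow> f vs = 0"
  and Alt_linear: "f \<in> Alt d \<Longrightarrow> f (X @ (sv c a + b) # Y) = sv c (f (X @ a # Y)) + f (X @ b # Y)"
  and Alt_swap: "f \<in> Alt d \<Longrightarrow> f (X @ a # b # Y) = - f (X @ b # a # Y)"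
  unfolding Alt_def by blast+

lemma Alt_add: "f \<in> Alt d \<Longrightarrow> f (X @ (a + b) # Y) = f (X @ a # Y) + f (X @ b # Y)"
  using Alt_linear[of f d X 1 a b Y] by simp

lemma Alt_slot_zero: "f \<in> Alt d \<Longrightarrow> f (X @ 0 # Y) = 0"
  using Alt_add[of f d X 0 0 Y] by simp

lemma Alt_minus: "f \<in> Alt d \<Longrightarrow> f (X @ (- a) # Y) = - f (X @ a # Y)"
  using Alt_add[of f d X a "- a" Y] Alt_slot_zero[of f d X Y] by (simp add: eq_neg_iff_add_eq_0 add.commute)

lemma Alt_scale: "f \<in> Alt d \<Longrightarrow> f (X @ sv c a # Y) = sv c (f (X @ a # Y))"
  using Alt_linear[of f d X c a 0 Y] Alt_slot_zero[of f d X Y] by simp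

lemma Alt_sgnv: "f \<in> Alt d \<Longrightarrow> f (X @ sgnv e a # Y) = sgnv e (f (X @ a # Y))"
  by (simp add: sgnv_def Alt_minus)

lemma Alt_unsh: "f \<in> Alt d \<Longrightarrow> f (X @ unsh p xs F # Y) = unsh p xs (\<lambda>A B. f (X @ F A B # Y))"
  by (rule unsh_additive[where \<phi> = "\<lambda>w. f (X @ w # Y)"]) (rule Alt_add)

lemmas Alt_head = Alt_linear[where X = "[]", simplified] Alt_add[where X = "[]", simplified]
  Alt_slot_zero[where X = "[]", simplified] Alt_minus[where X = "[]", simplified]
  Alt_sgnv[where X = "[]", simplified] Alt_unsh[where X = "[]", simplified] Alt_scale[where X = "[]", simplified]

lemma Alt_insert_nonzero:
  assumes "f \<in> Alt d" "g \<in> Alt e" "f (g A # B) \<noteq> 0"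
  shows "int (length A) = e + 1" "int (length B) = d" "A \<noteq> []"
proof -
  have "g A \<noteq> 0" using assms Alt_head(3) by auto
  then show "int (length A) = e + 1" "A \<noteq> []" using Alt_support[OF assms(2)] by auto
  show "int (length B) = d" using Alt_support[OF assms(1), of "g A # B"] assms(3) by auto
qed

lemma circ_Alt:
  assumes f: "f \<in> Alt d" and g: "g \<in> Alt e"
  shows "circ f g \<in> Alt (d + e)"
  unfolding Alt_def
proof (intro CollectI conjI allI impI)
  fix vs :: "('g \<times> 'h) list" assume vs: "vs = [] \<or> int (length vs) \<noteq> d + e + 1"
  show "circ f g vs = 0"
    unfolding circ_def
  proof (rule unsh_eq_0)
    fix A B assume "mset A + mset B = mset vs"
    then have "length A + length B = length vs" using mset_parts(3) by blast
    then show "f (g A # B) = 0" using Alt_insert_nonzero[OF f g, of A B] vs by (cases "f (g A # B) = 0") auto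
  qed
next
  fix X Y c a b
  show "circ f g (X @ (sv c a + b) # Y) = sv c (circ f g (X @ a # Y)) + circ f g (X @ b # Y)"
    unfolding circ_def
  proof (rule V.unsh_linear[where S = UNIV])
    show "f (g (X @ (sv c a + b) # Y) # B) = sv c (f (g (X @ a # Y) # B)) + f (g (X @ b # Y) # B)" for X Y B
      by (simp add: Alt_linear[OF g] Alt_head[OF f])
    show "f (g A # X @ (sv c a + b) # Y) = sv c (f (g A # X @ a # Y)) + f (g A # X @ b # Y)" for A X Y
      using Alt_linear[OF f, of "g A # X"] by simp
  qed auto
next
  fix X a b Y
  have "circ f g (X @ a # b # Y) = sgnv (1 * 1) (circ f g (X @ b # a # Y))"
    unfolding circ_def
  proof (rule unsh_swap[where S = UNIV])
    show "f (g (X @ u # v # Y) # B) = sgnv (1 * 1) (f (g (X @ v # u # Y) # B))" for X u v Y B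
      by (simp add: Alt_swap[OF g, of X u v Y] Alt_head[OF f])
    show "f (g A # X @ u # v # Y) = sgnv (1 * 1) (f (g A # X @ v # u # Y))" for A X u v Y
      using Alt_swap[OF f, of "g A # X" u v Y] by simp
  qed simp
  then show "circ f g (X @ a # b # Y) = - circ f g (X @ b # a # Y)" by simp
qed

text \<open>In nonzero terms the inner and outer arities are those of \<open>g\<close> and
  \<open>f\<close>, so the arity-dependent sign matters only there and becomes a global one.\<close>

lemma comp_sgn_eq:
  assumes f: "f \<in> Alt d" and g: "g \<in> Alt e"
    and s: "\<And>n m. 1 \<le> n \<Longrightarrow> 1 \<le> m \<Longrightarrow> int n = e + 1 \<Longrightarrow> int m = d + 1 \<Longrightarrow> even (s n m + k)"
  shows "comp_sgn s f g vs = sgnv k (circ f g vs)"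
proof -
  let ?N = "length vs"
  have "comp_sgn s f g vs = (\<Sum>n\<in>{1..?N}. \<Sum>\<sigma>\<in>unshuffles n ?N. psgn \<sigma>
      (sgnv (s n (?N - n + 1)) (f (g (take n (permute_list \<sigma> vs)) # drop n (permute_list \<sigma> vs)))))"
    by (simp add: comp_sgn_def Let_def psgn_sgnv_commute)
  also have "\<dots> = (\<Sum>n\<in>{1..?N}. unsh (\<lambda>_. 1) vs (\<lambda>A B. if length A = n then sgnv (s n (?N - n + 1)) (f (g A # B)) else 0))"
    by (intro sum.cong refl sum_unshuffles_psgn[of _ vs "\<lambda>A B. sgnv (s _ (?N - _ + 1)) (f (g A # B))"]) simp
  also have "\<dots> = unsh (\<lambda>_. 1) vs (\<lambda>A B. \<Sum>n\<in>{1..?N}. if length A = n then sgnv (s n (?N - n + 1)) (f (g A # B)) else 0)"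
    by (rule unsh_sum[symmetric]) simp
  also have "\<dots> = unsh (\<lambda>_. 1) vs (\<lambda>A B. sgnv k (f (g A # B)))"
  proof (rule unsh_cong)
    fix A B assume "mset A + mset B = mset vs"
    then have l: "length A + length B = ?N" using mset_parts(3) by blast
    show "(\<Sum>n\<in>{1..?N}. if length A = n then sgnv (s n (?N - n + 1)) (f (g A # B)) else 0) = sgnv k (f (g A # B))"
    proof (cases "f (g A # B) = 0")
      case False
      note nz = Alt_insert_nonzero[OF f g False]
      have "length A \<in> {1..?N}" using nz(3) l by (cases A) auto
      moreover have "sgnv (s (length A) (?N - length A + 1)) (f (g A # B)) = sgnv k (f (g A # B))"
        by (rule sgnv_cong, rule s) (use nz l in \<open>auto simp: Suc_le_eq\<close>)
      ultimately show ?thesis by simp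
    qed simp
  qed
  also have "\<dots> = sgnv k (circ f g vs)" by (simp add: unsh_sgnv circ_def)
  finally show ?thesis .
qed

lemma nr_eq:
  assumes f: "f \<in> Alt d" and g: "g \<in> Alt e"
  shows "nr f g vs = circ f g vs - sgnv (d * e) (circ g f vs)"
proof -
  have "comp_sgn (\<lambda>_ _. 0) f g vs = sgnv 0 (circ f g vs)"
    by (rule comp_sgn_eq[OF f g]) simp
  moreover have "comp_sgn (\<lambda>n m. 1 + int ((n - 1) * (m - 1))) g f vs = sgnv (1 + d * e) (circ g f vs)"
  proof (rule comp_sgn_eq[OF g f])
    fix n m :: nat assume "1 \<le> n" "1 \<le> m" "int n = d + 1" "int m = e + 1"
    then have "int (n - 1) = d" "int (m - 1) = e" by simp_all
    then have "int ((n - 1) * (m - 1)) = d * e" by simp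
    then show "even (1 + int ((n - 1) * (m - 1)) + (1 + d * e))" by simp
  qed
  ultimately show ?thesis by (simp add: nr_def sgnv_1_add)
qed

definition scaleA :: "'k \<Rightarrow> ('g, 'h) cochain \<Rightarrow> ('g, 'h) cochain" where
  "scaleA c f = (\<lambda>vs. sv c (f vs))"

sublocale C: vector_space scaleA
  by unfold_locales (simp_all add: scaleA_def fun_eq_iff V.scale_right_distrib V.scale_left_distrib)

lemma Alt_lin: "f \<in> Alt d \<Longrightarrow> g \<in> Alt d \<Longrightarrow> scaleA c f + g \<in> Alt d"
proof -
  assume f: "f \<in> Alt d" and g: "g \<in> Alt d"
  show "scaleA c f + g \<in> Alt d"
    unfolding Alt_def
  proof (intro CollectI conjI allI impI)
    show "(scaleA c f + g) vs = 0" if "vs = [] \<or> int (length vs) \<noteq> d + 1" for vs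
      using Alt_support[OF f that] Alt_support[OF g that] by (simp add: scaleA_def)
    show "(scaleA c f + g) (X @ (sv k a + b) # Y) = sv k ((scaleA c f + g) (X @ a # Y)) + (scaleA c f + g) (X @ b # Y)"
      for X Y k a b
      by (simp add: scaleA_def Alt_linear[OF f] Alt_linear[OF g] V.scale_right_distrib mult.commute add.assoc add.left_commute)
    show "(scaleA c f + g) (X @ a # b # Y) = - (scaleA c f + g) (X @ b # a # Y)" for X a b Y
      using Alt_swap[OF f, of X a b Y] Alt_swap[OF g, of X a b Y] by (simp add: scaleA_def)
  qed
qed

lemma Alt_zero: "0 \<in> Alt d"
  by (simp add: Alt_def)

lemma Alt_sgnv_mem: "f \<in> Alt d \<Longrightarrow> sgnv e f \<in> Alt d"
  using Alt_lin[of f d 0 "-1"] Alt_zero by (simp add: sgnv_def)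

lemma Alt_diff: "f \<in> Alt d \<Longrightarrow> g \<in> Alt d \<Longrightarrow> f - g \<in> Alt d"
  using Alt_lin[of g d f "-1"] by simp

lemma nr_fun: "f \<in> Alt d \<Longrightarrow> g \<in> Alt e \<Longrightarrow> nr f g = circ f g - sgnv (d * e) (circ g f)"
  by (rule ext) (simp add: nr_eq)

lemma nr_Alt: "f \<in> Alt d \<Longrightarrow> g \<in> Alt e \<Longrightarrow> nr f g \<in> Alt (d + e)"
  using circ_Alt[of f d g e] circ_Alt[of g e f d] by (simp add: nr_fun Alt_diff Alt_sgnv_mem add.commute)

lemma circ_lin_left: "circ (scaleA c f + f') g = scaleA c (circ f g) + circ f' g"
  by (rule ext) (simp add: circ_def scaleA_def unsh_add V.unsh_scale)

lemma circ_lin_right: "f \<in> Alt d \<Longrightarrow> circ f (scaleA c g + g') = scaleA c (circ f g) + circ f g'"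
  by (rule ext) (simp add: circ_def scaleA_def unsh_add[symmetric] V.unsh_scale[symmetric] Alt_head)

lemma circ_diff_left: fixes f f' g :: "('g, 'h) cochain" shows "circ (f - f') g = circ f g - circ f' g"
  using circ_lin_left[of "-1" f' f g] by simp

lemma circ_diff_right: "f \<in> Alt d \<Longrightarrow> circ f (g - g') = circ f g - circ f g'"
  using circ_lin_right[of f d "-1" g' g] by simp

lemma circ_sgnv_left: fixes f g :: "('g, 'h) cochain" shows "circ (sgnv e f) g = sgnv e (circ f g)"
  using circ_lin_left[of "-1" f 0 g] by (simp add: sgnv_def circ_def fun_eq_iff)

lemma circ_sgnv_right: "f \<in> Alt d \<Longrightarrow> circ f (sgnv e g) = sgnv e (circ f g)"
  by (rule ext) (simp add: circ_def unsh_sgnv[symmetric] Alt_head)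

lemma nr_lin_left:
  assumes "f \<in> Alt d" "f' \<in> Alt d" "g \<in> Alt e"
  shows "nr (scaleA c f + f') g = scaleA c (nr f g) + nr f' g"
  unfolding nr_fun[OF Alt_lin[OF assms(1,2)] assms(3)] nr_fun[OF assms(1,3)] nr_fun[OF assms(2,3)]
    circ_lin_left circ_lin_right[OF assms(3)]
  by (simp add: sgnv_add C.scale_sgnv C.scale_right_diff_distrib algebra_simps)

lemma nr_lin_right:
  assumes "f \<in> Alt d" "g \<in> Alt e" "g' \<in> Alt e"
  shows "nr f (scaleA c g + g') = scaleA c (nr f g) + nr f g'"
  unfolding nr_fun[OF assms(1) Alt_lin[OF assms(2,3)]] nr_fun[OF assms(1,2)] nr_fun[OF assms(1,3)]
    circ_lin_left circ_lin_right[OF assms(1)]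
  by (simp add: sgnv_add C.scale_sgnv C.scale_right_diff_distrib algebra_simps)

lemma nr_anti:
  assumes "f \<in> Alt d" "g \<in> Alt e"
  shows "nr f g = sgnv (1 + d * e) (nr g f)"
proof -
  have "sgnv (1 + d * e) (sgnv (e * d) (circ f g)) = sgnv 1 (circ f g)"
    by (simp only: sgnv_sgnv) (rule sgnv_cong, simp)
  then show ?thesis
    unfolding nr_fun[OF assms] nr_fun[OF assms(2,1)] sgnv_diff by (simp add: sgnv_1_add)
qed

text \<open>The associator of \<open>circ\<close>. Its graded symmetry in the last two arguments (the pre-Lie
  property) is what makes \<open>nr\<close> a graded Lie bracket.\<close>

definition insert_two :: "('g, 'h) cochain \<Rightarrow> ('g, 'h) cochain \<Rightarrow> ('g, 'h) cochain \<Rightarrow> ('g, 'h) cochain" where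
  "insert_two f g h vs = unsh (\<lambda>_. 1) vs (\<lambda>A B. unsh (\<lambda>_. 1) B (\<lambda>C E. sgnv (tdeg (\<lambda>_. 1) C) (f (g C # h A # E))))"

text \<open>The value \<open>h A\<close> stands first among the arguments of
  \<open>circ f g\<close>. The recursion of \<open>unsh\<close> sends it either into
  \<open>g\<close>, which by coassociativity is the nested composition, or beside the value of
  \<open>g\<close>, which is \<open>insert_two\<close>.\<close>

lemma circ_assoc:
  assumes f: "f \<in> Alt d"
  shows "circ (circ f g) h = circ f (circ g h) + insert_two f g h"
proof (rule ext)
  fix vs
  have "circ (circ f g) h vs = unsh (\<lambda>_. 1) vs (\<lambda>A B. unsh (\<lambda>_. 1) B (\<lambda>C E. f (g (h A # C) # E))) + insert_two f g h vs"
    by (simp add: circ_def insert_two_def unsh_add)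
  also have "unsh (\<lambda>_. 1) vs (\<lambda>A B. unsh (\<lambda>_. 1) B (\<lambda>C E. f (g (h A # C) # E))) = circ f (circ g h) vs"
    unfolding unsh_coassoc[symmetric] by (simp add: circ_def Alt_head[OF f])
  finally show "circ (circ f g) h vs = (circ f (circ g h) + insert_two f g h) vs" by simp
qed

text \<open>Both inner values are arguments of \<open>f\<close>, so exchanging \<open>g\<close> and
  \<open>h\<close> amounts to exchanging their blocks by cocommutativity and swapping the first two
  arguments of \<open>f\<close>.\<close>

lemma insert_two_commute:
  assumes f: "f \<in> Alt d" and g: "g \<in> Alt e" and h: "h \<in> Alt k"
  shows "insert_two f g h = sgnv (e * k) (insert_two f h g)"
proof (rule ext)
  fix vs
  let ?p = "\<lambda>_ :: 'g \<times> 'h. 1 :: int"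
  have "insert_two f g h vs = unsh ?p vs (\<lambda>U E. unsh ?p U (\<lambda>A C. sgnv (tdeg ?p C) (f (g C # h A # E))))"
    unfolding insert_two_def unsh_coassoc ..
  also have "\<dots> = unsh ?p vs (\<lambda>U E. unsh ?p U (\<lambda>A C. sgnv (tdeg ?p A * tdeg ?p C) (sgnv (tdeg ?p A) (f (g A # h C # E)))))"
    by (subst unsh_cocomm) simp
  also have "\<dots> = unsh ?p vs (\<lambda>U E. unsh ?p U (\<lambda>A C. sgnv (e * k) (sgnv (tdeg ?p C) (f (h C # g A # E)))))"
  proof (intro unsh_cong)
    fix U E A C
    show "sgnv (tdeg ?p A * tdeg ?p C) (sgnv (tdeg ?p A) (f (g A # h C # E))) = sgnv (e * k) (sgnv (tdeg ?p C) (f (h C # g A # E)))"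
    proof (cases "f (h C # g A # E) = 0")
      case True
      then show ?thesis using Alt_swap[OF f, of "[]" "g A" "h C" E] by simp
    next
      case False
      have "h C \<noteq> 0" using False Alt_slot_zero[OF f, of "[]" "g A # E"] by auto
      moreover have "g A \<noteq> 0" using False Alt_slot_zero[OF f, of "[h C]" "E"] by auto
      ultimately have l: "int (length A) = e + 1" "int (length C) = k + 1"
        using Alt_support[OF g, of A] Alt_support[OF h, of C] by auto
      have "f (g A # h C # E) = sgnv 1 (f (h C # g A # E))"
        using Alt_swap[OF f, of "[]" "g A" "h C" E] by simp
      \<comment> \<open>The exponent collects \<open>(e + 1) * (k + 1)\<close> for the exchange of
        blocks, \<open>e + 1\<close> from the definition of \<open>insert_two\<close>, and 1 for the
        swap inside \<open>f\<close>.\<close>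
      then have "sgnv (tdeg ?p A * tdeg ?p C) (sgnv (tdeg ?p A) (f (g A # h C # E)))
         = sgnv ((e + 1) * (k + 1) + (e + 1 + 1)) (f (h C # g A # E))"
        by (simp only: sgnv_sgnv tdeg_one l)
      also have "\<dots> = sgnv (e * k + (k + 1)) (f (h C # g A # E))"
        by (rule sgnv_cong) (simp add: algebra_simps)
      finally show ?thesis by (simp only: sgnv_sgnv tdeg_one l)
    qed
  qed
  also have "\<dots> = sgnv (e * k) (insert_two f h g vs)"
    unfolding unsh_coassoc unsh_sgnv insert_two_def ..
  finally show "insert_two f g h vs = sgnv (e * k) (insert_two f h g) vs" by simp
qed

text \<open>Replacing every left-nested composition by the right-nested one plus an associator
  cancels the right-nested ones; the associators then cancel in pairs by
  \<open>insert_two_commute\<close>. The parities of the three degrees decide the signs.\<close>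

lemma nr_jacobi:
  assumes f: "f \<in> Alt d" and g: "g \<in> Alt e" and h: "h \<in> Alt k"
  shows "nr (nr f g) h = nr f (nr g h) + sgnv (e * k) (nr (nr f h) g)"
proof -
  note expand = circ_diff_left circ_diff_right[OF f] circ_diff_right[OF g] circ_diff_right[OF h]
    circ_sgnv_left circ_sgnv_right[OF f] circ_sgnv_right[OF g] circ_sgnv_right[OF h]
    circ_assoc[OF f] circ_assoc[OF g] circ_assoc[OF h]
  have 1: "nr (nr f g) h = circ (circ f g - sgnv (d * e) (circ g f)) h
      - sgnv ((d + e) * k) (circ h (circ f g - sgnv (d * e) (circ g f)))"
    unfolding nr_fun[OF nr_Alt[OF f g] h] unfolding nr_fun[OF f g] by (rule refl)
  have 2: "nr (nr f h) g = circ (circ f h - sgnv (d * k) (circ h f)) g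
      - sgnv ((d + k) * e) (circ g (circ f h - sgnv (d * k) (circ h f)))"
    unfolding nr_fun[OF nr_Alt[OF f h] g] unfolding nr_fun[OF f h] by (rule refl)
  have 3: "nr f (nr g h) = circ f (circ g h - sgnv (e * k) (circ h g))
      - sgnv (d * (e + k)) (circ (circ g h - sgnv (e * k) (circ h g)) f)"
    unfolding nr_fun[OF f nr_Alt[OF g h]] unfolding nr_fun[OF g h] by (rule refl)
  show ?thesis
    unfolding 1 2 3 expand insert_two_commute[OF f h g] insert_two_commute[OF g h f] insert_two_commute[OF h g f]
    by (cases "even d"; cases "even e"; cases "even k") (simp_all add: sgnv_def algebra_simps)
qed

section \<open>The projection onto \<open>F\<close> and the subalgebras \<open>F\<close> and
  \<open>M\<close>\<close>

lemma gpart_linear: "gpart (sv c a + b) = sv c (gpart a) + gpart b"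
  by (simp add: sV_def)

lemma projF_eq: "f \<in> Alt d \<Longrightarrow> projF f vs = (0, snd (f (map gpart vs)))"
  using Alt_support[of f d "[]"] by (simp add: projF_def zero_prod_def)

definition Alt_F :: "int \<Rightarrow> ('g, 'h) cochain set" where
  "Alt_F d = {\<theta> \<in> Alt d. projF \<theta> = \<theta>}"

text \<open>A description without blocks: the first condition excludes \<open>h\<close>-valued maps
  on \<open>g\<close> alone, the second excludes \<open>g\<close>-valued maps with an argument in
  \<open>h\<close>. \<open>inM_iff\<close> identifies it with the definition by lifts.\<close>

definition Alt_M :: "int \<Rightarrow> ('g, 'h) cochain set" where
  "Alt_M d = {f \<in> Alt d. projF f = 0 \<and> (\<forall>vs. fst (f vs) = fst (f (map gpart vs)))}"

lemma projF_lin: "projF (scaleA c f + g) = scaleA c (projF f) + projF g"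
  by (rule ext) (simp add: projF_def scaleA_def sV_def zero_prod_def[symmetric])

lemma projF_zero: "projF (0 :: ('g, 'h) cochain) = 0"
  by (rule ext) (simp add: projF_def prod_eq_iff)

lemma projF_Alt:
  assumes f: "f \<in> Alt d"
  shows "projF f \<in> Alt d"
  unfolding Alt_def
proof (intro CollectI conjI allI impI)
  show "projF f vs = 0" if "vs = [] \<or> int (length vs) \<noteq> d + 1" for vs
    using Alt_support[OF f, of "map gpart vs"] that by (simp add: projF_eq[OF f] zero_prod_def)
  show "projF f (X @ (sv c a + b) # Y) = sv c (projF f (X @ a # Y)) + projF f (X @ b # Y)" for X Y c a b
    unfolding projF_eq[OF f] map_append list.map gpart_linear Alt_linear[OF f]
    by (simp add: sV_def)
  show "projF f (X @ a # b # Y) = - projF f (X @ b # a # Y)" for X a b Y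
    using Alt_swap[OF f, of "map gpart X" "gpart a" "gpart b" "map gpart Y"] by (simp add: projF_eq[OF f])
qed

lemma projF_Alt_F: "f \<in> Alt d \<Longrightarrow> projF f \<in> Alt_F d"
proof -
  assume f: "f \<in> Alt d"
  have "projF (projF f) = projF f"
    by (rule ext) (simp add: projF_eq[OF projF_Alt[OF f]] projF_eq[OF f] comp_def)
  then show "projF f \<in> Alt_F d" by (simp add: Alt_F_def projF_Alt[OF f])
qed

lemma Alt_F_eq: "\<theta> \<in> Alt_F d \<Longrightarrow> \<theta> vs = (0, snd (\<theta> (map gpart vs)))"
  using projF_eq[of \<theta> d vs] by (auto simp: Alt_F_def)

lemma Alt_F_slot:
  assumes t: "\<theta> \<in> Alt_F d" and "fst w = 0"
  shows "\<theta> (X @ w # Y) = 0"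
proof -
  have "\<theta> \<in> Alt d" using t by (simp add: Alt_F_def)
  then have "\<theta> (map gpart X @ 0 # map gpart Y) = 0" by (rule Alt_slot_zero)
  moreover have "gpart w = 0" using assms(2) by (simp add: zero_prod_def)
  ultimately show ?thesis by (subst Alt_F_eq[OF t]) (simp add: zero_prod_def)
qed

lemma circ_Alt_F: "\<theta> \<in> Alt_F d \<Longrightarrow> \<theta>' \<in> Alt_F e \<Longrightarrow> circ \<theta> \<theta>' = 0"
proof (rule ext)
  fix vs assume t: "\<theta> \<in> Alt_F d" "\<theta>' \<in> Alt_F e"
  have "\<theta> (\<theta>' A # B) = 0" for A B
    using Alt_F_slot[OF t(1), of "\<theta>' A" "[]" B] Alt_F_eq[OF t(2), of A] by (metis append_Nil fst_conv)
  then show "circ \<theta> \<theta>' vs = 0 vs" by (simp add: circ_def)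
qed

lemma nr_Alt_F: "\<theta> \<in> Alt_F d \<Longrightarrow> \<theta>' \<in> Alt_F e \<Longrightarrow> nr \<theta> \<theta>' = 0"
  using nr_fun[of \<theta> d \<theta>' e] circ_Alt_F[of \<theta> d \<theta>' e] circ_Alt_F[of \<theta>' e \<theta> d] by (simp add: Alt_F_def)

text \<open>The kernel of \<open>projF\<close> consists of the cochains that send arguments in
  \<open>g\<close> to values in \<open>g\<close>, a property preserved by composition.\<close>

lemma projF_circ_zero:
  assumes f: "f \<in> Alt d" and g: "g \<in> Alt e" and Pf: "projF f = 0" and Pg: "projF g = 0"
  shows "projF (circ f g) = 0"
proof (rule ext)
  fix vs
  have z: "snd (f (map gpart A)) = 0" "snd (g (map gpart A)) = 0" for A
    using projF_eq[OF f, of A] projF_eq[OF g, of A] Pf Pg by (simp_all add: zero_prod_def)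
  have "snd (f (g (map gpart A) # map gpart B)) = 0" for A B
  proof -
    have "g (map gpart A) = gpart (g (map gpart A))" using z(2)[of A] by (simp add: prod_eq_iff)
    then show ?thesis using z(1)[of "g (map gpart A) # B"] by simp
  qed
  then show "projF (circ f g) vs = 0 vs"
    by (simp add: projF_eq[OF circ_Alt[OF f g]] circ_def unsh_map snd_unsh zero_prod_def)
qed

lemma projF_diff: fixes f g :: "('g, 'h) cochain" shows "projF (f - g) = projF f - projF g"
  using projF_lin[of "-1" g f] by simp

lemma projF_sgnv: fixes f :: "('g, 'h) cochain" shows "projF (sgnv e f) = sgnv e (projF f)"
  using projF_lin[of "-1" f 0] by (simp add: sgnv_def projF_zero)

lemma projF_nr_zero:
  assumes f: "f \<in> Alt d" and g: "g \<in> Alt e" and Pf: "projF f = 0" and Pg: "projF g = 0"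
  shows "projF (nr f g) = 0"
  unfolding nr_fun[OF f g]
  by (simp add: projF_diff projF_sgnv projF_circ_zero[OF f g Pf Pg] projF_circ_zero[OF g f Pg Pf])

lemma Alt_M_circ_fst:
  assumes f: "f \<in> Alt_M d" and g: "g \<in> Alt_M e"
  shows "fst (circ f g vs) = fst (circ f g (map gpart vs))"
proof -
  have f': "fst (f vs) = fst (f (map gpart vs))" and g': "fst (g vs) = fst (g (map gpart vs))" for vs
    using f g by (auto simp: Alt_M_def)
  have "fst (f (g A # B)) = fst (f (g (map gpart A) # map gpart B))" for A B
    using f'[of "g A # B"] f'[of "g (map gpart A) # map gpart B"] g'[of A] by (simp add: comp_def cong: map_cong)
  then show ?thesis by (simp add: circ_def unsh_map fst_unsh comp_def)
qed

lemma nr_Alt_M: "f \<in> Alt_M d \<Longrightarrow> g \<in> Alt_M e \<Longrightarrow> nr f g \<in> Alt_M (d + e)"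
proof -
  assume f: "f \<in> Alt_M d" and g: "g \<in> Alt_M e"
  have fC: "f \<in> Alt d" and gC: "g \<in> Alt e" using f g by (auto simp: Alt_M_def)
  have "fst (nr f g vs) = fst (nr f g (map gpart vs))" for vs
    unfolding nr_eq[OF fC gC] using Alt_M_circ_fst[OF f g, of vs] Alt_M_circ_fst[OF g f, of vs]
    by (simp add: fst_sgnv)
  then show ?thesis
    using projF_nr_zero[OF fC gC] nr_Alt[OF fC gC] f g by (auto simp: Alt_M_def)
qed

section \<open>A second grading that bounds the length of nonzero iterated brackets\<close>

definition h_count :: "('g \<times> 'h) list \<Rightarrow> int" where
  "h_count vs = int (length (filter (\<lambda>v. fst v = 0) vs))"

lemma h_count_simps [simp]: "h_count [] = 0" "h_count (v # vs) = (if fst v = 0 then 1 else 0) + h_count vs"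
  by (simp_all add: h_count_def)

lemma h_count_mset: "mset A + mset B = mset vs \<Longrightarrow> h_count A + h_count B = h_count vs"
  unfolding h_count_def by (metis filter_union_mset mset_filter of_nat_add size_mset size_union)

lemma h_count_nonneg: "0 \<le> h_count vs" and h_count_le: "h_count vs \<le> int (length vs)"
  by (simp_all add: h_count_def)

text \<open>\<open>h_count\<close> is the number of arguments in \<open>h\<close>. Giving a component with \<open>r\<close> arguments in \<open>h\<close> the weight
  \<open>- r\<close> if it is \<open>g\<close>-valued and \<open>1 - r\<close> if it is \<open>h\<close>-valued, elements of \<open>Alt_F\<close> have weight 1, weights
  add under brackets, and no weight exceeds 1.\<close>

definition weight_ge :: "int \<Rightarrow> ('g, 'h) cochain \<Rightarrow> bool" where
  "weight_ge w f \<longleftrightarrow> (\<forall>vs. (- w < h_count vs \<longrightarrow> fst (f vs) = 0) \<and> (1 - w < h_count vs \<longrightarrow> snd (f vs) = 0))"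

lemma Alt_F_h_count: "\<theta> \<in> Alt_F d \<Longrightarrow> 0 < h_count vs \<Longrightarrow> \<theta> vs = 0"
proof -
  assume t: "\<theta> \<in> Alt_F d" and "0 < h_count vs"
  then have "filter (\<lambda>v. fst v = 0) vs \<noteq> []" by (auto simp: h_count_def)
  then obtain v where "v \<in> set vs" "fst v = 0" by (auto simp: filter_empty_conv)
  then show "\<theta> vs = 0" using Alt_F_slot[OF t] by (metis split_list)
qed

text \<open>A cochain of degree \<open>d\<close> has \<open>d + 1\<close> arguments. An
  \<open>h\<close>-valued component thus has weight at least \<open>1 - (d + 1) = - d\<close>; for
  the \<open>g\<close>-valued one, \<open>d + 1\<close> arguments in \<open>h\<close> force it to
  vanish, as it depends on \<open>g\<close>-parts only.\<close>

lemma weight_Alt_M: "f \<in> Alt_M d \<Longrightarrow> weight_ge (- d) f"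
  unfolding weight_ge_def
proof (intro allI conjI impI)
  assume f: "f \<in> Alt_M d"
  then have fC: "f \<in> Alt d" by (simp add: Alt_M_def)
  fix vs
  show "snd (f vs) = 0" if "1 - - d < h_count vs"
    using Alt_support[OF fC, of vs] h_count_le[of vs] that by auto
  show "fst (f vs) = 0" if h: "- (- d) < h_count vs"
  proof (cases "f vs = 0")
    case False
    then have l: "int (length vs) = d + 1" and ne: "vs \<noteq> []" using Alt_support[OF fC, of vs] by auto
    have "length (filter (\<lambda>v. fst v = 0) vs) = length vs"
      using h l h_count_le[of vs] by (simp add: h_count_def)
    then have "fst v = 0" if "v \<in> set vs" for v
      using length_filter_less[OF that, of "\<lambda>v. fst v = 0"] by (cases "fst v = 0") simp_all
    then obtain v vs' where v: "vs = v # vs'" "fst v = 0" using ne by (cases vs) auto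
    then have "gpart v = 0" by (simp add: zero_prod_def)
    then have "f (map gpart vs) = 0" using v Alt_head(3)[OF fC] by simp
    moreover have "fst (f vs) = fst (f (map gpart vs))" using f unfolding Alt_M_def by blast
    ultimately show ?thesis by simp
  qed simp
qed

text \<open>In \<open>circ f \<theta>\<close> the block given to \<open>\<theta>\<close> contains no
  argument in \<open>h\<close>, and its value is a new argument in \<open>h\<close> for
  \<open>f\<close>, so \<open>f\<close> sees one more than the list has. In
  \<open>circ \<theta> f\<close> the result lies in \<open>h\<close> and depends only on the
  \<open>g\<close>-part of the value of \<open>f\<close>.\<close>

lemma weight_nr:
  assumes f: "f \<in> Alt d" and w: "weight_ge w f" and t: "\<theta> \<in> Alt_F e"
  shows "weight_ge (w + 1) (nr f \<theta>)"
proof -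
  have tC: "\<theta> \<in> Alt e" using t by (simp add: Alt_F_def)
  have 1: "(- (w + 1) < h_count vs \<longrightarrow> fst (circ f \<theta> vs) = 0) \<and> (1 - (w + 1) < h_count vs \<longrightarrow> snd (circ f \<theta> vs) = 0)" for vs
  proof -
    have "(- (w + 1) < h_count vs \<longrightarrow> fst (f (\<theta> A # B)) = 0) \<and> (1 - (w + 1) < h_count vs \<longrightarrow> snd (f (\<theta> A # B)) = 0)"
      if "mset A + mset B = mset vs" for A B
    proof (cases "h_count A = 0")
      case True
      then have "h_count (\<theta> A # B) = h_count vs + 1" using h_count_mset[OF that] Alt_F_eq[OF t, of A] by simp
      then show ?thesis using w unfolding weight_ge_def by auto
    next
      case False
      then have "\<theta> A = 0" using Alt_F_h_count[OF t] h_count_nonneg[of A] by simp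
      then show ?thesis using Alt_head(3)[OF f] by simp
    qed
    then show ?thesis unfolding circ_def fst_unsh snd_unsh by (auto intro!: unsh_eq_0)
  qed
  have 2: "fst (circ \<theta> f vs) = 0 \<and> (1 - (w + 1) < h_count vs \<longrightarrow> snd (circ \<theta> f vs) = 0)" for vs
  proof -
    have "fst (\<theta> (f A # B)) = 0" for A B using Alt_F_eq[OF t, of "f A # B"] by simp
    moreover have "\<theta> (f A # B) = 0" if m: "mset A + mset B = mset vs" and "1 - (w + 1) < h_count vs" for A B
    proof (cases "h_count B = 0")
      case True
      then have "- w < h_count A" using h_count_mset[OF m] that(2) by simp
      then have "fst (f A) = 0" using w unfolding weight_ge_def by auto
      then show ?thesis using Alt_F_slot[OF t, of "f A" "[]"] by simp
    next
      case False
      then have "0 < h_count (f A # B)" using h_count_nonneg[of B] by simp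
      then show ?thesis by (rule Alt_F_h_count[OF t])
    qed
    ultimately show ?thesis unfolding circ_def fst_unsh snd_unsh by (auto intro!: unsh_eq_0)
  qed
  show ?thesis
    unfolding weight_ge_def nr_eq[OF f tC] using 1 2 by (simp add: fst_sgnv snd_sgnv)
qed

lemma weight_fold:
  "f \<in> Alt d \<Longrightarrow> weight_ge w f \<Longrightarrow> (\<And>\<theta>. \<theta> \<in> set \<theta>s \<Longrightarrow> \<exists>e. \<theta> \<in> Alt_F e) \<Longrightarrow>
    weight_ge (w + int (length \<theta>s)) (foldl nr f \<theta>s)"
proof (induction \<theta>s arbitrary: f d w)
  case (Cons \<theta> \<theta>s)
  obtain e where t: "\<theta> \<in> Alt_F e" using Cons.prems(3)[of \<theta>] by auto
  then have "\<theta> \<in> Alt e" by (simp add: Alt_F_def)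
  from Cons.IH[OF nr_Alt[OF Cons.prems(1) this] weight_nr[OF Cons.prems(1,2) t]] Cons.prems(3)
  show ?case by (simp add: algebra_simps)
qed simp

text \<open>After \<open>n\<close> brackets the weight is at least \<open>n - d\<close>, while the
  part seen by \<open>projF\<close>, \<open>h\<close>-valued on arguments in \<open>g\<close>, has
  weight 1. Hence \<open>n > d + 1\<close> leaves nothing.\<close>

lemma projF_fold_nilpotent:
  assumes f: "f \<in> Alt_M d" and t: "\<And>\<theta>. \<theta> \<in> set \<theta>s \<Longrightarrow> \<exists>e. \<theta> \<in> Alt_F e"
    and len: "\<bar>d\<bar> + 1 < int (length \<theta>s)"
  shows "projF (foldl nr f \<theta>s) = 0"
proof (rule ext)
  fix vs
  have "f \<in> Alt d" using f by (simp add: Alt_M_def)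
  from weight_fold[OF this weight_Alt_M[OF f] t]
  have "weight_ge (- d + int (length \<theta>s)) (foldl nr f \<theta>s)" by simp
  moreover have "1 - (- d + int (length \<theta>s)) < h_count (map gpart vs)"
    using len h_count_nonneg[of "map gpart vs"] by simp
  ultimately have "snd (foldl nr f \<theta>s (map gpart vs)) = 0" unfolding weight_ge_def by blast
  then show "projF (foldl nr f \<theta>s) vs = 0 vs" by (simp add: projF_def zero_prod_def)
qed

lemma Alt_indep:
  assumes "finite D" "\<And>d. d \<in> D \<Longrightarrow> x d \<in> Alt d" "sum x D = 0" "d \<in> D"
  shows "x d = 0"
proof (rule ext)
  fix vs
  show "x d vs = 0 vs"
  proof (cases "int (length vs) = d + 1")
    case True
    have "0 = (\<Sum>d'\<in>D. x d' vs)" using assms(3) by (simp add: sum_fun_apply[symmetric])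
    also have "\<dots> = (\<Sum>d'\<in>D. if d' = d then x d vs else 0)"
      using True by (intro sum.cong) (auto intro: Alt_support[OF assms(2)])
    finally show ?thesis using assms(1,4) by simp
  qed (use Alt_support[OF assms(2)[OF assms(4)]] in auto)
qed

sublocale derived_data scaleA Alt Alt_M Alt_F nr projF
proof unfold_locales
  show "scaleA c f + g \<in> Alt_M d" if "f \<in> Alt_M d" "g \<in> Alt_M d" for f g c d
    using that by (auto simp: Alt_M_def Alt_lin projF_lin) (simp add: scaleA_def sV_def)+
  show "scaleA c f + g \<in> Alt_F d" if "f \<in> Alt_F d" "g \<in> Alt_F d" for f g c d
    using that by (auto simp: Alt_F_def Alt_lin projF_lin)
  show "sum x D = 0 \<Longrightarrow> x d = 0" if "finite D" "\<And>d. d \<in> D \<Longrightarrow> x d \<in> Alt d" "d \<in> D" for x D d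
    using Alt_indep that by blast
  show "f \<in> Alt_M d \<Longrightarrow> g \<in> Alt_M e \<Longrightarrow> nr f g \<in> Alt_M (d + e)" for f g d e by (rule nr_Alt_M)
  show "f \<in> Alt d \<Longrightarrow> projF f \<in> Alt_F d" for f d by (rule projF_Alt_F)
  show "f \<in> Alt_F d \<Longrightarrow> g \<in> Alt_F e \<Longrightarrow> nr f g = 0" for f g d e by (rule nr_Alt_F)
  show "projF (foldl nr f \<theta>s) = 0" if "f \<in> Alt_M d" "\<And>\<theta>. \<theta> \<in> set \<theta>s \<Longrightarrow> \<exists>e. \<theta> \<in> Alt_F e" "\<bar>d\<bar> + 1 < int (length \<theta>s)"
    for f d \<theta>s by (rule projF_fold_nilpotent[OF that])
qed (auto simp: Alt_zero projF_zero Alt_M_def Alt_F_def Alt_lin nr_Alt nr_lin_left nr_lin_right projF_lin projF_nr_zero projF_Alt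
      intro: nr_anti nr_jacobi)

end

section \<open>Identification of the graded space and the brackets\<close>

lemma lift_eq_unsh:
  "lift k l \<kappa> vs = unsh (\<lambda>_. 1) vs (\<lambda>A B. if length A = k \<and> length B = l
      then \<kappa> (map fst A) (map snd B) else 0)"
proof -
  have len: "length A + length B = length vs" if "mset A + mset B = mset vs" for A B
    using that mset_parts(3) by blast
  show ?thesis
  proof (cases "length vs = k + l")
    case True
    then have "lift k l \<kappa> vs = (\<Sum>\<tau>\<in>unshuffles k (length vs). psgn \<tau>
        (\<kappa> (map fst (take k (permute_list \<tau> vs))) (map snd (drop k (permute_list \<tau> vs)))))"
      by (simp add: lift_def)
    also have "\<dots> = unsh (\<lambda>_. 1) vs (\<lambda>A B. if length A = k then \<kappa> (map fst A) (map snd B) else 0)"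
      by (rule sum_unshuffles_psgn) (simp add: True)
    also have "\<dots> = unsh (\<lambda>_. 1) vs (\<lambda>A B. if length A = k \<and> length B = l then \<kappa> (map fst A) (map snd B) else 0)"
      apply (rule unsh_cong)
      subgoal for A B using len[of A B] True by auto
      done
    finally show ?thesis .
  next
    case False
    then have "unsh (\<lambda>_. 1) vs (\<lambda>A B. if length A = k \<and> length B = l then \<kappa> (map fst A) (map snd B) else 0) = 0"
      using len by (intro unsh_eq_0) auto
    then show ?thesis using False by (simp add: lift_def)
  qed
qed

lemma Pi_lift_eq: "Pi_lift \<pi> \<rho> \<mu> vs = (case vs of [v, w] \<Rightarrow>
    (\<pi> (fst v) (fst w), \<rho> (fst v) (snd w) - \<rho> (fst w) (snd v) + \<mu> (snd v) (snd w)) | _ \<Rightarrow> 0)"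
proof (cases "length vs = 2")
  case True
  then obtain v w where "vs = [v, w]" by (auto simp: numeral_2_eq_2 length_Suc_conv)
  then show ?thesis by (simp add: Pi_lift_def lift_eq_unsh numeral_2_eq_2)
next
  case False
  then have "Pi_lift \<pi> \<rho> \<mu> vs = 0" by (simp add: Pi_lift_def lift_def)
  then show ?thesis using False by (auto split: list.split)
qed

lemma D_lift_eq: "D_lift D vs = (case vs of [v] \<Rightarrow> (0, D (fst v)) | _ \<Rightarrow> 0)"
proof (cases "length vs = 1")
  case True
  then obtain v where "vs = [v]" by (auto simp: length_Suc_conv)
  then show ?thesis by (simp add: D_lift_def lift_eq_unsh)
next
  case False
  then have "D_lift D vs = 0" by (simp add: D_lift_def lift_def)
  then show ?thesis using False by (auto split: list.split)
qed

text \<open>Once an \<open>Inl\<close> has been chosen elsewhere, every further \<open>Inl\<close>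
  gives 0, so a single word of the multilinear expansion survives.\<close>

lemma sum_expand_single:
  assumes "\<And>ps. (\<exists>p\<in>set ps. isl p) \<Longrightarrow> G ps = 0"
  shows "sum_list (map G (expand xs)) = G (map (Inr \<circ> snd) xs)"
  using assms
proof (induction xs arbitrary: G)
  case (Cons x xs)
  have "sum_list (map (\<lambda>r. G (Inl (fst x) # r)) (expand xs)) = sum_list (map (\<lambda>r. 0) (expand xs))"
    by (intro arg_cong[where f = sum_list] map_cong refl Cons.prems) simp
  moreover have "sum_list (map (\<lambda>r. G (Inr (snd x) # r)) (expand xs)) = G (Inr (snd x) # map (Inr \<circ> snd) xs)"
    by (rule Cons.IH) (use Cons.prems in auto)
  ultimately show ?case by (simp add: comp_def)
qed simp

lemma length_expand: "ps \<in> set (expand xs) \<Longrightarrow> length ps = length xs"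
  by (induction xs arbitrary: ps) auto

lemma length_filter_indices: "length (filter (\<lambda>i. P (xs ! i)) [0..<length xs]) = length (filter P xs)"
proof -
  have "filter P (map (nth xs) [0..<length xs]) = map (nth xs) (filter (P \<circ> nth xs) [0..<length xs])"
    by (rule filter_map)
  then show ?thesis by (simp add: map_nth comp_def)
qed

lemma snd_lpure_zero:
  assumes "length (filter isl ps) \<noteq> 1"
  shows "snd (lpure ps) = 0"
proof -
  have "length (filter (\<lambda>i. isl (ps ! i)) [0..<length ps]) \<noteq> 1"
    using assms length_filter_indices[of isl ps] by simp
  moreover have "length ps = 1 \<Longrightarrow> \<not> isl (ps ! 0)"
    using assms by (cases ps) auto
  ultimately show ?thesis
    by (auto simp: lpure_def Let_def zero_fun_def split: sum.split)
qed

lemma fst_lpure_zero: "length ps \<noteq> 2 \<Longrightarrow> fst (lpure ps) = 0"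
  by (auto simp: lpure_def Let_def zero_fun_def split: sum.split)

text \<open>The sign is that of moving \<open>f\<close> in front of \<open>X\<close>. With
  \<open>X\<close> and \<open>Y\<close> empty, the fold is \<open>f\<close> itself and the formula
  covers the unary bracket.\<close>

lemma snd_lpure_single:
  "snd (lpure (map Inr X @ Inl f # map Inr Y))
   = sgnv (pdeg (Inl f :: ('g::ab_group_add, 'h::ab_group_add) cochain + ('g, 'h) cochain) * (\<Sum>\<theta>\<leftarrow>X. pdeg (Inr \<theta> :: ('g, 'h) cochain + ('g, 'h) cochain)))
      (projF (foldl nr f (X @ Y)))"
proof -
  let ?ps = "map Inr X @ Inl f # map Inr Y :: (('g, 'h) cochain + ('g, 'h) cochain) list"
  have e: "[0..<length ?ps] = [0..<length X] @ length X # [Suc (length X)..<length ?ps]"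
    using upt_add_eq_append[of 0 "length X" "Suc (length Y)"] upt_conv_Cons[of "length X" "length X + Suc (length Y)"]
    by (simp del: upt_Suc)
  have e1: "filter (\<lambda>i. isl (?ps ! i)) [0..<length X] = []"
    by (auto simp: filter_empty_conv nth_append)
  have e2: "filter (\<lambda>i. isl (?ps ! i)) [Suc (length X)..<length ?ps] = []"
    by (auto simp: filter_empty_conv nth_append nth_Cons split: nat.splits)
  have L: "filter (\<lambda>i. isl (?ps ! i)) [0..<length ?ps] = [length X]"
    unfolding e filter_append filter.simps e1 e2 by (simp add: nth_append)
  have th: "map projr (take (length X) ?ps @ drop (length X + 1) ?ps) = X @ Y"
    by (simp add: comp_def)
  have fsg: "fsg e \<theta> = sgnv e \<theta>" for e and \<theta> :: "('g, 'h) cochain"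
    by (rule ext) (simp add: fsg_def)
  show ?thesis
  proof (cases "X = [] \<and> Y = []")
    case True
    then show ?thesis by (simp add: lpure_def)
  next
    case False
    then have "length ?ps \<noteq> 1" "2 \<le> length ?ps" by (cases X; cases Y; simp)+
    then show ?thesis
      unfolding lpure_def Let_def L th by (simp add: fsg comp_def nth_append)
  qed
qed

context two_spaces
begin

section \<open>Blocks of multilinear maps, their lifts, and the decomposition of a cochain into
  lifts\<close>

lemma hom_blockD:
  assumes h: "hom_block sg sh k l \<kappa>" and xs: "length xs = k" and us: "length us = l"
  shows "i < k \<Longrightarrow> \<kappa> (xs[i := sg c a + b]) us = sv c (\<kappa> (xs[i := a]) us) + \<kappa> (xs[i := b]) us"
    and "i < l \<Longrightarrow> \<kappa> xs (us[i := sh c u + v]) = sv c (\<kappa> xs (us[i := u])) + \<kappa> xs (us[i := v])"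
    and "i < j \<Longrightarrow> j < k \<Longrightarrow> xs ! i = xs ! j \<Longrightarrow> \<kappa> xs us = 0"
    and "i < j \<Longrightarrow> j < l \<Longrightarrow> us ! i = us ! j \<Longrightarrow> \<kappa> xs us = 0"
proof -
  note * = h[unfolded hom_block_def, THEN spec[of _ xs], THEN spec[of _ us], THEN mp, OF conjI[OF xs us]]
  show "i < k \<Longrightarrow> \<kappa> (xs[i := sg c a + b]) us = sv c (\<kappa> (xs[i := a]) us) + \<kappa> (xs[i := b]) us"
    by (rule *[THEN conjunct1, rule_format])
  show "i < l \<Longrightarrow> \<kappa> xs (us[i := sh c u + v]) = sv c (\<kappa> xs (us[i := u])) + \<kappa> xs (us[i := v])"
    by (rule *[THEN conjunct2, THEN conjunct1, rule_format])
  show "i < j \<Longrightarrow> j < k \<Longrightarrow> xs ! i = xs ! j \<Longrightarrow> \<kappa> xs us = 0"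
    by (rule *[THEN conjunct2, THEN conjunct2, THEN conjunct1, rule_format, of i j]) simp
  show "i < j \<Longrightarrow> j < l \<Longrightarrow> us ! i = us ! j \<Longrightarrow> \<kappa> xs us = 0"
    by (rule *[THEN conjunct2, THEN conjunct2, THEN conjunct2, rule_format, of i j]) simp
qed

lemma hom_block_left:
  assumes "hom_block sg sh k l \<kappa>" "length X + length Y + 1 = k" "length us = l"
  shows "\<kappa> (X @ (sg c a + b) # Y) us = sv c (\<kappa> (X @ a # Y) us) + \<kappa> (X @ b # Y) us"
proof -
  have "length (X @ a # Y) = k" "length X < k" using assms(2) by auto
  then have "\<kappa> ((X @ a # Y)[length X := sg c a + b]) us
    = sv c (\<kappa> ((X @ a # Y)[length X := a]) us) + \<kappa> ((X @ a # Y)[length X := b]) us"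
    using hom_blockD(1)[OF assms(1) _ assms(3)] by blast
  then show ?thesis by simp
qed

lemma hom_block_right:
  assumes "hom_block sg sh k l \<kappa>" "length xs = k" "length X + length Y + 1 = l"
  shows "\<kappa> xs (X @ (sh c a + b) # Y) = sv c (\<kappa> xs (X @ a # Y)) + \<kappa> xs (X @ b # Y)"
proof -
  have "length (X @ a # Y) = l" "length X < l" using assms(3) by auto
  then have "\<kappa> xs ((X @ a # Y)[length X := sh c a + b])
    = sv c (\<kappa> xs ((X @ a # Y)[length X := a])) + \<kappa> xs ((X @ a # Y)[length X := b])"
    using hom_blockD(2)[OF assms(1,2)] by blast
  then show ?thesis by simp
qed

text \<open>Polarization: expand the value with \<open>a + b\<close> in both places. The length
  \<open>n\<close> is fixed because a block is constrained only on lists of its own arity.\<close>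

lemma alternating_swap:
  assumes add: "\<And>X a b Y. length X + length Y + 1 = n \<Longrightarrow> \<phi> (X @ (a + b) # Y) = (\<phi> (X @ a # Y) + \<phi> (X @ b # Y) :: 'w::ab_group_add)"
    and alt: "\<And>X a Y. length X + length Y + 2 = n \<Longrightarrow> \<phi> (X @ a # a # Y) = 0"
    and n: "length X + length Y + 2 = n"
  shows "\<phi> (X @ a # b # Y) = - \<phi> (X @ b # a # Y)"
proof -
  have "0 = \<phi> (X @ (a + b) # (a + b) # Y)" using alt n by simp
  also have "\<dots> = \<phi> (X @ a # (a + b) # Y) + \<phi> (X @ b # (a + b) # Y)"
    using add[of X "(a + b) # Y" a b] n by simp
  also have "\<dots> = \<phi> (X @ a # a # Y) + \<phi> (X @ a # b # Y) + (\<phi> (X @ b # a # Y) + \<phi> (X @ b # b # Y))"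
    using add[of "X @ [a]" Y a b] add[of "X @ [b]" Y a b] n by simp
  also have "\<dots> = \<phi> (X @ a # b # Y) + \<phi> (X @ b # a # Y)"
    using alt n by simp
  finally show ?thesis by (simp add: eq_neg_iff_add_eq_0)
qed

lemma hom_block_swap_left:
  assumes h: "hom_block sg sh k l \<kappa>" and "length X + length Y + 2 = k" "length us = l"
  shows "\<kappa> (X @ a # b # Y) us = - \<kappa> (X @ b # a # Y) us"
proof (rule alternating_swap[where \<phi> = "\<lambda>xs. \<kappa> xs us" and n = k])
  show "\<kappa> (X @ (a + b) # Y) us = \<kappa> (X @ a # Y) us + \<kappa> (X @ b # Y) us"
    if "length X + length Y + 1 = k" for X a b Y
    using hom_block_left[OF h that assms(3), of 1] by simp
  show "\<kappa> (X @ a # a # Y) us = 0" if l: "length X + length Y + 2 = k" for X a Y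
  proof -
    have "(X @ a # a # Y) ! length X = (X @ a # a # Y) ! Suc (length X)" by (simp add: nth_append)
    moreover have "length (X @ a # a # Y) = k" "length X < Suc (length X)" "Suc (length X) < k" using l by auto
    ultimately show ?thesis using hom_blockD(3)[OF h _ assms(3)] by blast
  qed
qed fact

lemma hom_block_swap_right:
  assumes h: "hom_block sg sh k l \<kappa>" and "length xs = k" "length X + length Y + 2 = l"
  shows "\<kappa> xs (X @ a # b # Y) = - \<kappa> xs (X @ b # a # Y)"
proof (rule alternating_swap[where \<phi> = "\<lambda>us. \<kappa> xs us" and n = l])
  show "\<kappa> xs (X @ (a + b) # Y) = \<kappa> xs (X @ a # Y) + \<kappa> xs (X @ b # Y)"
    if "length X + length Y + 1 = l" for X a b Y
    using hom_block_right[OF h assms(2) that, of 1] by simp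
  show "\<kappa> xs (X @ a # a # Y) = 0" if l: "length X + length Y + 2 = l" for X a Y
  proof -
    have "(X @ a # a # Y) ! length X = (X @ a # a # Y) ! Suc (length X)" by (simp add: nth_append)
    moreover have "length (X @ a # a # Y) = l" "length X < Suc (length X)" "Suc (length X) < l" using l by auto
    ultimately show ?thesis using hom_blockD(4)[OF h assms(2)] by blast
  qed
qed fact

lemma hom_block_zero_right:
  assumes "hom_block sg sh k l \<kappa>" "length xs = k" "length X + length Y + 1 = l"
  shows "\<kappa> xs (X @ 0 # Y) = 0"
  using hom_block_right[OF assms, of 1 0 0] by simp

lemma fst_sv: "fst (sv c a) = sg c (fst a)" and snd_sv: "snd (sv c a) = sh c (snd a)"
  by (simp_all add: sV_def)

lemma lift_Alt:
  assumes h: "hom_block sg sh k l \<kappa>" and n: "k + l = n" "1 \<le> n"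
  shows "lift k l \<kappa> \<in> Alt (int n - 1)"
  unfolding Alt_def
proof (intro CollectI conjI allI impI)
  show "lift k l \<kappa> vs = 0" if "vs = [] \<or> int (length vs) \<noteq> int n - 1 + 1" for vs
    using that n by (auto simp: lift_def)
next
  fix X Y c a b
  let ?F = "\<lambda>A B. if length A = k \<and> length B = l then \<kappa> (map fst A) (map snd B) else 0"
  show "lift k l \<kappa> (X @ (sv c a + b) # Y) = sv c (lift k l \<kappa> (X @ a # Y)) + lift k l \<kappa> (X @ b # Y)"
    unfolding lift_eq_unsh
  proof (rule V.unsh_linear[where S = UNIV])
    show "?F (X @ (sv c a + b) # Y) B = sv c (?F (X @ a # Y) B) + ?F (X @ b # Y) B" for X Y B
      using hom_block_left[OF h, of "map fst X" "map fst Y" "map snd B" c "fst a" "fst b"]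
      by (simp add: fst_sv)
    show "?F A (X @ (sv c a + b) # Y) = sv c (?F A (X @ a # Y)) + ?F A (X @ b # Y)" for A X Y
      using hom_block_right[OF h, of "map fst A" "map snd X" "map snd Y" c "snd a" "snd b"]
      by (simp add: snd_sv)
  qed auto
next
  fix X a b Y
  let ?F = "\<lambda>A B. if length A = k \<and> length B = l then \<kappa> (map fst A) (map snd B) else 0"
  have "lift k l \<kappa> (X @ a # b # Y) = sgnv (1 * 1) (lift k l \<kappa> (X @ b # a # Y))"
    unfolding lift_eq_unsh
  proof (rule unsh_swap[where S = UNIV])
    show "?F (X @ u # v # Y) B = sgnv (1 * 1) (?F (X @ v # u # Y) B)" for X u v Y B
      using hom_block_swap_left[OF h, of "map fst X" "map fst Y" "map snd B" "fst u" "fst v"] by simp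
    show "?F A (X @ u # v # Y) = sgnv (1 * 1) (?F A (X @ v # u # Y))" for A X u v Y
      using hom_block_swap_right[OF h, of "map fst A" "map snd X" "map snd Y" "snd u" "snd v"] by simp
  qed simp
  then show "lift k l \<kappa> (X @ a # b # Y) = - lift k l \<kappa> (X @ b # a # Y)" by simp
qed

lemma Alt_move: "f \<in> Alt d \<Longrightarrow> f (X @ a # Y @ Z) = sgnv (int (length Y)) (f (X @ Y @ a # Z))"
proof (induction Y arbitrary: X)
  case (Cons y Y)
  have "f ((X @ [y]) @ a # Y @ Z) = sgnv (int (length Y)) (f ((X @ [y]) @ Y @ a # Z))"
    by (rule Cons.IH[OF Cons.prems])
  then show ?case using Alt_swap[OF Cons.prems, of X a y "Y @ Z"] by (simp add: sgnv_1_add)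
qed simp

text \<open>With the equal entries made adjacent, a swap shows that twice the value is 0, and 2 is
  invertible in characteristic 0.\<close>

lemma Alt_alternating:
  assumes f: "f \<in> Alt d" and ij: "i < j" "j < length vs" "vs ! i = vs ! j"
  shows "f vs = 0"
proof -
  obtain X a Y Z where vs: "vs = X @ a # Y @ a # Z"
  proof
    have "vs = take i vs @ vs ! i # drop (Suc i) vs" using ij by (intro id_take_nth_drop) simp
    also have "drop (Suc i) vs = take (j - Suc i) (drop (Suc i) vs) @ vs ! j # drop (Suc j) vs"
      using ij id_take_nth_drop[of "j - Suc i" "drop (Suc i) vs"] by simp
    finally show "vs = take i vs @ vs ! i # take (j - Suc i) (drop (Suc i) vs) @ vs ! i # drop (Suc j) vs"
      using ij by simp
  qed
  have "f (X @ Y @ a # a # Z) = - f (X @ Y @ a # a # Z)" using Alt_swap[OF f, of "X @ Y" a a Z] by simp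
  then have "f (X @ Y @ a # a # Z) + f (X @ Y @ a # a # Z) = 0" by (simp add: eq_neg_iff_add_eq_0)
  then have "sv 2 (f (X @ Y @ a # a # Z)) = 0"
    using V.scale_left_distrib[of 1 1 "f (X @ Y @ a # a # Z)"] by simp
  then have "f (X @ Y @ a # a # Z) = 0" by simp
  then show ?thesis unfolding vs using Alt_move[OF f, of X a Y "a # Z"] by simp
qed

abbreviation inh :: "'h \<Rightarrow> 'g \<times> 'h" where "inh u \<equiv> (0, u)"
abbreviation ing :: "'g \<Rightarrow> 'g \<times> 'h" where "ing x \<equiv> (x, 0)"

text \<open>Every argument is the sum of its parts in \<open>g\<close> and \<open>h\<close>; moving
  the \<open>g\<close>-parts to the front costs the signs of the splitting. So \<open>f\<close> is
  the sum of the lifts of its restrictions to blocks.\<close>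

lemma Alt_decompose:
  assumes f: "f \<in> Alt d"
  shows "f (X @ vs) = unsh (\<lambda>_. 1) vs (\<lambda>A B. f (X @ map (ing \<circ> fst) A @ map (inh \<circ> snd) B))"
proof (induction vs arbitrary: X)
  case (Cons v vs)
  have "f (X @ v # vs) = f (X @ (ing (fst v) + inh (snd v)) # vs)" by simp
  also have "\<dots> = f ((X @ [ing (fst v)]) @ vs) + f ((X @ [inh (snd v)]) @ vs)"
    unfolding Alt_add[OF f] by simp
  also have "f ((X @ [inh (snd v)]) @ vs)
     = unsh (\<lambda>_. 1) vs (\<lambda>A B. sgnv (1 * tdeg (\<lambda>_. 1) A) (f (X @ map (ing \<circ> fst) A @ map (inh \<circ> snd) (v # B))))"
    unfolding Cons.IH
    by (rule unsh_cong) (simp add: tdeg_one Alt_move[OF f])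
  also have "f ((X @ [ing (fst v)]) @ vs) = unsh (\<lambda>_. 1) vs (\<lambda>A B. f (X @ map (ing \<circ> fst) (v # A) @ map (inh \<circ> snd) B))"
    unfolding Cons.IH by simp
  finally show ?case by (simp add: comp_def)
qed simp

text \<open>Restriction of a cochain to arguments from \<open>g\<close> followed by arguments from
  \<open>h\<close>. The linear map \<open>\<psi>\<close> stands for the choice of the
  \<open>g\<close>- or \<open>h\<close>-component of the value.\<close>

lemma hom_block_Alt:
  assumes f: "f \<in> Alt d" and \<psi>: "\<And>c x y. \<psi> (sv c x + y) = sv c (\<psi> x) + \<psi> y"
  shows "hom_block sg sh k l (\<lambda>xs us. \<psi> (f (map ing xs @ map inh us)))"
  unfolding hom_block_def
proof (intro allI impI conjI; elim conjE)
  fix xs :: "'g list" and us :: "'h list"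
  have \<psi>0: "\<psi> 0 = 0" using \<psi>[of 1 0 0] by simp
  assume xs: "length xs = k" and us: "length us = l"
  show "\<psi> (f (map ing (xs[i := sg c a + b]) @ map inh us)) =
     sv c (\<psi> (f (map ing (xs[i := a]) @ map inh us))) + \<psi> (f (map ing (xs[i := b]) @ map inh us))"
    if "i < k" for i a b c
  proof -
    have u: "map ing (xs[i := y]) @ map inh us = map ing (take i xs) @ ing y # map ing (drop (Suc i) xs) @ map inh us" for y
      using that xs by (simp add: upd_conv_take_nth_drop)
    have "ing (sg c a + b) = sv c (ing a) + ing b" by (simp add: sV_def)
    then show ?thesis unfolding u by (simp add: Alt_linear[OF f] \<psi>)
  qed
  show "\<psi> (f (map ing xs @ map inh (us[i := sh c a + b]))) =
     sv c (\<psi> (f (map ing xs @ map inh (us[i := a])))) + \<psi> (f (map ing xs @ map inh (us[i := b])))"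
    if "i < l" for i a b c
  proof -
    have u: "map ing xs @ map inh (us[i := y]) = (map ing xs @ map inh (take i us)) @ inh y # map inh (drop (Suc i) us)" for y
      using that us by (simp add: upd_conv_take_nth_drop)
    have "inh (sh c a + b) = sv c (inh a) + inh b" by (simp add: sV_def)
    then show ?thesis unfolding u by (simp only: Alt_linear[OF f] \<psi>)
  qed
  show "\<psi> (f (map ing xs @ map inh us)) = 0" if "i < j" "j < k" "xs ! i = xs ! j" for i j
    using Alt_alternating[OF f, of i j "map ing xs @ map inh us"] that xs by (simp add: nth_append \<psi>0)
  show "\<psi> (f (map ing xs @ map inh us)) = 0" if "i < j" "j < l" "us ! i = us ! j" for i j
    using Alt_alternating[OF f, of "k + i" "k + j" "map ing xs @ map inh us"] that xs us by (simp add: nth_append \<psi>0)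
qed

lemma Alt_sum: "(\<And>i. i \<in> I \<Longrightarrow> f i \<in> Alt d) \<Longrightarrow> (\<lambda>vs. \<Sum>i\<in>I. f i vs) \<in> Alt d"
proof (induction I rule: infinite_finite_induct)
  case (insert i I)
  then have "f i + (\<lambda>vs. \<Sum>i\<in>I. f i vs) \<in> Alt d" by (intro L_add) auto
  then show ?case using insert by (simp add: plus_fun_def)
qed (use Alt_zero in \<open>simp_all add: zero_fun_def\<close>)

lemma lift_gparts_zero:
  assumes "hom_block sg sh k l \<kappa>" "1 \<le> l"
  shows "lift k l \<kappa> (map gpart vs) = 0"
  unfolding lift_eq_unsh unsh_map
proof (rule unsh_eq_0)
  fix A B
  show "(if length (map gpart A) = k \<and> length (map gpart B) = l
      then \<kappa> (map fst (map gpart A)) (map snd (map gpart B)) else 0) = 0"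
  proof (cases "length A = k \<and> length B = l")
    case True
    then obtain b B' where "B = b # B'" using assms(2) by (cases B) auto
    then show ?thesis
      using True hom_block_zero_right[OF assms(1), of "map fst A" "[]" "map snd (map gpart B')"]
      by (simp add: comp_def)
  qed auto
qed

text \<open>A lift with at least one argument in \<open>h\<close> vanishes on
  \<open>g\<close>-parts, which isolates the \<open>g\<close>-valued block. Conversely, the blocks
  are recovered as restrictions of \<open>f\<close> through \<open>Alt_decompose\<close>.\<close>

lemma inM_iff:
  assumes n: "1 \<le> n"
  shows "inM sg sh n f \<longleftrightarrow> f \<in> Alt_M (int n - 1)"
proof
  assume "inM sg sh n f"
  then obtain \<kappa>0 \<kappa> where k0: "hom_block sg sh n 0 \<kappa>0" "g_valued \<kappa>0"
    and k: "\<And>j. j \<in> {1..n} \<Longrightarrow> hom_block sg sh (n - j) j (\<kappa> j) \<and> h_valued (\<kappa> j)"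
    and f: "f = (\<lambda>vs. lift n 0 \<kappa>0 vs + (\<Sum>j\<in>{1..n}. lift (n - j) j (\<kappa> j) vs))"
    unfolding inM_def by blast
  have "lift n 0 \<kappa>0 + (\<lambda>vs. \<Sum>j\<in>{1..n}. lift (n - j) j (\<kappa> j) vs) \<in> Alt (int n - 1)"
    by (intro L_add lift_Alt Alt_sum) (use k0 k n in auto)
  then have C: "f \<in> Alt (int n - 1)" unfolding f plus_fun_def .
  have g: "f (map gpart vs) = lift n 0 \<kappa>0 (map gpart vs)" for vs
    unfolding f using k by (simp add: lift_gparts_zero)
  have s0: "snd (lift n 0 \<kappa>0 vs) = 0" for vs
    unfolding lift_eq_unsh snd_unsh by (rule unsh_eq_0) (use k0(2) in \<open>auto simp: g_valued_def\<close>)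
  have fk: "fst (lift (n - j) j (\<kappa> j) vs) = 0" if "j \<in> {1..n}" for j vs
    unfolding lift_eq_unsh fst_unsh by (rule unsh_eq_0) (use k[OF that] in \<open>auto simp: h_valued_def\<close>)
  have "lift n 0 \<kappa>0 (map gpart vs) = lift n 0 \<kappa>0 vs" for vs
    unfolding lift_eq_unsh unsh_map by (simp add: comp_def cong: if_cong)
  moreover have "fst (f vs) = fst (lift n 0 \<kappa>0 vs)" for vs
    unfolding f by (simp add: fst_sum fk)
  ultimately show "f \<in> Alt_M (int n - 1)"
    using C g s0 by (auto simp: Alt_M_def fun_eq_iff projF_eq[OF C] zero_prod_def)
next
  assume M: "f \<in> Alt_M (int n - 1)"
  then have C: "f \<in> Alt (int n - 1)" and P: "projF f = 0" and ff: "\<And>vs. fst (f vs) = fst (f (map gpart vs))"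
    unfolding Alt_M_def by blast+
  define \<kappa>0 where "\<kappa>0 = (\<lambda>xs (us :: 'h list). (fst (f (map ing xs @ map inh us)), 0 :: 'h))"
  \<comment> \<open>One map serves for all \<open>j\<close>: the lengths of \<open>xs\<close> and
    \<open>us\<close> already tell the blocks apart.\<close>
  define \<kappa> where "\<kappa> = (\<lambda>xs us. (0 :: 'g, snd (f (map ing xs @ map inh us))))"
  have h0: "hom_block sg sh n 0 \<kappa>0"
    unfolding \<kappa>0_def using hom_block_Alt[OF C, of gpart] by (simp add: sV_def)
  have hj: "hom_block sg sh (n - j) j \<kappa>" for j
    unfolding \<kappa>_def using hom_block_Alt[OF C, of "\<lambda>v. (0, snd v)"] by (simp add: sV_def)
  have s: "snd (f (map gpart vs)) = 0" for vs
    using projF_eq[OF C, of vs] P by (simp add: zero_prod_def)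
  have "f vs = lift n 0 \<kappa>0 vs + (\<Sum>j\<in>{1..n}. lift (n - j) j \<kappa> vs)" for vs
  proof -
    let ?gpt = "\<lambda>(A :: ('g \<times> 'h) list) (B :: ('g \<times> 'h) list). if length A = n \<and> length B = 0 then \<kappa>0 (map fst A) (map snd B) else 0"
    let ?hpt = "\<lambda>j (A :: ('g \<times> 'h) list) (B :: ('g \<times> 'h) list). if length A = n - j \<and> length B = j then \<kappa> (map fst A) (map snd B) else 0"
    have "f vs = unsh (\<lambda>_. 1) vs (\<lambda>A B. f (map (ing \<circ> fst) A @ map (inh \<circ> snd) B))"
      using Alt_decompose[OF C, of "[]" vs] by simp
    also have "\<dots> = unsh (\<lambda>_. 1) vs (\<lambda>A B. ?gpt A B
        + (\<Sum>j\<in>{1..n}. ?hpt j A B))"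
    proof (rule unsh_cong)
      fix A B :: "('g \<times> 'h) list"
      let ?w = "map (ing \<circ> fst) A @ map (inh \<circ> snd) B"
      show "f ?w = ?gpt A B
        + (\<Sum>j\<in>{1..n}. ?hpt j A B)"
      proof (cases "length A + length B = n")
        case False
        then have "f ?w = 0" using Alt_support[OF C, of ?w] by auto
        moreover have "(\<Sum>j\<in>{1..n}. ?hpt j A B) = 0"
          by (rule sum.neutral) (use False in auto)
        ultimately show ?thesis using False by auto
      next
        case True
        show ?thesis
        proof (cases B)
          case Nil
          then have "?w = map gpart A" by (simp add: comp_def)
          then have "f ?w = (fst (f ?w), 0)" using s[of A] by (simp add: prod_eq_iff)
          moreover have "(\<Sum>j\<in>{1..n}. ?hpt j A B) = 0"
            by (rule sum.neutral) (use Nil in auto)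
          ultimately show ?thesis using True Nil by (simp add: \<kappa>0_def)
        next
          case (Cons b B')
          \<comment> \<open>An argument taken from \<open>h\<close> has \<open>g\<close>-part 0.
            Since the \<open>g\<close>-component of \<open>f\<close> depends on
            \<open>g\<close>-parts only, the value lies in \<open>h\<close>.\<close>
          have "f (map gpart ?w) = 0"
            using Alt_slot_zero[OF C, of "map gpart (map (ing \<circ> fst) A)" "map gpart (map (inh \<circ> snd) B')"] Cons
            by (simp add: zero_prod_def)
          then have "f ?w = (0, snd (f ?w))" using ff[of ?w] by (simp add: prod_eq_iff)
          moreover have "length B \<in> {1..n}" "length A = n - length B" using True Cons by auto
          then have "(\<Sum>j\<in>{1..n}. ?hpt j A B)
             = (\<Sum>j\<in>{1..n}. if j = length B then \<kappa> (map fst A) (map snd B) else 0)"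
            by (intro sum.cong) auto
          ultimately show ?thesis using \<open>length B \<in> {1..n}\<close> Cons by (simp add: \<kappa>_def)
        qed
      qed
    qed
    also have "\<dots> = lift n 0 \<kappa>0 vs + (\<Sum>j\<in>{1..n}. lift (n - j) j \<kappa> vs)"
      unfolding unsh_add lift_eq_unsh by (subst unsh_sum) simp_all
    finally show ?thesis .
  qed
  then have "f = (\<lambda>vs. lift n 0 \<kappa>0 vs + (\<Sum>j\<in>{1..n}. lift (n - j) j \<kappa> vs))" by (rule ext)
  moreover have "g_valued \<kappa>0" "h_valued \<kappa>" by (simp_all add: g_valued_def h_valued_def \<kappa>0_def \<kappa>_def)
  ultimately show "inM sg sh n f"
    unfolding inM_def using n h0 hj by (intro conjI exI[of _ \<kappa>0] exI[of _ "\<lambda>_. \<kappa>"]) auto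
qed

lemma inF_iff:
  assumes n: "1 \<le> n"
  shows "inF sg sh n \<theta> \<longleftrightarrow> \<theta> \<in> Alt_F (int n - 1)"
proof
  assume "inF sg sh n \<theta>"
  then obtain \<kappa> where k: "hom_block sg sh n 0 \<kappa>" "h_valued \<kappa>" and \<theta>: "\<theta> = lift n 0 \<kappa>"
    unfolding inF_def by blast
  have C: "\<theta> \<in> Alt (int n - 1)" unfolding \<theta> using lift_Alt[OF k(1)] n by simp
  have "\<theta> (map gpart vs) = \<theta> vs" for vs
    unfolding \<theta> lift_eq_unsh unsh_map by (simp add: comp_def cong: if_cong)
  moreover have "fst (\<theta> vs) = 0" for vs
    unfolding \<theta> lift_eq_unsh fst_unsh by (rule unsh_eq_0) (use k(2) in \<open>auto simp: h_valued_def\<close>)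
  ultimately have "projF \<theta> = \<theta>" by (auto simp: projF_eq[OF C] fun_eq_iff prod_eq_iff)
  then show "\<theta> \<in> Alt_F (int n - 1)" using C by (simp add: Alt_F_def)
next
  assume F: "\<theta> \<in> Alt_F (int n - 1)"
  then have C: "\<theta> \<in> Alt (int n - 1)" by (simp add: Alt_F_def)
  define \<kappa> where "\<kappa> = (\<lambda>xs us. (0 :: 'g, snd (\<theta> (map ing xs @ map inh us))))"
  have "hom_block sg sh n 0 \<kappa>"
    unfolding \<kappa>_def using hom_block_Alt[OF C, of "\<lambda>v. (0, snd v)"] by (simp add: sV_def)
  moreover have "h_valued \<kappa>" by (simp add: h_valued_def \<kappa>_def)
  moreover have "\<theta> vs = lift n 0 \<kappa> vs" for vs
  proof -
    have "lift n 0 \<kappa> vs = unsh (\<lambda>_. 1) vs (\<lambda>A B. if B = [] then (if length A = n then \<kappa> (map fst A) [] else 0) else 0)"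
      unfolding lift_eq_unsh by (rule unsh_cong) auto
    also have "\<dots> = (if length vs = n then \<kappa> (map fst vs) [] else 0)" by (rule unsh_Nil_right)
    also have "\<dots> = \<theta> vs"
      using Alt_support[OF C, of vs] Alt_F_eq[OF F, of vs] by (auto simp: \<kappa>_def comp_def)
    finally show ?thesis by simp
  qed
  then have "\<theta> = lift n 0 \<kappa>" by (rule ext)
  ultimately show "inF sg sh n \<theta>" unfolding inF_def using n by blast
qed

lemma Alt_neg: "f \<in> Alt d \<Longrightarrow> d < 0 \<Longrightarrow> f = 0"
proof (rule ext)
  fix vs :: "('g \<times> 'h) list" assume f: "f \<in> Alt d" and "d < 0"
  then have "vs = [] \<or> int (length vs) \<noteq> d + 1" by (cases vs) auto
  then show "f vs = 0 vs" using Alt_support[OF f] by simp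
qed

text \<open>\<open>Hdeg\<close> allows 0 in every degree and bounds the arities from below by 1;
  this agrees with \<open>H\<close> because \<open>Alt d\<close> is zero for negative
  \<open>d\<close>.\<close>

lemma Hdeg_eq: "Hdeg sg sh d = H d"
proof -
  have "(f = 0 \<or> 1 \<le> d + 2 \<and> inM sg sh (nat (d + 2)) f) \<longleftrightarrow> f \<in> Alt_M (d + 1)" for f
  proof (cases "1 \<le> d + 2")
    case True
    then have "inM sg sh (nat (d + 2)) f \<longleftrightarrow> f \<in> Alt_M (d + 1)" using inM_iff[of "nat (d + 2)" f] by (simp add: algebra_simps)
    then show ?thesis using True M_zero by auto
  next
    case False
    then show ?thesis using Alt_neg[of f "d + 1"] M_zero[of "d + 1"] M_L[of f "d + 1"] by auto
  qed
  moreover have "(\<theta> = 0 \<or> 1 \<le> d + 1 \<and> inF sg sh (nat (d + 1)) \<theta>) \<longleftrightarrow> \<theta> \<in> Alt_F d" for \<theta>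
  proof (cases "1 \<le> d + 1")
    case True
    then have "inF sg sh (nat (d + 1)) \<theta> \<longleftrightarrow> \<theta> \<in> Alt_F d" using inF_iff[of "nat (d + 1)" \<theta>] by simp
    then show ?thesis using True F_zero by auto
  next
    case False
    then show ?thesis using Alt_neg[of \<theta> d] F_zero[of d] F_L[of \<theta> d] by auto
  qed
  ultimately show ?thesis by (auto simp: Hdeg_def H_def)
qed

lemma arity_eq:
  assumes f: "f \<in> Alt d" "f \<noteq> 0"
  shows "int (arity f) = d + 1"
proof -
  obtain vs where "f vs \<noteq> 0" using f(2) by (auto simp: fun_eq_iff)
  then have vs: "int (length vs) = d + 1" using Alt_support[OF f(1)] by auto
  have "arity f = length vs"
    unfolding arity_def
  proof (rule Least_equality)
    show "\<exists>ws. length ws = length vs \<and> f ws \<noteq> 0" using \<open>f vs \<noteq> 0\<close> by blast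
    show "length vs \<le> m" if "\<exists>ws. length ws = m \<and> f ws \<noteq> 0" for m
    proof -
      from that obtain ws where "length ws = m" "f ws \<noteq> 0" by blast
      then have "int (length ws) = d + 1" using Alt_support[OF f(1), of ws] by blast
      then show ?thesis using vs \<open>length ws = m\<close> by simp
    qed
  qed
  then show ?thesis using vs by simp
qed

lemma ad_fold_theta_zero:
  assumes "f \<in> Alt e" "set B \<subseteq> S" "z \<in> set B" "snd (snd z) = 0"
  shows "ad_fold f B = 0"
proof -
  obtain X Y where B: "B = X @ z # Y" using assms(3) by (auto dest: split_list)
  have "ad_fold f X \<in> Alt (e + tdeg fst X)" using assms B by (intro ad_fold_L) auto
  then have "nr (ad_fold f X) 0 = 0" by (rule br_zero_right)
  then show ?thesis using ad_fold_zero[of Y] assms(2,4) B by simp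
qed

text \<open>The signs in \<open>lpure\<close> use \<open>arity\<close>, which is unspecified for the zero cochain; all brackets with a
  zero argument vanish, so the tagged degrees may be used instead.\<close>

lemma snd_lbr_aux:
  assumes "set (pre @ zs) \<subseteq> S"
  shows "sum_list (map (\<lambda>ps. snd (lpure (map (Inr \<circ> snd \<circ> snd) pre @ ps))) (expand (map snd zs)))
    = unsh fst zs (\<lambda>A B. if length A = 1 then sgnv (tdeg fst A * tdeg fst pre) (projF (ad_fold (fst (snd (hd A))) (pre @ B))) else 0)"
  using assms
proof (induction zs arbitrary: pre)
  case Nil
  have "snd (lpure (map (Inr \<circ> snd \<circ> snd) pre)) = 0"
    by (rule snd_lpure_zero) (simp add: filter_map comp_def)
  then show ?case by (simp add: comp_def zero_fun_def)
next
  case (Cons z zs)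
  let ?I = "Inr \<circ> snd \<circ> snd :: int \<times> ('g, 'h) cochain \<times> ('g, 'h) cochain \<Rightarrow> ('g, 'h) cochain + ('g, 'h) cochain"
  let ?dl = "\<lambda>f. pdeg (Inl f :: ('g, 'h) cochain + ('g, 'h) cochain)"
  let ?dr = "\<lambda>\<theta>. pdeg (Inr \<theta> :: ('g, 'h) cochain + ('g, 'h) cochain)"
  let ?F = "\<lambda>pre A B. if length A = 1 then sgnv (tdeg fst A * tdeg fst pre) (projF (ad_fold (fst (snd (hd A))) (pre @ B))) else 0"
  let ?f = "fst (snd z)"
  have S: "set (pre @ zs) \<subseteq> S" "z \<in> S" using Cons.prems by auto
  have f: "?f \<in> Alt (fst z + 1)" by (rule M_L[OF S_M[OF S(2)]])
  have "sum_list (map (\<lambda>ps. snd (lpure (map ?I pre @ Inl ?f # ps))) (expand (map snd zs)))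
     = snd (lpure (map ?I pre @ Inl ?f # map (Inr \<circ> snd) (map snd zs)))"
  proof (rule sum_expand_single, rule snd_lpure_zero)
    fix ps :: "(('g, 'h) cochain + ('g, 'h) cochain) list" assume "\<exists>p\<in>set ps. isl p"
    then have "filter isl ps \<noteq> []" by (auto simp: filter_empty_conv)
    then show "length (filter isl (map ?I pre @ Inl ?f # ps)) \<noteq> 1" by simp
  qed
  also have "\<dots> = snd (lpure (map Inr (map (snd \<circ> snd) pre) @ Inl ?f # map Inr (map (snd \<circ> snd) zs)))"
    by (simp add: o_assoc)
  also have "\<dots> = sgnv (?dl ?f
      * (\<Sum>\<theta>\<leftarrow>map (snd \<circ> snd) pre. ?dr \<theta>)) (projF (ad_fold ?f (pre @ zs)))"
    unfolding snd_lpure_single ad_fold_def map_append ..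
  also have "\<dots> = sgnv (fst z * tdeg fst pre) (projF (ad_fold ?f (pre @ zs)))"
  proof (cases "ad_fold ?f (pre @ zs) = 0")
    case True
    then show ?thesis by (simp only: P_zero sgnv_zero)
  next
    case False
    then have "?f \<noteq> 0" using ad_fold_zero[OF S(1)] by auto
    then have 1: "?dl ?f = fst z"
      using arity_eq[OF f] by (simp add: pdeg_def)
    have "?dr (snd (snd y)) = fst y" if "y \<in> set pre" for y
    proof -
      have "snd (snd y) \<in> Alt (fst y)" using that S(1) by (intro F_L S_F) auto
      moreover have "snd (snd y) \<noteq> 0" using ad_fold_theta_zero[OF f S(1), of y] that False by auto
      ultimately show ?thesis using arity_eq by (simp add: pdeg_def)
    qed
    then have "(\<Sum>\<theta>\<leftarrow>map (snd \<circ> snd) pre. ?dr \<theta>) = tdeg fst pre"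
      unfolding tdeg_def by (simp add: comp_def cong: map_cong)
    then show ?thesis unfolding 1 by (simp only:)
  qed
  also have "\<dots> = unsh fst zs (\<lambda>A B. if A = [] then sgnv (fst z * tdeg fst pre) (projF (ad_fold ?f (pre @ B))) else 0)"
    by (rule unsh_Nil_left[symmetric])
  also have "\<dots> = unsh fst zs (\<lambda>A B. ?F pre (z # A) B)"
    by (rule unsh_cong) auto
  finally have 1: "sum_list (map (\<lambda>ps. snd (lpure (map ?I pre @ Inl ?f # ps))) (expand (map snd zs)))
     = unsh fst zs (\<lambda>A B. ?F pre (z # A) B)" .
  \<comment> \<open>The other half of the expansion uses \<open>z\<close> through its
    \<open>F\<close>-part, so \<open>z\<close> joins \<open>pre\<close> and the induction hypothesis
    applies.\<close>
  have "sum_list (map (\<lambda>ps. snd (lpure (map ?I (pre @ [z]) @ ps))) (expand (map snd zs)))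
     = unsh fst zs (?F (pre @ [z]))"
    by (rule Cons.IH) (use Cons.prems in auto)
  also have "\<dots> = unsh fst zs (\<lambda>A B. sgnv (fst z * tdeg fst A) (?F pre A (z # B)))"
    by (rule unsh_cong) (simp add: algebra_simps)
  finally have 2: "sum_list (map (\<lambda>ps. snd (lpure (map ?I (pre @ [z]) @ ps))) (expand (map snd zs)))
     = unsh fst zs (\<lambda>A B. sgnv (fst z * tdeg fst A) (?F pre A (z # B)))" .
  show ?case
    unfolding unsh.simps 1[symmetric] 2[symmetric] by (simp add: comp_def)
qed

lemma snd_sum_list: "snd (sum_list (map F xs)) = sum_list (map (\<lambda>x. snd (F x)) xs)"
  and fst_sum_list: "fst (sum_list (map F xs)) = sum_list (map (\<lambda>x. fst (F x)) xs)"
  by (induction xs) simp_all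

lemma lbr_eq:
  assumes zs: "set zs \<subseteq> S"
  shows "lbr (length zs) (map snd zs) = dbr zs"
proof (rule prod_eqI)
  have l: "lbr (length zs) (map snd zs) = sum_list (map lpure (expand (map snd zs)))"
    by (simp add: lbr_def)
  show "snd (lbr (length zs) (map snd zs)) = snd (dbr zs)"
    unfolding l snd_sum_list snd_dbr dbrF_def using snd_lbr_aux[of "[]" zs] zs
    by (simp cong: if_cong)
  show "fst (lbr (length zs) (map snd zs)) = fst (dbr zs)"
  proof (cases "length zs = 2")
    case False
    have "sum_list (map (\<lambda>ps. fst (lpure ps)) (expand (map snd zs))) = sum_list (map (\<lambda>ps. 0) (expand (map snd zs)))"
      by (intro arg_cong[where f = sum_list] map_cong refl fst_lpure_zero) (use False length_expand in force)
    then show ?thesis unfolding l fst_sum_list using False by (simp add: dbr_def)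
  next
    case True
    then obtain y z where yz: "zs = [y, z]" by (auto simp: numeral_2_eq_2 length_Suc_conv)
    have f: "fst (snd y) \<in> Alt (fst y + 1)" and g: "fst (snd z) \<in> Alt (fst z + 1)"
      using zs yz by (auto intro: M_L S_M)
    have upt2: "[0..<2] = [0, 1::nat]" by (simp add: upt_rec)
    have fsg: "fsg e \<theta> = sgnv e \<theta>" for e and \<theta> :: "('g, 'h) cochain"
      by (rule ext) (simp add: fsg_def)
    have "fst (lbr (length zs) (map snd zs)) = sgnv (int (arity (fst (snd y))) - 1) (nr (fst (snd y)) (fst (snd z)))"
      unfolding l unfolding yz by (simp add: lpure_def Let_def upt2 fsg zero_fun_def[symmetric])
    also have "\<dots> = sgnv (fst y + 1) (nr (fst (snd y)) (fst (snd z)))"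
    proof (cases "fst (snd y) = 0")
      case True
      then have "nr (fst (snd y)) (fst (snd z)) = 0" using br_zero_left[OF g] by simp
      then show ?thesis by (simp only: sgnv_zero)
    next
      case False
      then show ?thesis using arity_eq[OF f] by (simp add: add.commute)
    qed
    finally show ?thesis unfolding yz by (simp add: dbr_def)
  qed
qed

lemma scW_eq: "scW sg sh = (\<lambda>c w. (scaleA c (fst w), scaleA c (snd w)))"
  by (simp add: fun_eq_iff scW_def scaleA_def)

lemma nil_linfty_lbr: "nil_linfty (scW sg sh) (Hdeg sg sh) lbr"
proof -
  have "Hdeg sg sh = H" using Hdeg_eq by (rule ext)
  then show ?thesis unfolding scW_eq using nil_linfty_derived[of lbr, OF lbr_eq] by simp
qed

end

section \<open>Maurer-Cartan elements and relative difference Lie algebras\<close>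

context two_spaces
begin

lemma D_lift_Alt_F:
  assumes "lin_map sg sh D"
  shows "D_lift D \<in> Alt_F 0"
proof -
  have lin: "D (sg c x + y) = sh c (D x) + D y" for c x y using assms by (simp add: lin_map_def)
  have D: "D_lift D \<in> Alt 0"
    unfolding Alt_def
  proof (intro CollectI conjI allI impI)
    show "D_lift D vs = 0" if "vs = [] \<or> int (length vs) \<noteq> 0 + 1" for vs
      using that by (auto simp: D_lift_eq split: list.split)
    show "D_lift D (X @ (sv c a + b) # Y) = sv c (D_lift D (X @ a # Y)) + D_lift D (X @ b # Y)" for X Y c a b
      by (cases X; cases Y) (auto simp: D_lift_eq lin sV_def zero_prod_def split: list.split)
    show "D_lift D (X @ a # b # Y) = - D_lift D (X @ b # a # Y)" for X a b Y
      by (cases X) (auto simp: D_lift_eq split: list.split)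
  qed
  have "projF (D_lift D) vs = D_lift D vs" for vs
    by (auto simp: projF_eq[OF D] D_lift_eq zero_prod_def split: list.split)
  then show ?thesis using D by (auto simp: Alt_F_def)
qed

lemma bilinear_mapD:
  assumes "bilinear_map sa sb sc' \<beta>"
  shows "\<beta> (sa c x + x') y = sc' c (\<beta> x y) + \<beta> x' y" "\<beta> x (sb c z + z') = sc' c (\<beta> x z) + \<beta> x z'"
  using assms by (simp_all add: bilinear_map_def)

lemma bilinear_additive:
  assumes "bilinear_map sa sb sc' \<beta>" "vector_space sa" "vector_space sb" "vector_space sc'"
  shows "\<beta> (x + x') y = \<beta> x y + \<beta> x' y" "\<beta> z (y + y') = \<beta> z y + \<beta> z y'"
    "\<beta> 0 y = 0" "\<beta> z 0 = 0" "\<beta> (- x) y = - \<beta> x y" "\<beta> z (- y) = - \<beta> z y"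
    "\<beta> (x - x') y = \<beta> x y - \<beta> x' y" "\<beta> z (y - y') = \<beta> z y - \<beta> z y'"
proof -
  have one: "sa 1 x = x" "sb 1 y = y" "sc' 1 w = w" for x y w
    using assms(2-4) by (simp_all add: vector_space_def)
  have l: "\<beta> (x + x') y = \<beta> x y + \<beta> x' y" for x x' y
    using bilinear_mapD(1)[OF assms(1), of 1 x x' y] by (simp add: one)
  have r: "\<beta> z (y + y') = \<beta> z y + \<beta> z y'" for z y y'
    using bilinear_mapD(2)[OF assms(1), of z 1 y y'] by (simp add: one)
  have l0: "\<beta> 0 y = 0" for y using l[of 0 0 y] by simp
  have r0: "\<beta> z 0 = 0" for z using r[of z 0 0] by simp
  have lm: "\<beta> (- x) y = - \<beta> x y" for x y using l[of "- x" x y] l0 by (simp add: eq_neg_iff_add_eq_0)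
  have rm: "\<beta> z (- y) = - \<beta> z y" for z y using r[of z "- y" y] r0 by (simp add: eq_neg_iff_add_eq_0)
  show "\<beta> (x + x') y = \<beta> x y + \<beta> x' y" "\<beta> z (y + y') = \<beta> z y + \<beta> z y'"
    "\<beta> 0 y = 0" "\<beta> z 0 = 0" "\<beta> (- x) y = - \<beta> x y" "\<beta> z (- y) = - \<beta> z y"
    by (fact l r l0 r0 lm rm)+
  show "\<beta> (x - x') y = \<beta> x y - \<beta> x' y" "\<beta> z (y - y') = \<beta> z y - \<beta> z y'"
    using l[of x "- x'" y] r[of z y "- y'"] lm rm by simp_all
qed

end

text \<open>Multilinear data of the right type, with no identities imposed. The locale is
  instantiated for the given structure, for the perturbation, and for their sum.\<close>

locale structure_data = two_spaces sg sh
  for sg :: "'k::field_char_0 \<Rightarrow> 'g::ab_group_add \<Rightarrow> 'g" and sh :: "'k \<Rightarrow> 'h::ab_group_add \<Rightarrow> 'h" +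
  fixes \<pi> :: "'g \<Rightarrow> 'g \<Rightarrow> 'g" and \<mu> :: "'h \<Rightarrow> 'h \<Rightarrow> 'h" and \<rho> :: "'g \<Rightarrow> 'h \<Rightarrow> 'h" and D :: "'g \<Rightarrow> 'h"
  assumes \<pi>: "alt_bilinear sg \<pi>" and \<mu>: "alt_bilinear sh \<mu>" and \<rho>: "bilinear_map sg sh sh \<rho>"
    and D: "lin_map sg sh D"
begin

abbreviation \<Omega> where "\<Omega> \<equiv> Pi_lift \<pi> \<rho> \<mu>"
abbreviation \<Delta> where "\<Delta> \<equiv> D_lift D"

lemma \<pi>_bil: "bilinear_map sg sg sg \<pi>" and \<mu>_bil: "bilinear_map sh sh sh \<mu>"
  and \<pi>_self: "\<pi> x x = 0" and \<mu>_self: "\<mu> u u = 0"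
  using \<pi> \<mu> by (simp_all add: alt_bilinear_def)

lemmas \<pi>_add = bilinear_additive[OF \<pi>_bil G.vector_space_axioms G.vector_space_axioms G.vector_space_axioms]
lemmas \<mu>_add = bilinear_additive[OF \<mu>_bil K.vector_space_axioms K.vector_space_axioms K.vector_space_axioms]
lemmas \<rho>_add = bilinear_additive[OF \<rho> G.vector_space_axioms K.vector_space_axioms K.vector_space_axioms]

lemma \<pi>_skew: "\<pi> x y = - \<pi> y x"
proof -
  have "\<pi> x y + \<pi> y x = \<pi> (x + y) (x + y)" by (simp only: \<pi>_add(1,2)) (simp add: \<pi>_self)
  then show ?thesis unfolding eq_neg_iff_add_eq_0 \<pi>_self .
qed

lemma \<mu>_skew: "\<mu> u v = - \<mu> v u"
proof -
  have "\<mu> u v + \<mu> v u = \<mu> (u + v) (u + v)" by (simp only: \<mu>_add(1,2)) (simp add: \<mu>_self)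
  then show ?thesis unfolding eq_neg_iff_add_eq_0 \<mu>_self .
qed

lemma \<pi>_jacobiator: "\<pi> (\<pi> x y) z - \<pi> (\<pi> x z) y + \<pi> (\<pi> y z) x
    = - (\<pi> x (\<pi> y z) + \<pi> y (\<pi> z x) + \<pi> z (\<pi> x y))"
proof -
  have "\<pi> (\<pi> x y) z = - \<pi> z (\<pi> x y)" "\<pi> (\<pi> y z) x = - \<pi> x (\<pi> y z)" by (rule \<pi>_skew)+
  moreover have "\<pi> (\<pi> x z) y = \<pi> y (\<pi> z x)"
    using \<pi>_skew[of "\<pi> x z" y] \<pi>_skew[of x z] by (simp add: \<pi>_add)
  ultimately show ?thesis by simp
qed

lemma \<mu>_jacobiator: "\<mu> (\<mu> x y) z - \<mu> (\<mu> x z) y + \<mu> (\<mu> y z) x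
    = - (\<mu> x (\<mu> y z) + \<mu> y (\<mu> z x) + \<mu> z (\<mu> x y))"
proof -
  have "\<mu> (\<mu> x y) z = - \<mu> z (\<mu> x y)" "\<mu> (\<mu> y z) x = - \<mu> x (\<mu> y z)" by (rule \<mu>_skew)+
  moreover have "\<mu> (\<mu> x z) y = \<mu> y (\<mu> z x)"
    using \<mu>_skew[of "\<mu> x z" y] \<mu>_skew[of x z] by (simp add: \<mu>_add)
  ultimately show ?thesis by simp
qed

lemma D_zero: "D 0 = 0"
  using D[unfolded lin_map_def, THEN spec[of _ 1], THEN spec[of _ 0], THEN spec[of _ 0]] by simp

lemma Pi_pair: "\<Omega> [v, w] = (\<pi> (fst v) (fst w), \<rho> (fst v) (snd w) - \<rho> (fst w) (snd v) + \<mu> (snd v) (snd w))"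
  by (simp add: Pi_lift_eq)

lemma Pi_Alt_M: "\<Omega> \<in> Alt_M 1"
proof -
  have C: "\<Omega> \<in> Alt 1"
    unfolding Alt_def
  proof (intro CollectI conjI allI impI)
    show "\<Omega> vs = 0" if "vs = [] \<or> int (length vs) \<noteq> 1 + 1" for vs
      using that by (auto simp: Pi_lift_eq split: list.split)
    show "\<Omega> (X @ (sv c a + b) # Y) = sv c (\<Omega> (X @ a # Y)) + \<Omega> (X @ b # Y)" for X Y c a b
    proof (cases "length X + length Y = 1")
      case True
      then consider w where "X = []" "Y = [w]" | w where "X = [w]" "Y = []"
        by (cases X; cases Y) auto
      then show ?thesis
        by cases (auto simp: Pi_pair sV_def bilinear_mapD[OF \<pi>_bil] bilinear_mapD[OF \<mu>_bil] bilinear_mapD[OF \<rho>]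
            K.scale_right_distrib K.scale_right_diff_distrib)
    next
      case False
      then have "\<Omega> (X @ w # Y) = 0" for w
        by (cases X; cases Y) (auto simp: Pi_lift_eq split: list.split)
      then show ?thesis by simp
    qed
    show "\<Omega> (X @ a # b # Y) = - \<Omega> (X @ b # a # Y)" for X a b Y
    proof (cases "X = [] \<and> Y = []")
      case True
      then show ?thesis using \<pi>_skew[of "fst a" "fst b"] \<mu>_skew[of "snd a" "snd b"] by (simp add: Pi_pair)
    next
      case False
      then have "\<Omega> (X @ a # b # Y) = 0" for a b
        by (cases X) (auto simp: Pi_lift_eq split: list.split)
      then show ?thesis by simp
    qed
  qed
  have "projF \<Omega> vs = 0" for vs
    by (auto simp: projF_eq[OF C] Pi_lift_eq zero_prod_def \<rho>_add \<mu>_add split: list.split)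
  moreover have "fst (\<Omega> vs) = fst (\<Omega> (map gpart vs))" for vs
    by (auto simp: Pi_lift_eq split: list.split)
  ultimately show ?thesis using C by (auto simp: Alt_M_def)
qed

lemma Pi_Alt: "\<Omega> \<in> Alt 1" and Delta_Alt_F: "\<Delta> \<in> Alt_F 0" and Delta_Alt: "\<Delta> \<in> Alt 0"
  using Pi_Alt_M D_lift_Alt_F[OF D] by (auto simp: Alt_M_def Alt_F_def)

lemma element_H: "(\<Omega>, \<Delta>) \<in> H 0"
  using Pi_Alt_M Delta_Alt_F by (simp add: H_def)

text \<open>Brackets with more than three arguments vanish, and the unary one gives
  \<open>projF \<Omega> = 0\<close>. Which copy supplies its \<open>M\<close>-part can be chosen in
  \<open>n\<close> ways, so the coefficients are \<open>2 / 2! = 1\<close> and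
  \<open>3 / 3! = 1 / 2\<close>; the sign in the first component is that of the odd degree of
  \<open>\<Omega>\<close>.\<close>

lemma maurer_cartan_components:
  "maurer_cartan (scW sg sh) (Hdeg sg sh) lbr (\<Omega>, \<Delta>) \<longleftrightarrow>
    nr \<Omega> \<Omega> = 0 \<and> projF (nr \<Omega> \<Delta>) + scaleA (1 / 2) (projF (nr (nr \<Omega> \<Delta>) \<Delta>)) = 0"
proof -
  let ?z = "(0::int, \<Omega>, \<Delta>)"
  have HH: "Hdeg sg sh = H" using Hdeg_eq by (rule ext)
  have z: "?z \<in> S" using element_H by (simp add: S_def)
  have P0: "projF \<Omega> = 0" using Pi_Alt_M by (simp add: Alt_M_def)
  have half: "scaleA (1 / 2) (f + f) = f" for f
    using C.scale_left_distrib[of "1 / 2" "1 / 2" f] by (simp add: C.scale_right_distrib)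
  have third: "scaleA (1 / 6) (f + (f + f)) = scaleA (1 / 2) f" for f
    using C.scale_left_distrib[of "1 / 6" "1 / 6" f] C.scale_left_distrib[of "1 / 6" "1 / 6 + 1 / 6" f]
    by (simp add: C.scale_right_distrib)
  have "maurer_cartan (scW sg sh) (Hdeg sg sh) lbr (\<Omega>, \<Delta>) \<longleftrightarrow>
    (\<Sum>n<4. scW sg sh (inverse (fact n)) (lbr (length (replicate n ?z)) (map snd (replicate n ?z)))) = 0"
    by (rule nil_linfty.maurer_cartan_iff[OF nil_linfty_lbr]) (simp_all add: HH element_H)
  also have "(\<Sum>n<4. scW sg sh (inverse (fact n)) (lbr (length (replicate n ?z)) (map snd (replicate n ?z))))
    = (\<Sum>n<4. scW sg sh (inverse (fact n)) (dbr (replicate n ?z)))"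
    by (intro sum.cong refl arg_cong[where f = "scW sg sh _"] lbr_eq) (use z in auto)
  also have "\<dots> = (scaleA (1 / 2) (- nr \<Omega> \<Omega>), projF (nr \<Omega> \<Delta>) + scaleA (1 / 2) (projF (nr (nr \<Omega> \<Delta>) \<Delta>)))"
    by (simp add: lessThan_Suc numeral_eq_Suc)
      (simp add: dbr_def dbrF_def P0 scW_eq half[simplified] third zero_prod_def)
  finally show ?thesis by (simp add: zero_prod_def)
qed

lemma circ_Pi_Pi: "circ \<Omega> \<Omega> [u, v, w] = \<Omega> [\<Omega> [u, v], w] - \<Omega> [\<Omega> [u, w], v] + \<Omega> [\<Omega> [v, w], u]"
proof -
  have z: "\<Omega> vs = 0" if "length vs \<noteq> 2" for vs using Alt_support[OF Pi_Alt, of vs] that by auto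
  have z2: "\<Omega> [0, w] = 0" for w using Alt_head(3)[OF Pi_Alt, of "[w]"] .
  show ?thesis by (simp add: circ_def z z2 sgnv_def)
qed

text \<open>\<open>\<Omega>\<close> has odd degree, so its bracket with itself is twice
  \<open>circ \<Omega> \<Omega>\<close>, a cochain with three arguments.\<close>

lemma nr_Pi_Pi_zero_iff: "nr \<Omega> \<Omega> = 0 \<longleftrightarrow> (\<forall>u v w. circ \<Omega> \<Omega> [u, v, w] = 0)"
proof -
  have e: "nr \<Omega> \<Omega> vs = sv 2 (circ \<Omega> \<Omega> vs)" for vs
    using nr_eq[OF Pi_Alt Pi_Alt, of vs] V.scale_left_distrib[of 1 1 "circ \<Omega> \<Omega> vs"] by simp
  have "circ \<Omega> \<Omega> vs = 0" if "\<forall>u v w. circ \<Omega> \<Omega> [u, v, w] = 0" for vs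
  proof (cases "length vs = 3")
    case True
    then show ?thesis using that by (auto simp: numeral_3_eq_3 length_Suc_conv)
  next
    case False
    then show ?thesis using Alt_support[OF circ_Alt[OF Pi_Alt Pi_Alt], of vs] by auto
  qed
  then show ?thesis by (auto simp: fun_eq_iff e)
qed

text \<open>Evaluation on pure vectors separates the conditions: three from \<open>g\<close> or
  three from \<open>h\<close> give the Jacobi identities, one from \<open>g\<close> and two from
  \<open>h\<close> the derivation rule, two from \<open>g\<close> and one from \<open>h\<close>
  compatibility with \<open>\<pi>\<close>. Conversely, these identities cancel the expression for
  arbitrary vectors.\<close>

lemma lie_iff:
  "nr \<Omega> \<Omega> = 0 \<longleftrightarrow> lie_algebra sg \<pi> \<and> lie_algebra sh \<mu> \<and> lie_action sg sh \<pi> \<mu> \<rho>"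
  unfolding nr_Pi_Pi_zero_iff
proof (intro iffI conjI)
  assume z: "\<forall>u v w. circ \<Omega> \<Omega> [u, v, w] = 0"
  have J\<pi>: "\<pi> x (\<pi> y z) + \<pi> y (\<pi> z x) + \<pi> z (\<pi> x y) = 0" for x y z
  proof -
    have "fst (circ \<Omega> \<Omega> [(x, 0), (y, 0), (z, 0)]) = 0" using z by simp
    then have "\<pi> (\<pi> x y) z - \<pi> (\<pi> x z) y + \<pi> (\<pi> y z) x = 0" by (simp add: circ_Pi_Pi Pi_pair)
    then show ?thesis unfolding \<pi>_jacobiator neg_equal_0_iff_equal .
  qed
  have J\<mu>: "\<mu> x (\<mu> y z) + \<mu> y (\<mu> z x) + \<mu> z (\<mu> x y) = 0" for x y z
  proof -
    have "snd (circ \<Omega> \<Omega> [(0, x), (0, y), (0, z)]) = 0" using z by simp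
    then have "\<mu> (\<mu> x y) z - \<mu> (\<mu> x z) y + \<mu> (\<mu> y z) x = 0"
      by (simp add: circ_Pi_Pi Pi_pair \<pi>_add \<rho>_add)
    then show ?thesis unfolding \<mu>_jacobiator neg_equal_0_iff_equal .
  qed
  show "lie_algebra sg \<pi>" using \<pi> J\<pi> by (simp add: lie_algebra_def)
  show "lie_algebra sh \<mu>" using \<mu> J\<mu> by (simp add: lie_algebra_def)
  have A1: "\<rho> x (\<mu> u v) = \<mu> (\<rho> x u) v + \<mu> u (\<rho> x v)" for x u v
  proof -
    have "snd (circ \<Omega> \<Omega> [(x, 0), (0, u), (0, v)]) = 0" using z by simp
    then have "\<mu> (\<rho> x u) v - \<mu> (\<rho> x v) u - \<rho> x (\<mu> u v) = 0"
      by (simp add: circ_Pi_Pi Pi_pair \<pi>_add \<rho>_add \<mu>_add)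
    then show ?thesis using \<mu>_skew[of "\<rho> x v" u] by (simp add: algebra_simps)
  qed
  have A2: "\<rho> (\<pi> x y) u = \<rho> x (\<rho> y u) - \<rho> y (\<rho> x u)" for x y u
  proof -
    have "snd (circ \<Omega> \<Omega> [(x, 0), (y, 0), (0, u)]) = 0" using z by simp
    then show ?thesis by (simp add: circ_Pi_Pi Pi_pair \<pi>_add \<rho>_add \<mu>_add algebra_simps)
  qed
  show "lie_action sg sh \<pi> \<mu> \<rho>" using \<rho> A1 A2 by (simp add: lie_action_def)
next
  assume "lie_algebra sg \<pi> \<and> lie_algebra sh \<mu> \<and> lie_action sg sh \<pi> \<mu> \<rho>"
  then have J\<pi>: "\<And>x y z. \<pi> x (\<pi> y z) + \<pi> y (\<pi> z x) + \<pi> z (\<pi> x y) = 0"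
    and J\<mu>: "\<And>x y z. \<mu> x (\<mu> y z) + \<mu> y (\<mu> z x) + \<mu> z (\<mu> x y) = 0"
    and A1: "\<And>x u v. \<rho> x (\<mu> u v) = \<mu> (\<rho> x u) v + \<mu> u (\<rho> x v)"
    and A2: "\<And>x y u. \<rho> (\<pi> x y) u = \<rho> x (\<rho> y u) - \<rho> y (\<rho> x u)"
    by (auto simp: lie_algebra_def lie_action_def)
  show "\<forall>u v w. circ \<Omega> \<Omega> [u, v, w] = 0"
  proof (intro allI prod_eqI)
    fix u v w :: "'g \<times> 'h"
    obtain x a y b z c where e: "u = (x, a)" "v = (y, b)" "w = (z, c)" by (cases u; cases v; cases w) blast
    show "fst (circ \<Omega> \<Omega> [u, v, w]) = fst 0"
      unfolding circ_Pi_Pi e Pi_pair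
      using \<pi>_jacobiator[of x y z] J\<pi>[of x y z] by simp
    have m: "\<mu> (\<mu> a b) c - \<mu> (\<mu> a c) b + \<mu> (\<mu> b c) a = 0"
      unfolding \<mu>_jacobiator J\<mu> by simp
    show "snd (circ \<Omega> \<Omega> [u, v, w]) = snd 0"
      unfolding circ_Pi_Pi e Pi_pair
      using m \<mu>_skew[of a "\<rho> z b"] \<mu>_skew[of a "\<rho> y c"] \<mu>_skew[of b "\<rho> x c"]
      by (simp add: \<rho>_add \<mu>_add A1 A2 algebra_simps)
  qed
qed

text \<open>On \<open>x\<close>, \<open>y\<close> in \<open>g\<close> the single bracket contributes
  \<open>\<rho> x (D y) - \<rho> y (D x) - D (\<pi> x y)\<close>. The double bracket replaces both
  arguments by their images under \<open>D\<close>, in either order, and contributes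
  \<open>2 \<mu> (D x) (D y)\<close>; the factor \<open>1 / 2\<close> removes the 2.\<close>

lemma difference_operator_iff:
  "projF (nr \<Omega> \<Delta>) + scaleA (1 / 2) (projF (nr (nr \<Omega> \<Delta>) \<Delta>)) = 0 \<longleftrightarrow> rel_diff_op sg sh \<pi> \<mu> \<rho> D"
proof -
  have z\<Omega>: "\<Omega> vs = 0" if "length vs \<noteq> 2" for vs using Alt_support[OF Pi_Alt, of vs] that by auto
  have z\<Delta>: "\<Delta> vs = 0" if "length vs \<noteq> 1" for vs using Alt_support[OF Delta_Alt, of vs] that by auto
  have \<Delta>: "\<Delta> [v] = (0, D (fst v))" for v by (simp add: D_lift_eq)
  define N where "N = nr \<Omega> \<Delta>"
  have N_CC: "N \<in> Alt 1" unfolding N_def using nr_Alt[OF Pi_Alt Delta_Alt] by simp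
  have zN: "N vs = 0" if "length vs \<noteq> 2" for vs using Alt_support[OF N_CC, of vs] that by auto
  have N: "N [v, w] = \<Omega> [(0, D (fst v)), w] - \<Omega> [(0, D (fst w)), v] - (0, D (\<pi> (fst v) (fst w)))" for v w
    using nr_eq[OF Pi_Alt Delta_Alt, of "[v, w]"]
    by (simp add: N_def circ_def z\<Omega> z\<Delta> \<Delta> Pi_pair)
  have N2_Alt: "nr N \<Delta> \<in> Alt 1" using nr_Alt[OF N_CC Delta_Alt] by simp
  have N2: "nr N \<Delta> [v, w] = N [(0, D (fst v)), w] - N [(0, D (fst w)), v] - (0, D (fst (N [v, w])))" for v w
    using nr_eq[OF N_CC Delta_Alt, of "[v, w]"]
    by (simp add: circ_def zN z\<Delta> \<Delta>)
  let ?T = "projF N + scaleA (1 / 2) (projF (nr N \<Delta>))"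
  have half: "sh (1 / 2) (u + u) = u" for u
    using K.scale_left_distrib[of "1 / 2" "1 / 2" u] by (simp add: K.scale_right_distrib)
  have T: "?T [v, w] = (0, \<rho> (fst v) (D (fst w)) - \<rho> (fst w) (D (fst v)) + \<mu> (D (fst v)) (D (fst w)) - D (\<pi> (fst v) (fst w)))"
    for v w
  proof -
    have 1: "snd (N [(fst v, 0), (fst w, 0)]) = \<rho> (fst v) (D (fst w)) - \<rho> (fst w) (D (fst v)) - D (\<pi> (fst v) (fst w))"
      by (simp add: N Pi_pair \<rho>_add \<mu>_add)
    have 2: "snd (nr N \<Delta> [(fst v, 0), (fst w, 0)]) = \<mu> (D (fst v)) (D (fst w)) + \<mu> (D (fst v)) (D (fst w))"
      using \<mu>_skew[of "D (fst w)" "D (fst v)"]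
      by (simp add: N2 N Pi_pair \<rho>_add \<mu>_add \<pi>_add D_zero)
    show ?thesis
      using 1 2 half by (simp add: projF_eq[OF N_CC] projF_eq[OF N2_Alt] scaleA_def sV_def)
  qed
  have T_CC: "?T \<in> Alt 1"
    using Alt_lin[OF projF_Alt[OF N2_Alt] projF_Alt[OF N_CC], of "1 / 2"] by (simp add: add.commute)
  have "?T = 0 \<longleftrightarrow> (\<forall>v w. ?T [v, w] = 0)"
  proof
    assume z: "\<forall>v w. ?T [v, w] = 0"
    show "?T = 0"
    proof (rule ext)
      fix vs
      show "?T vs = 0 vs"
      proof (cases "length vs = 2")
        case True
        then obtain v w where "vs = [v, w]" by (auto simp: numeral_2_eq_2 length_Suc_conv)
        moreover have "?T [v, w] = 0" using z by blast
        ultimately show ?thesis by (simp only: zero_fun_apply)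
      next
        case False
        then show ?thesis using Alt_support[OF T_CC, of vs] by simp
      qed
    qed
  qed simp
  also have "\<dots> \<longleftrightarrow> (\<forall>x y. D (\<pi> x y) = \<rho> x (D y) - \<rho> y (D x) + \<mu> (D x) (D y))"
    unfolding T by (auto simp: zero_prod_def)
  also have "\<dots> \<longleftrightarrow> rel_diff_op sg sh \<pi> \<mu> \<rho> D"
    using D by (simp add: rel_diff_op_def)
  finally show ?thesis unfolding N_def .
qed

theorem maurer_cartan_iff_rel_diff_lie:
  "maurer_cartan (scW sg sh) (Hdeg sg sh) lbr (\<Omega>, \<Delta>) \<longleftrightarrow> rel_diff_lie sg sh \<pi> \<mu> \<rho> D"
  unfolding maurer_cartan_components lie_iff difference_operator_iff rel_diff_lie_def by blast

end

section \<open>Perturbations of a relative difference Lie algebra\<close>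

lemma Pi_lift_add:
  "Pi_lift \<pi> \<rho> \<mu> + Pi_lift \<pi>' \<rho>' \<mu>' = Pi_lift (\<lambda>x y. \<pi> x y + \<pi>' x y) (\<lambda>x u. \<rho> x u + \<rho>' x u) (\<lambda>u v. \<mu> u v + \<mu>' u v)"
  by (rule ext) (simp add: Pi_lift_eq split: list.split)

lemma D_lift_add: "D_lift D + D_lift D' = D_lift (\<lambda>x. D x + D' x)"
  by (rule ext) (simp add: D_lift_eq split: list.split)

lemma bilinear_map_add:
  assumes "vector_space sc'" "bilinear_map sa sb sc' \<beta>" "bilinear_map sa sb sc' \<beta>'"
  shows "bilinear_map sa sb sc' (\<lambda>x y. \<beta> x y + \<beta>' x y)"
  using assms by (simp add: vector_space_def bilinear_map_def add.assoc add.left_commute)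

theorem theorem3p9:
  fixes sg :: "'k::field_char_0 \<Rightarrow> 'g::ab_group_add \<Rightarrow> 'g"
    and sh :: "'k \<Rightarrow> 'h::ab_group_add \<Rightarrow> 'h"
    and \<pi> :: "'g \<Rightarrow> 'g \<Rightarrow> 'g" and \<mu> :: "'h \<Rightarrow> 'h \<Rightarrow> 'h"
    and \<rho> :: "'g \<Rightarrow> 'h \<Rightarrow> 'h" and D :: "'g \<Rightarrow> 'h"
  assumes "vector_space sg" and "vector_space sh"
    and "rel_diff_lie sg sh \<pi> \<mu> \<rho> D"
  shows "twisting_finite (Hdeg sg sh) lbr (Pi_lift \<pi> \<rho> \<mu>, D_lift D)
       \<and> linfty_algebra (scW sg sh) (Hdeg sg sh) (twisted (scW sg sh) lbr (Pi_lift \<pi> \<rho> \<mu>, D_lift D))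
       \<and> (\<forall>\<pi>' \<mu>' \<rho>' D'. alt_bilinear sg \<pi>' \<and> alt_bilinear sh \<mu>'
             \<and> bilinear_map sg sh sh \<rho>' \<and> lin_map sg sh D' \<longrightarrow>
           (rel_diff_lie sg sh (\<lambda>x y. \<pi> x y + \<pi>' x y) (\<lambda>u v. \<mu> u v + \<mu>' u v)
                (\<lambda>x u. \<rho> x u + \<rho>' x u) (\<lambda>x. D x + D' x)
            \<longleftrightarrow> maurer_cartan (scW sg sh) (Hdeg sg sh)
                  (twisted (scW sg sh) lbr (Pi_lift \<pi> \<rho> \<mu>, D_lift D))
                  (Pi_lift \<pi>' \<rho>' \<mu>', D_lift D')))"
proof -
  interpret two_spaces sg sh by (rule two_spaces.intro) fact+
  interpret lbr: nil_linfty "scW sg sh" "Hdeg sg sh" lbr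
    "\<lambda>zs. lbr (length zs) (map snd zs)" "{z. snd z \<in> Hdeg sg sh (fst z)}"
    by (rule nil_linfty_lbr) auto
  have base: "structure_data sg sh \<pi> \<mu> \<rho> D"
    using assms(3) by unfold_locales
      (auto simp: rel_diff_lie_def lie_algebra_def lie_action_def rel_diff_op_def)
  let ?a = "(Pi_lift \<pi> \<rho> \<mu>, D_lift D)"
  have mc: "maurer_cartan (scW sg sh) (Hdeg sg sh) lbr ?a"
    using structure_data.maurer_cartan_iff_rel_diff_lie[OF base] assms(3) by blast
  have a: "?a \<in> Hdeg sg sh 0" using structure_data.element_H[OF base] by (simp add: Hdeg_eq)
  have "rel_diff_lie sg sh (\<lambda>x y. \<pi> x y + \<pi>' x y) (\<lambda>u v. \<mu> u v + \<mu>' u v)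
                (\<lambda>x u. \<rho> x u + \<rho>' x u) (\<lambda>x. D x + D' x)
            \<longleftrightarrow> maurer_cartan (scW sg sh) (Hdeg sg sh)
                  (twisted (scW sg sh) lbr ?a) (Pi_lift \<pi>' \<rho>' \<mu>', D_lift D')"
    if "alt_bilinear sg \<pi>'" "alt_bilinear sh \<mu>'" "bilinear_map sg sh sh \<rho>'" "lin_map sg sh D'"
    for \<pi>' \<mu>' \<rho>' D'
  proof -
    \<comment> \<open>From the perturbation itself only its type is used: it makes the corresponding
      pair an element of degree 0.\<close>
    have pert: "structure_data sg sh \<pi>' \<mu>' \<rho>' D'" using that by unfold_locales
    interpret base: structure_data sg sh \<pi> \<mu> \<rho> D by (rule base)
    have sum: "structure_data sg sh (\<lambda>x y. \<pi> x y + \<pi>' x y) (\<lambda>u v. \<mu> u v + \<mu>' u v)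
        (\<lambda>x u. \<rho> x u + \<rho>' x u) (\<lambda>x. D x + D' x)"
    proof unfold_locales
      show "alt_bilinear sg (\<lambda>x y. \<pi> x y + \<pi>' x y)"
        using that(1) base.\<pi> bilinear_map_add[OF G.vector_space_axioms, of sg sg \<pi> \<pi>'] by (simp add: alt_bilinear_def)
      show "alt_bilinear sh (\<lambda>u v. \<mu> u v + \<mu>' u v)"
        using that(2) base.\<mu> bilinear_map_add[OF K.vector_space_axioms, of sh sh \<mu> \<mu>'] by (simp add: alt_bilinear_def)
      show "bilinear_map sg sh sh (\<lambda>x u. \<rho> x u + \<rho>' x u)"
        by (rule bilinear_map_add[OF K.vector_space_axioms base.\<rho> that(3)])
      show "lin_map sg sh (\<lambda>x. D x + D' x)"
        using that(4) base.D by (simp add: lin_map_def K.scale_right_distrib add.assoc add.left_commute)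
    qed
    have a': "(Pi_lift \<pi>' \<rho>' \<mu>', D_lift D') \<in> Hdeg sg sh 0"
      using structure_data.element_H[OF pert] by (simp add: Hdeg_eq)
    \<comment> \<open>The Maurer-Cartan equation of the perturbation in the twisted algebra is that
      of the sum in the original one. As lifting is additive, this sum is the pair attached to the
      perturbed structure.\<close>
    show ?thesis
      unfolding lbr.maurer_cartan_twisted_iff[OF mc a'] plus_prod_def fst_conv snd_conv Pi_lift_add D_lift_add
      using structure_data.maurer_cartan_iff_rel_diff_lie[OF sum] by simp
  qed
  moreover have "linfty_algebra (scW sg sh) (Hdeg sg sh) (twisted (scW sg sh) lbr ?a)"
    by (rule nil_linfty.linfty[OF lbr.nil_linfty_twisted[OF mc]])
  ultimately show ?thesis using lbr.twisting_finite[OF a] by blast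
qed

end
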